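(* Let $l\ge2$. The graded dimensions of the principal subspaces of the level $1$ standard $\widehat{\mathfrak{sl}(l+1)}$-modules are given by $$\chi_0(x_1,\dots,x_l;q)=\sum_{r_1,\dots,r_l\ge0}\frac{q^{r_1^2+\cdots+r_l^2-r_2r_1-\cdots-r_lr_{l-1}}}{(q)_{r_1}\cdots(q)_{r_l}}x_1^{r_1}\cdots x_l^{r_l}$$ and, for any $j=1,\dots,l$, $$\chi_j'(x_1,\dots,x_l;q)=\sum_{r_1,\dots,r_l\ge0}\frac{q^{r_1^2+\cdots+r_l^2+r_j-r_2r_1-\cdots-r_lr_{l-1}}}{(q)_{r_1}\cdots(q)_{r_l}}x_1^{r_1}\cdots x_l^{r_l}.$$ In particular, for any $j=1,\dots,l$, $$\chi_j(x_1,\dots,x_l;q)=x_1^{\langle\lambda_1,\lambda_j\rangle}\cdots x_l^{\langle\lambda_l,\lambda_j\rangle}q^{\frac12\langle\lambda_j,\lambda_j\rangle}\chi_j'(x_1,\dots,x_l;q).$$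
   Context: Let $\mathfrak g=\mathfrak{sl}(l+1,\mathbb C)$ with Cartan subalgebra $\mathfrak h$ of diagonal matrices, simple roots $\alpha_1,\dots,\alpha_l$ labelled along the Dynkin diagram, positive roots $\Delta_+$, root vectors $x_\alpha$, invariant form $\langle\cdot,\cdot\rangle$ with $\langle\alpha_i,\alpha_i\rangle=2$ (identifying $\mathfrak h\simeq\mathfrak h^*$), fundamental weights $\lambda_1,\dots,\lambda_l$, and $\lambda_0=0$. $\widehat{\mathfrak g}=\mathfrak g\otimes\mathbb C[t,t^{-1}]\oplus\mathbb Cc$ with $c$ central and $[x\otimes t^m,y\otimes t^n]=[x,y]\otimes t^{m+n}+m\langle x,y\rangle\delta_{m+n,0}c$; $x(m)=x\otimes t^m$. For $0\le i\le l$, $L(\Lambda_i)$ is the level $1$ standard (irreducible integrable highest weight) $\widehat{\mathfrak g}$-module with highest weight vector $v_{\Lambda_i}$, which is annihilated by $\mathfrak g\otimes t\mathbb C[t]$ and by $x_\alpha(0)$, $\alpha\in\Delta_+$, and on which $\mathfrak h\otimes t^0$ acts by $\lambda_i$ and $c$ acts as $1$. Let $\mathfrak n=\sum_{\alpha\in\Delta_+}\mathbb Cx_\alpha$, $\bar{\mathfrak n}=\mathfrak n\otimes\mathbb C[t,t^{-1}]$, and $W(\Lambda_i)=U(\bar{\mathfrak n})\cdot v_{\Lambda_i}$ (the principal subspaces). Gradings: $W(\Lambda_i)$ is graded by weight (eigenvalues of the Virasoro operator $L(0)$) and by $l$ charges (eigenvalues of $\lambda_j(0)$, $1\le j\le l$).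 Explicitly, $x_{\gamma_1}(m_1)\cdots x_{\gamma_s}(m_s)\cdot v_{\Lambda_i}$ with $\gamma_p\in\Delta_+$ has weight $-(m_1+\cdots+m_s)+\frac12\langle\lambda_i,\lambda_i\rangle$ and $\lambda_j$-charge $\sum_p\langle\lambda_j,\gamma_p\rangle+\langle\lambda_j,\lambda_i\rangle$. The graded dimensions are $$\chi_i(x_1,\dots,x_l;q)=\mathrm{tr}|_{W(\Lambda_i)}x_1^{\lambda_1}\cdots x_l^{\lambda_l}q^{L(0)},\qquad 0\le i\le l,$$ i.e. the generating functions of the dimensions of the homogeneous subspaces, and for $1\le j\le l$ $$\chi_j'(x_1,\dots,x_l;q)=x_1^{-\langle\lambda_1,\lambda_j\rangle}\cdots x_l^{-\langle\lambda_l,\lambda_j\rangle}q^{-\frac12\langle\lambda_j,\lambda_j\rangle}\chi_j(x_1,\dots,x_l;q).$$ Here $x_1,\dots,x_l,q$ are formal variables, and $(q)_m=(1-q)(1-q^2)\cdots(1-q^m)$ for $m\ge 0$, with $(q)_0=1$. *)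

theory Defs
  imports
    "Jordan_Normal_Form.Matrix"
    "HOL-Computational_Algebra.Formal_Power_Series"
    "HOL-Library.Groups_Big_Fun"
    "HOL-Library.FuncSet"
begin

section \<open>The Lie algebra sl(l+1)\<close>

text \<open>Rows and columns are numbered from 0 to l, so that the simple root \<open>alpha_i\<close>
  (for i from 1 to l) is \<open>eps_(i-1) - eps_i\<close>.\<close>

definition mtrace :: "complex mat \<Rightarrow> complex" where
  "mtrace A = (\<Sum>p<dim_row A. A $$ (p, p))"

definition sl :: "nat \<Rightarrow> complex mat set" where
  "sl l = {A \<in> carrier_mat (l + 1) (l + 1). mtrace A = 0}"

definition cartan :: "nat \<Rightarrow> complex mat set" where
  "cartan l = {A \<in> sl l. diagonal_mat A}"

definition form :: "complex mat \<Rightarrow> complex mat \<Rightarrow> complex" where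
  "form A B = mtrace (A * B)"

text \<open>For \<open>p < q\<close> this is the root vector of the positive root \<open>eps_p - eps_q\<close>,
  and for \<open>q < p\<close> that of a negative root.\<close>

definition root_vec :: "nat \<Rightarrow> nat \<Rightarrow> nat \<Rightarrow> complex mat" where
  "root_vec l p q = mat (l + 1) (l + 1) (\<lambda>e. if e = (p, q) then 1 else 0)"

text \<open>Roots and weights are regarded as elements of the Cartan subalgebra by means of \<^term>\<open>form\<close>;
  as a linear functional, a weight \<open>mu\<close> takes the value \<open>form mu H\<close> at H.\<close>

definition simple_root :: "nat \<Rightarrow> nat \<Rightarrow> complex mat" where
  "simple_root l i = mat (l + 1) (l + 1)
     (\<lambda>(p, q). if p = q then (if p + 1 = i then 1 else if p = i then - 1 else 0) else 0)"

definition fund_weight :: "nat \<Rightarrow> nat \<Rightarrow> complex mat" where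
  "fund_weight l i = mat (l + 1) (l + 1)
     (\<lambda>(p, q). if p = q then (if p < i then 1 else 0) - of_nat i / of_nat (l + 1) else 0)"

lemma fund_weight_in_cartan: "i \<le> l \<Longrightarrow> fund_weight l i \<in> cartan l"
proof -
  assume i: "i \<le> l"
  have "(\<Sum>p<l + 1. (if p < i then 1 else 0) - of_nat i / of_nat (l + 1) :: complex)
      = (\<Sum>p<l + 1. if p < i then 1 else 0) - of_nat i"
    by (simp add: sum_subtractf del: of_nat_Suc of_nat_add sum.lessThan_Suc)
  also have "(\<Sum>p<l + 1. if p < i then 1 else 0 :: complex) = (\<Sum>p<i. 1)"
    using i by (intro sum.mono_neutral_cong_right) auto
  finally show ?thesis
    by (simp add: cartan_def sl_def mtrace_def fund_weight_def diagonal_mat_def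
        del: of_nat_Suc of_nat_add sum.lessThan_Suc)
qed

lemma fund_weight_0: "fund_weight l 0 = 0\<^sub>m (l + 1) (l + 1)"
  by (rule eq_matI) (auto simp: fund_weight_def)

lemma form_simple_root:
  assumes "j \<in> {1..l}" "A \<in> carrier_mat (l + 1) (l + 1)"
  shows "form A (simple_root l j) = A $$ (j - 1, j - 1) - A $$ (j, j)"
proof -
  have "form A (simple_root l j)
      = (\<Sum>p<l + 1. \<Sum>q<l + 1. A $$ (p, q) * simple_root l j $$ (q, p))"
    using assms by (simp add: form_def mtrace_def scalar_prod_def simple_root_def atLeast0LessThan
        del: sum.lessThan_Suc)
  also have "\<dots> = (\<Sum>p<l + 1. \<Sum>q<l + 1. if q = p then A $$ (p, p) * simple_root l j $$ (p, p) else 0)"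
    by (intro sum.cong refl) (auto simp: simple_root_def)
  also have "\<dots> = (\<Sum>p<l + 1. A $$ (p, p) * simple_root l j $$ (p, p))"
    by (intro sum.cong refl, subst sum.delta) auto
  also have "\<dots> = (\<Sum>p<l + 1. (if p = j - 1 then A $$ (p, p) else 0) - (if p = j then A $$ (p, p) else 0))"
    using assms by (intro sum.cong refl) (auto simp: simple_root_def)
  also have "\<dots> = A $$ (j - 1, j - 1) - A $$ (j, j)"
    using assms by (subst sum_subtractf, subst (1 2) sum.delta) auto
  finally show ?thesis .
qed

lemma fund_weight_dual:
  "i \<in> {1..l} \<Longrightarrow> j \<in> {1..l} \<Longrightarrow> form (fund_weight l i) (simple_root l j) = (if i = j then 1 else 0)"
  by (subst form_simple_root) (auto simp: fund_weight_def)

lemma simple_root_norm: "i \<in> {1..l} \<Longrightarrow> form (simple_root l i) (simple_root l i) = 2"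
  by (subst form_simple_root) (auto simp: simple_root_def)


section \<open>The affine Lie algebra\<close>

text \<open>The pair \<open>(f, a)\<close> stands for the sum of all \<open>f m \<otimes> t^m\<close>, plus \<open>a\<close> times \<open>c\<close>.\<close>

type_synonym affine = "(int \<Rightarrow> complex mat) \<times> complex"

definition aff :: "nat \<Rightarrow> affine set" where
  "aff l = {(f, a). (\<forall>m. f m \<in> sl l) \<and> finite {m. f m \<noteq> 0\<^sub>m (l + 1) (l + 1)}}"

definition aff_add :: "affine \<Rightarrow> affine \<Rightarrow> affine" where
  "aff_add X Y = (\<lambda>m. fst X m + fst Y m, snd X + snd Y)"

definition aff_scale :: "complex \<Rightarrow> affine \<Rightarrow> affine" where
  "aff_scale z X = (\<lambda>m. z \<cdot>\<^sub>m fst X m, z * snd X)"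

definition aff_bracket :: "nat \<Rightarrow> affine \<Rightarrow> affine \<Rightarrow> affine" where
  "aff_bracket l X Y =
     (let f = fst X; g = fst Y; S = {m. f m \<noteq> 0\<^sub>m (l + 1) (l + 1)}
      in (\<lambda>k. mat (l + 1) (l + 1) (\<lambda>e. \<Sum>m\<in>S. (f m * g (k - m) - g (k - m) * f m) $$ e),
          \<Sum>m\<in>S. of_int m * form (f m) (g (- m))))"

definition loop :: "nat \<Rightarrow> complex mat \<Rightarrow> int \<Rightarrow> affine" where
  "loop l x m = (\<lambda>k. if k = m then x else 0\<^sub>m (l + 1) (l + 1), 0)"

definition central :: "nat \<Rightarrow> affine" where
  "central l = (\<lambda>k. 0\<^sub>m (l + 1) (l + 1), 1)"

lemma aff_bracket_loop:
  assumes "x \<in> sl l" "y \<in> sl l"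
  shows "aff_bracket l (loop l x m) (loop l y n) =
    aff_add (loop l (x * y - y * x) (m + n))
      (aff_scale (if m + n = 0 then of_int m * form x y else 0) (central l))"
proof -
  obtain N where N: "l + 1 = N" by blast
  have x: "x \<in> carrier_mat N N" and y: "y \<in> carrier_mat N N"
    using assms by (auto simp: sl_def N[symmetric])
  have xz: "x * 0\<^sub>m N N = 0\<^sub>m N N" and zx: "0\<^sub>m N N * x = 0\<^sub>m N N"
    and zy: "0\<^sub>m N N * y = 0\<^sub>m N N" and yz: "y * 0\<^sub>m N N = 0\<^sub>m N N"
    using x y by auto
  have f0: "form x (0\<^sub>m N N) = 0" "form (0\<^sub>m N N) y = 0"
    by (simp_all add: form_def mtrace_def xz zy)
  have s: "a \<cdot>\<^sub>m 0\<^sub>m N N = 0\<^sub>m N N" for a :: complex by (intro eq_matI) auto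
  have mm: "0\<^sub>m N N - 0\<^sub>m N N = (0\<^sub>m N N :: complex mat)" by (intro eq_matI) auto
  have z: "A + 0\<^sub>m N N = A" if "A \<in> carrier_mat N N" for A :: "complex mat"
    using that by simp
  have c: "mat N N (\<lambda>e. A $$ e) = A" if "A \<in> carrier_mat N N" for A :: "complex mat"
    using that by (intro eq_matI) auto
  have d: "x * y - y * x \<in> carrier_mat N N" using x y by auto
  have c0: "mat N N (\<lambda>e. (0\<^sub>m N N - 0\<^sub>m N N) $$ e) = (0\<^sub>m N N :: complex mat)"
    by (intro eq_matI) auto
  let ?S = "{k. fst (loop l x m) k \<noteq> 0\<^sub>m (l + 1) (l + 1)}"
  have S: "?S = (if x = 0\<^sub>m N N then {} else {m})"
    by (auto simp: loop_def N simp del: One_nat_def)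
  have fm: "fst (loop l x m) m = x" by (simp add: loop_def)
  have rhs: "aff_add (loop l (x * y - y * x) (m + n))
      (aff_scale (if m + n = 0 then of_int m * form x y else 0) (central l))
    = (\<lambda>k. if k = m + n then x * y - y * x else 0\<^sub>m N N, if m + n = 0 then of_int m * form x y else 0)"
    using z[OF d] by (auto simp only: aff_add_def aff_scale_def central_def loop_def N s fst_conv snd_conv
        intro!: ext split: if_splits) auto
  have 1: "mat N N (\<lambda>e. \<Sum>i\<in>?S. (fst (loop l x m) i * fst (loop l y n) (k - i)
        - fst (loop l y n) (k - i) * fst (loop l x m) i) $$ e)
      = (if k = m + n then x * y - y * x else 0\<^sub>m N N)" for k
  proof (cases "x = 0\<^sub>m N N")
    case True
    then show ?thesis unfolding S using zy yz mm by (auto intro!: eq_matI)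
  next
    case False
    have "mat N N (\<lambda>e. (x * fst (loop l y n) (k - m) - fst (loop l y n) (k - m) * x) $$ e)
        = (if k = m + n then x * y - y * x else 0\<^sub>m N N)"
      using c[OF d] c0 xz zx by (auto simp: loop_def N simp del: One_nat_def index_zero_mat)
    then show ?thesis using False unfolding S by (simp add: fm)
  qed
  have 2: "(\<Sum>i\<in>?S. of_int i * form (fst (loop l x m) i) (fst (loop l y n) (- i)))
      = (if m + n = 0 then of_int m * form x y else 0)"
  proof (cases "x = 0\<^sub>m N N")
    case True
    then show ?thesis unfolding S using f0 by auto
  next
    case False
    have "- m = n \<longleftrightarrow> m + n = 0" by auto
    then have "form x (fst (loop l y n) (- m)) = (if m + n = 0 then form x y else 0)"
      using f0 by (simp add: loop_def N del: One_nat_def)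
    then show ?thesis using False unfolding S by (simp add: fm)
  qed
  show ?thesis
    unfolding rhs unfolding aff_bracket_def Let_def by (simp only: N 1[unfolded N] 2[unfolded N])
qed


section \<open>Level one standard modules\<close>

text \<open>The module is a whole type \<open>'v\<close> with scalar multiplication \<open>scale\<close>; the values of the action
  \<open>act\<close> outside \<^term>\<open>aff l\<close> are irrelevant.\<close>

definition aff_module ::
    "nat \<Rightarrow> (complex \<Rightarrow> 'v::ab_group_add \<Rightarrow> 'v) \<Rightarrow> (affine \<Rightarrow> 'v \<Rightarrow> 'v) \<Rightarrow> bool" where
  "aff_module l scale act \<longleftrightarrow>
     vector_space scale \<and>
     (\<forall>X\<in>aff l. Vector_Spaces.linear scale scale (act X)) \<and>
     (\<forall>X\<in>aff l. \<forall>Y\<in>aff l. \<forall>u. act (aff_add X Y) u = act X u + act Y u) \<and>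
     (\<forall>z. \<forall>X\<in>aff l. \<forall>u. act (aff_scale z X) u = scale z (act X u)) \<and>
     (\<forall>X\<in>aff l. \<forall>Y\<in>aff l. \<forall>u. act (aff_bracket l X Y) u = act X (act Y u) - act Y (act X u))"

definition irreducible_module ::
    "nat \<Rightarrow> (complex \<Rightarrow> 'v::ab_group_add \<Rightarrow> 'v) \<Rightarrow> (affine \<Rightarrow> 'v \<Rightarrow> 'v) \<Rightarrow> bool" where
  "irreducible_module l scale act \<longleftrightarrow>
     (\<exists>u::'v. u \<noteq> 0) \<and>
     (\<forall>S. module.subspace scale S \<and> (\<forall>X\<in>aff l. \<forall>u\<in>S. act X u \<in> S) \<longrightarrow> S = {0} \<or> S = UNIV)"

definition chevalley_gens :: "nat \<Rightarrow> affine set" where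
  "chevalley_gens l =
     {loop l (root_vec l (i - 1) i) 0 |i. i \<in> {1..l}} \<union>
     {loop l (root_vec l i (i - 1)) 0 |i. i \<in> {1..l}} \<union>
     {loop l (root_vec l l 0) 1, loop l (root_vec l 0 l) (- 1)}"

text \<open>Integrable: the Cartan subalgebra (including \<open>c\<close>) acts diagonalizably, and the Chevalley
  generators act locally nilpotently.\<close>

definition integrable_module ::
    "nat \<Rightarrow> (complex \<Rightarrow> 'v::ab_group_add \<Rightarrow> 'v) \<Rightarrow> (affine \<Rightarrow> 'v \<Rightarrow> 'v) \<Rightarrow> bool" where
  "integrable_module l scale act \<longleftrightarrow>
     module.span scale
       {u. (\<forall>H\<in>cartan l. \<exists>z. act (loop l H 0) u = scale z u) \<and> (\<exists>z. act (central l) u = scale z u)}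
       = UNIV \<and>
     (\<forall>X\<in>chevalley_gens l. \<forall>u. \<exists>k. (act X ^^ k) u = 0)"

text \<open>\<open>standard_module l i scale act v\<close>: the module is \<open>L(Lambda_i)\<close>, with highest weight vector
  \<open>v\<close>.\<close>

definition standard_module ::
    "nat \<Rightarrow> nat \<Rightarrow> (complex \<Rightarrow> 'v::ab_group_add \<Rightarrow> 'v) \<Rightarrow> (affine \<Rightarrow> 'v \<Rightarrow> 'v) \<Rightarrow> 'v \<Rightarrow> bool" where
  "standard_module l i scale act v \<longleftrightarrow>
     aff_module l scale act \<and>
     irreducible_module l scale act \<and>
     integrable_module l scale act \<and>
     v \<noteq> 0 \<and>
     (\<forall>x\<in>sl l. \<forall>m>0. act (loop l x m) v = 0) \<and>
     (\<forall>p q. p < q \<and> q \<le> l \<longrightarrow> act (loop l (root_vec l p q) 0) v = 0) \<and>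
     (\<forall>H\<in>cartan l. act (loop l H 0) v = scale (form (fund_weight l i) H) v) \<and>
     act (central l) v = v"


section \<open>Principal subspaces and their gradings\<close>

definition nbar :: "nat \<Rightarrow> affine set" where
  "nbar l = {(f, a) \<in> aff l. a = 0 \<and> (\<forall>m. \<forall>p\<le>l. \<forall>q\<le>p. f m $$ (p, q) = 0)}"

text \<open>\<open>U(nbar) v\<close> is spanned by the results of applying to \<open>v\<close> finite products of elements of
  \<^term>\<open>nbar l\<close>.\<close>

definition principal_subspace ::
    "nat \<Rightarrow> (complex \<Rightarrow> 'v::ab_group_add \<Rightarrow> 'v) \<Rightarrow> (affine \<Rightarrow> 'v \<Rightarrow> 'v) \<Rightarrow> 'v \<Rightarrow> 'v set" where
  "principal_subspace l scale act v =
     module.span scale {foldr act Xs v |Xs. set Xs \<subseteq> nbar l}"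

text \<open>Evaluation of a bilinear B at the Casimir tensor of \<open>form\<close>, written in the dual bases consisting
  of the root vectors and the simple roots, and of the opposite root vectors and the fundamental
  weights.\<close>

definition casimir_sum :: "nat \<Rightarrow> (complex mat \<Rightarrow> complex mat \<Rightarrow> 'v) \<Rightarrow> 'v::ab_group_add" where
  "casimir_sum l B =
     (\<Sum>p\<le>l. \<Sum>q\<in>{..l} - {p}. B (root_vec l p q) (root_vec l q p)) +
     (\<Sum>i=1..l. B (simple_root l i) (fund_weight l i))"

text \<open>The Virasoro operator \<open>L(0)\<close>, by the Segal-Sugawara formula at level 1 (the dual Coxeter number
  is \<open>l + 1\<close>):
  \<open>L(0) = 1/(2(1 + (l+1))) (sum_a u_a(0) u^a(0) + 2 sum_{m>0} sum_a u_a(-m) u^a(m))\<close>.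
  On a standard module only finitely many \<open>m\<close> contribute for each vector, which is what
  \<^const>\<open>Sum_any\<close> needs.\<close>

definition L0 ::
    "nat \<Rightarrow> (complex \<Rightarrow> 'v::ab_group_add \<Rightarrow> 'v) \<Rightarrow> (affine \<Rightarrow> 'v \<Rightarrow> 'v) \<Rightarrow> 'v \<Rightarrow> 'v" where
  "L0 l scale act u = scale (1 / (2 * (1 + of_nat (l + 1))))
     (casimir_sum l (\<lambda>x y. act (loop l x 0) (act (loop l y 0) u)) +
      scale 2 (Sum_any (\<lambda>m::nat. if m > 0
        then casimir_sum l (\<lambda>x y. act (loop l x (- int m)) (act (loop l y (int m)) u)) else 0)))"

text \<open>The exponent \<open>(a, b)\<close> encodes the monomial \<open>x_1^(a 1) ... x_l^(a l) q^b\<close>; the values of \<open>a\<close>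
  outside \<open>{1..l}\<close> are ignored. Complex exponents are allowed because exponents are eigenvalues.
  A formal series is given by its coefficients.\<close>

type_synonym exponent = "(nat \<Rightarrow> complex) \<times> complex"
type_synonym series = "exponent \<Rightarrow> complex"

definition homogeneous_subspace ::
    "nat \<Rightarrow> (complex \<Rightarrow> 'v::ab_group_add \<Rightarrow> 'v) \<Rightarrow> (affine \<Rightarrow> 'v \<Rightarrow> 'v) \<Rightarrow> 'v \<Rightarrow> exponent \<Rightarrow> 'v set" where
  "homogeneous_subspace l scale act v e =
     {u \<in> principal_subspace l scale act v.
        (\<forall>j\<in>{1..l}. act (loop l (fund_weight l j) 0) u = scale (fst e j) u) \<and>
        L0 l scale act u = scale (snd e) u}"

text \<open>The formal trace of \<open>x_1^(lambda_1) ... x_l^(lambda_l) q^(L(0))\<close> makes sense when the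
  principal subspace is the sum of its homogeneous subspaces and these are finite-dimensional
  (the library's dimension of an infinite-dimensional space is 0).\<close>

definition graded_dim_exists ::
    "nat \<Rightarrow> (complex \<Rightarrow> 'v::ab_group_add \<Rightarrow> 'v) \<Rightarrow> (affine \<Rightarrow> 'v \<Rightarrow> 'v) \<Rightarrow> 'v \<Rightarrow> bool" where
  "graded_dim_exists l scale act v \<longleftrightarrow>
     module.span scale (\<Union>e. homogeneous_subspace l scale act v e) = principal_subspace l scale act v \<and>
     (\<forall>e. \<exists>B. finite B \<and> homogeneous_subspace l scale act v e \<subseteq> module.span scale B)"

definition graded_dim ::
    "nat \<Rightarrow> (complex \<Rightarrow> 'v::ab_group_add \<Rightarrow> 'v) \<Rightarrow> (affine \<Rightarrow> 'v \<Rightarrow> 'v) \<Rightarrow> 'v \<Rightarrow> series" where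
  "graded_dim l scale act v =
     (\<lambda>e. of_nat (vector_space.dim scale (homogeneous_subspace l scale act v e)))"


section \<open>Formal series\<close>

definition monom_mult :: "(nat \<Rightarrow> complex) \<Rightarrow> complex \<Rightarrow> series \<Rightarrow> series" where
  "monom_mult a b F = (\<lambda>e. F (\<lambda>i. fst e i - a i, snd e - b))"

definition q_series :: "nat \<Rightarrow> complex fps \<Rightarrow> series" where
  "q_series l P = (\<lambda>e. Sum_any (\<lambda>n::nat.
     if (\<forall>i\<in>{1..l}. fst e i = 0) \<and> snd e = of_nat n then fps_nth P n else 0))"

text \<open>Coefficientwise sum over \<open>r_1, ..., r_l \<ge> 0\<close>, meant for families in which every monomial occurs
  only finitely often.\<close>

definition multi_sum :: "nat \<Rightarrow> ((nat \<Rightarrow> nat) \<Rightarrow> series) \<Rightarrow> series" where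
  "multi_sum l F = (\<lambda>e. Sum_any (\<lambda>r. if r \<in> {1..l} \<rightarrow>\<^sub>E UNIV then F r e else 0))"

definition q_poch :: "nat \<Rightarrow> complex fps" where
  "q_poch m = (\<Prod>k=1..m. 1 - fps_X ^ k)"

definition q_frac :: "nat \<Rightarrow> int \<Rightarrow> (nat \<Rightarrow> nat) \<Rightarrow> series" where
  "q_frac l N r = monom_mult (\<lambda>i. 0) (of_int N) (q_series l (inverse (\<Prod>i=1..l. q_poch (r i))))"

definition quad :: "nat \<Rightarrow> (nat \<Rightarrow> nat) \<Rightarrow> int" where
  "quad l r = (\<Sum>i=1..l. int (r i) ^ 2) - (\<Sum>i=2..l. int (r i) * int (r (i - 1)))"

definition graded_dim' ::
    "nat \<Rightarrow> nat \<Rightarrow> (complex \<Rightarrow> 'v::ab_group_add \<Rightarrow> 'v) \<Rightarrow> (affine \<Rightarrow> 'v \<Rightarrow> 'v) \<Rightarrow> 'v \<Rightarrow> series" where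
  "graded_dim' l j scale act v =
     monom_mult (\<lambda>k. - form (fund_weight l k) (fund_weight l j))
       (- (1 / 2) * form (fund_weight l j) (fund_weight l j)) (graded_dim l scale act v)"

end

theory Submission
  imports Defs "HOL-Library.Multiset"
begin

text \<open>Write \<open>x_i(z)\<close> for the current of the simple root \<open>alpha_i\<close> and \<open>h(k)\<close> for Heisenberg modes. On a vacuum
  vector \<open>v\<close> every \<open>x(z)^2\<close> with \<open>x\<close> a root vector vanishes: by descending induction on \<open>N\<close> its coefficient \<open>R_N v\<close> is
  a singular vector of positive degree, since \<open>[y(m), R_N] = [y(0), R_(N+m)]\<close> for all \<open>y\<close>, and an irreducible module
  has none. The same commutation formula spreads \<open>x(z)^2 = 0\<close> to the whole module. Together with the locality
  \<open>(z - w) [x_i(z), x_(i+1)(w)] = 0\<close> it gives a straightening procedure, so that the principal subspace is spanned by words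
  in the \<open>x_i(m)\<close> subject to difference-two conditions within a colour and a bound on the first mode of
  colour \<open>i + 1\<close> that depends on the number of letters of colour \<open>i\<close>.

  These words are linearly independent. The elementary symmetric polynomial \<open>e_r\<close>, written in power sums and evaluated at
  \<open>h(1), h(2), ...\<close>, raises all \<open>r\<close> modes of one colour by 1; it kills the words whose first mode is maximal and is
  injective on the others, so only words with maximal first mode matter. There the first
  letter maps \<open>v\<close> to another extremal vector (which is nonzero and again a vacuum for a shifted action), and one
  concludes by induction on the length. The same shift, combinatorially, gives the recursion
  \<open>f_r (1 - q^(r_i)) = q^(...) f_(r - e_i)\<close> for the generating functions of the words.

  The modules \<open>L(Lambda_j)\<close> are reduced to \<open>L(Lambda_0)\<close> by a spectral flow of the action, which shifts the modes of \<open>x_j\<close> by 1 and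
  gives the term \<open>r_j\<close>.\<close>

text \<open>No module is constructed here: the only data are irreducibility, integrability and the
  highest weight vector, so neither lattice vertex operators nor intertwining operators are at hand.
  Extremal vectors take the place of the lattice vectors \<open>e^b\<close>; they are nonzero
  because an opposite root mode leads each one back to its predecessor. The top elementary symmetric
  function takes the place of the operator that shifts the modes of one colour: in \<open>r\<close>
  variables \<open>e_r\<close> is the single monomial \<open>z_1 ... z_r\<close>, whereas a power
  sum would turn one word into a sum of \<open>r\<close> words. Level 1 matters in
  \<open>[e r s m, R_N]\<close>: the central term contributes a multiple of \<open>m\<close> and the
  reordering a multiple of \<open>N\<close>, and at level 1 these combine to a function of
  \<open>N + m\<close>. Integrability makes the lowering modes of weight zero kill the highest
  weight vector, which is what turns it into a vacuum after the spectral flow. Indexing by all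
  matrix units, diagonal ones included, gives one commutator formula without a choice of Cartan
  basis; \<open>kap\<close> is the price.\<close>

text \<open>\<open>e p q m\<close> stands for \<open>E_(pq) \<otimes> t^m\<close>, made traceless if \<open>p = q\<close>; indices run from 0 to \<open>n - 1\<close>, the level is 1, and
  \<open>kap\<close> is the contribution of the traces to the invariant form, \<open>1 / n\<close> for \<open>sl(n)\<close>.\<close>

locale current_rep = vector_space scale
  for scale :: "complex \<Rightarrow> 'v::ab_group_add \<Rightarrow> 'v" (infixr \<open>*s\<close> 75) +
  fixes n :: nat and kap :: complex and e :: "nat \<Rightarrow> nat \<Rightarrow> int \<Rightarrow> 'v \<Rightarrow> 'v"
  assumes linear_e: "p < n \<Longrightarrow> q < n \<Longrightarrow> Vector_Spaces.linear scale scale (e p q m)"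
    and comm_e: "p < n \<Longrightarrow> q < n \<Longrightarrow> r < n \<Longrightarrow> s < n \<Longrightarrow>
      e p q m (e r s k u) = e r s k (e p q m u)
        + (if q = r then e p s (m + k) u else 0) - (if p = s then e r q (m + k) u else 0)
        + (if m + k = 0 then (of_int m * ((if q = r \<and> p = s then 1 else 0)
            - (if p = q \<and> r = s then kap else 0))) *s u else 0)"
    and restricted: "\<exists>M. \<forall>m\<ge>M. \<forall>p<n. \<forall>q<n. e p q m u = 0"
begin

lemma e_add: "p < n \<Longrightarrow> q < n \<Longrightarrow> e p q m (u + w) = e p q m u + e p q m w"
  using linear_e[of p q m] by (simp add: Vector_Spaces.linear_iff)

lemma e_scale: "p < n \<Longrightarrow> q < n \<Longrightarrow> e p q m (a *s u) = a *s e p q m u"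
  using linear_e[of p q m] by (simp add: Vector_Spaces.linear_iff)

lemma e_0: "p < n \<Longrightarrow> q < n \<Longrightarrow> e p q m 0 = 0"
  using e_scale[of p q m 0 0] by simp

lemma e_neg: "p < n \<Longrightarrow> q < n \<Longrightarrow> e p q m (- u) = - e p q m u"
  using e_scale[of p q m "-1" u] by simp

lemma e_diff: "p < n \<Longrightarrow> q < n \<Longrightarrow> e p q m (u - w) = e p q m u - e p q m w"
  using e_add[of p q m u "-w"] by (simp add: e_neg)

lemma e_sum: "p < n \<Longrightarrow> q < n \<Longrightarrow> e p q m (sum f A) = (\<Sum>a\<in>A. e p q m (f a))"
  by (induction A rule: infinite_finite_induct) (auto simp: e_0 e_add)

lemmas e_simps = e_add e_scale e_0 e_neg e_diff e_sum

definition bounded_by :: "'v \<Rightarrow> int \<Rightarrow> bool" where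
  "bounded_by u M \<longleftrightarrow> (\<forall>m\<ge>M. \<forall>p<n. \<forall>q<n. e p q m u = 0)"

lemma bounded_ex: "\<exists>M. bounded_by u M"
  using restricted by (simp add: bounded_by_def)

lemma bounded_mono: "bounded_by u M \<Longrightarrow> M \<le> M' \<Longrightarrow> bounded_by u M'"
  by (auto simp: bounded_by_def)

lemma bounded_byD: "bounded_by u M \<Longrightarrow> M \<le> m \<Longrightarrow> p < n \<Longrightarrow> q < n \<Longrightarrow> e p q m u = 0"
  by (auto simp: bounded_by_def)

end

text \<open>The degree operator is abstract, known only through its commutators, because the
  spectral flow replaces \<open>L(0)\<close> by a different operator.\<close>

locale current_module = current_rep +
  fixes d
  assumes linear_d: "Vector_Spaces.linear scale scale d"
    and comm_d: "p < n \<Longrightarrow> q < n \<Longrightarrow> d (e p q m u) = e p q m (d u) - of_int m *s e p q m u"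
    and irreducible: "subspace S \<Longrightarrow> (\<And>p q m u. p < n \<Longrightarrow> q < n \<Longrightarrow> u \<in> S \<Longrightarrow> e p q m u \<in> S)
      \<Longrightarrow> S = {0} \<or> S = UNIV"
begin

lemma d_add: "d (u + w) = d u + d w"
  using linear_d by (simp add: Vector_Spaces.linear_iff)

lemma d_scale: "d (a *s u) = a *s d u"
  using linear_d by (simp add: Vector_Spaces.linear_iff)

lemma d_0: "d 0 = 0"
  using d_scale[of 0 0] by simp

lemma d_sum: "d (sum f A) = (\<Sum>a\<in>A. d (f a))"
  by (induction A rule: infinite_finite_induct) (auto simp: d_0 d_add)

end

text \<open>A basis chosen inside \<open>G\<close> consists of eigenvectors; comparing coefficients
  in \<open>T u = c u\<close> leaves only those of eigenvalue \<open>c\<close>. Gradings can thus be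
  used without direct sums.\<close>

lemma (in vector_space) eigenvector_in_span:
  assumes T: "\<And>u w. T (u + w) = T u + T w" "\<And>a u. T (scale a u) = scale a (T u)"
    and G: "\<And>g. g \<in> G \<Longrightarrow> \<exists>z. T g = scale z g"
    and u: "u \<in> span G" "T u = scale c u"
  shows "u \<in> span {g \<in> G. T g = scale c g}"
proof -
  obtain B where B: "B \<subseteq> G" "independent B" "G \<subseteq> span B"
    using maximal_independent_subset[of G] by blast
  have T0: "T 0 = 0" using T(2)[of 0 0] by simp
  have Tsum: "T (sum f A) = (\<Sum>a\<in>A. T (f a))" for f :: "'b \<Rightarrow> 'b" and A
    by (induction A rule: infinite_finite_induct) (auto simp: T0 T)
  have "u \<in> span B" using u(1) B(3) span_minimal[OF B(3) subspace_span] by blast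
  then obtain t a where t: "finite t" "t \<subseteq> B" "u = (\<Sum>b\<in>t. scale (a b) b)"
    unfolding span_explicit by blast
  have "\<exists>f. \<forall>g\<in>G. T g = scale (f g) g" using G by (intro bchoice) blast
  then obtain ev where ev: "\<And>g. g \<in> G \<Longrightarrow> T g = scale (ev g) g" by blast
  have "T u - scale c u = (\<Sum>b\<in>t. scale (a b * (ev b - c)) b)"
    unfolding t(3) Tsum scale_sum_right sum_subtractf[symmetric]
    using t(2) B(1) by (intro sum.cong refl) (auto simp: T(2) ev scale_left_diff_distrib algebra_simps)
  then have "(\<Sum>b\<in>t. scale (a b * (ev b - c)) b) = 0" using u(2) by simp
  then have z: "a b * (ev b - c) = 0" if "b \<in> t" for b
    using independentD[OF B(2) t(1,2), of "\<lambda>b. a b * (ev b - c)"] that by simp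
  have "scale (a b) b \<in> span {g \<in> G. T g = scale c g}" if b: "b \<in> t" for b
  proof (cases "a b = 0")
    case True then show ?thesis by (simp add: span_zero)
  next
    case False
    then have "ev b = c" using z[OF b] by simp
    then have "b \<in> {g \<in> G. T g = scale c g}" using b t(2) B(1) ev by auto
    then show ?thesis by (intro span_scale span_base)
  qed
  then show ?thesis unfolding t(3) by (intro span_sum)
qed

section \<open>Singular vectors in irreducible modules\<close>

context current_module
begin

lemma e_in_span:
  assumes "p < n" "q < n" "\<And>u. u \<in> A \<Longrightarrow> e p q m u \<in> span B" "u \<in> span A"
  shows "e p q m u \<in> span B"
proof -
  have "subspace {u. e p q m u \<in> span B}"
    using assms(1,2) by (auto simp: subspace_def e_simps span_zero span_add span_scale)
  then have "span A \<subseteq> {u. e p q m u \<in> span B}"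
    using assms(3) by (intro span_minimal) auto
  then show ?thesis using assms(4) by auto
qed

inductive_set descendants :: "'a \<Rightarrow> 'a set" for w where
  self: "w \<in> descendants w"
| step: "u \<in> descendants w \<Longrightarrow> p < n \<Longrightarrow> q < n \<Longrightarrow> m \<le> 0 \<Longrightarrow> e p q m u \<in> descendants w"

text \<open>A positive mode is moved inwards until it meets \<open>w\<close>; every commutator met
  on the way acts on a shorter product. So nonpositive modes applied to \<open>w\<close> already
  span a submodule.\<close>

lemma descendants_closed:
  assumes w: "\<And>p q m. p < n \<Longrightarrow> q < n \<Longrightarrow> 0 < m \<Longrightarrow> e p q m w = 0"
    and u: "u \<in> descendants w" and pq: "p < n" "q < n"
  shows "e p q m u \<in> span (descendants w)"
  using u pq
proof (induction arbitrary: p q m)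
  case self
  then show ?case
    using w by (cases "m \<le> 0") (auto intro: span_base descendants.intros simp: span_zero)
next
  case (step u r s k)
  have *: "e r s k x \<in> span (descendants w)" if "x \<in> span (descendants w)" for x
    by (rule e_in_span[OF step.hyps(2,3) _ that]) (intro span_base descendants.step step.hyps(2-4))
  show ?case
    unfolding comm_e[OF step.prems step.hyps(2,3)]
    using *[OF step.IH[OF step.prems]] step.IH step.prems step.hyps(2,3)
    by (intro span_add span_diff) (simp_all add: span_zero span_scale span_base[OF step.hyps(1)])
qed

lemma descendants_degree:
  assumes "u \<in> descendants w" "d w = z *s w"
  shows "\<exists>N::nat. d u = (z + of_nat N) *s u"
  using assms
proof induction
  case self then show ?case by (intro exI[of _ 0]) simp
next
  case (step u p q m)
  then obtain N :: nat where N: "d u = (z + of_nat N) *s u" by blast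
  have "d (e p q m u) = (z + of_nat N - of_int m) *s e p q m u"
    using step.hyps N by (simp add: comm_d e_simps scale_left_diff_distrib)
  moreover have "- of_int m = (of_nat (nat (- m)) :: complex)"
    using step.hyps(4) by (simp add: of_nat_nat)
  ultimately show ?case
    by (intro exI[of _ "N + nat (- m)"]) (metis add.assoc diff_conv_add_uminus of_nat_add)
qed

text \<open>A vector killed by all positive modes generates a submodule graded in degrees at least its own.\<close>

lemma singular_vector_zero:
  assumes v: "v \<noteq> 0" "d v = c *s v"
    and w: "\<And>p q m. p < n \<Longrightarrow> q < n \<Longrightarrow> 0 < m \<Longrightarrow> e p q m w = 0"
    and dw: "d w = (c + of_nat N) *s w" and N: "0 < N"
  shows "w = 0"
proof -
  let ?S = "span (descendants w)"
  have "?S = {0} \<or> ?S = UNIV"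
    using descendants_closed[OF w]
    by (intro irreducible) (auto intro: e_in_span[of _ _ "descendants w"])
  moreover have "?S \<noteq> UNIV"
  proof
    assume "?S = UNIV"
    then have "v \<in> span {g \<in> descendants w. d g = c *s g}"
      using descendants_degree[OF _ dw] v(2)
      by (intro eigenvector_in_span) (auto simp: d_add d_scale)
    moreover have "{g \<in> descendants w. d g = c *s g} \<subseteq> {0}"
    proof
      fix g assume g: "g \<in> {g \<in> descendants w. d g = c *s g}"
      then obtain k :: nat where "d g = (c + of_nat N + of_nat k) *s g"
        using descendants_degree[OF _ dw] by blast
      then have "(of_nat N + of_nat k) *s g = 0"
        using g by (simp add: scale_left_distrib)
      moreover have "(of_nat N + of_nat k :: complex) \<noteq> 0"
        using N by (metis of_nat_add of_nat_eq_0_iff add_is_0 not_gr0)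
      ultimately show "g \<in> {0}" by simp
    qed
    ultimately have "v \<in> span {0}" using span_mono by blast
    then show False using v(1) by simp
  qed
  ultimately show ?thesis using span_base[OF descendants.self, of w] by auto
qed

section \<open>The square of a root current vanishes\<close>

definition current_square :: "nat \<Rightarrow> nat \<Rightarrow> int \<Rightarrow> 'a \<Rightarrow> 'a" where
  "current_square p q N u = Sum_any (\<lambda>a. e p q a (e p q (N - a) u))"

lemma root_commute:
  assumes "p < n" "q < n" "p \<noteq> q"
  shows "e p q a (e p q b u) = e p q b (e p q a u)"
  using assms by (simp add: comm_e[of p q p q a b])

lemma current_square_eq:
  assumes "p < n" "q < n" "p \<noteq> q" "bounded_by u M" "M \<le> B"
  shows "current_square p q N u = (\<Sum>a\<in>{N - B..B}. e p q a (e p q (N - a) u))"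
  unfolding current_square_def
proof (rule Sum_any.expand_superset)
  show "{a. e p q a (e p q (N - a) u) \<noteq> 0} \<subseteq> {N - B..B}"
  proof
    fix a assume a: "a \<in> {a. e p q a (e p q (N - a) u) \<noteq> 0}"
    have "e p q a (e p q (N - a) u) \<noteq> 0" "e p q (N - a) (e p q a u) \<noteq> 0"
      using a root_commute[OF assms(1-3), of a "N - a" u] by auto
    then have "e p q a u \<noteq> 0" "e p q (N - a) u \<noteq> 0"
      using e_0[OF assms(1,2)] by auto
    then have "a < M" "N - a < M"
      using bounded_byD[OF assms(4) _ assms(1,2)] by (meson not_less)+
    then show "a \<in> {N - B..B}" using assms(5) by auto
  qed
qed simp

text \<open>\<open>Z\<close> collects the modes produced by \<open>[e r s m, e p q a]\<close>.
  Moving \<open>Z\<close> to the right, where large modes vanish, costs \<open>2 * kr\<close> for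
  each of the \<open>2 * B - N + 1\<close> summands, and the two central terms give
  \<open>2 * kr * m\<close>. The cutoff \<open>B\<close> has to stay visible: for
  \<open>kr = 1\<close> the reordered sum itself grows with \<open>B\<close>.\<close>

lemma current_square_commutator:
  assumes pq: "p < n" "q < n" "p \<noteq> q" and rs: "r < n" "s < n"
  defines "kr \<equiv> if s = p \<and> r = q then 1 else 0 :: complex"
  defines "Z \<equiv> \<lambda>a w. (if s = p then e r q a w else 0) - (if r = q then e p s a w else 0)"
  shows "\<exists>B0. \<forall>B\<ge>B0. e r s m (current_square p q N u) - current_square p q N (e r s m u)
    = 2 *s (\<Sum>a\<in>{N - B..B}. e p q (N - a) (Z (m + a) u))
      + (2 * kr * of_int (m - (2 * B - N + 1))) *s e p q (m + N) u"
proof -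
  have 1: "e r s m (e p q b w) = e p q b (e r s m w) + Z (m + b) w
      + (if m + b = 0 then (of_int m * kr) *s w else 0)" for b w
    using pq(3) unfolding comm_e[OF rs pq(1,2)] Z_def kr_def by (auto simp: algebra_simps)
  have 2: "e p q a (Z b w) = Z b (e p q a w) + (2 * kr) *s e p q (a + b) w" for a b w
    using pq rs unfolding Z_def kr_def
    by (auto simp: e_simps comm_e[of p q _ _ a b] scale_left_distrib[of 1 1, simplified])
  obtain M where M: "bounded_by u M" "bounded_by (e r s m u) M"
    using bounded_ex bounded_mono by (metis linorder_le_cases)
  show ?thesis
  proof (intro exI allI impI)
    fix B assume B: "\<bar>M\<bar> + \<bar>m\<bar> + \<bar>N\<bar> \<le> B"
    let ?I = "{N - B..B}"
    have bnd: "N - B \<le> - m" "- m \<le> B" "N - B \<le> m + N" "m + N \<le> B"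
      using B by arith+
    have split: "(2 * kr * of_int (m - K)) *s x = (of_int m * kr) *s x + (of_int m * kr) *s x - (2 * kr * of_int K) *s x"
      for K x
    proof -
      have "2 * kr * of_int (m - K) = of_int m * kr + of_int m * kr - 2 * kr * of_int K"
        by (simp add: algebra_simps)
      then show ?thesis by (simp only: scale_left_distrib scale_left_diff_distrib)
    qed
    have t: "e r s m (e p q a (e p q (N - a) u)) - e p q a (e p q (N - a) (e r s m u))
      = e p q (N - a) (Z (m + a) u) + e p q a (Z (m + N - a) u) - (2 * kr) *s e p q (m + N) u
        + (if - m = a then (of_int m * kr) *s e p q (N + m) u else 0)
        + (if m + N = a then (of_int m * kr) *s e p q (m + N) u else 0)" for a
    proof -
      have "m + a = 0 \<longleftrightarrow> - m = a" "m + (N - a) = 0 \<longleftrightarrow> m + N = a" by auto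
      then show ?thesis
        using pq unfolding 1 by (auto simp: e_simps 2 algebra_simps)
    qed
    have "current_square p q N u = (\<Sum>a\<in>?I. e p q a (e p q (N - a) u))"
      "current_square p q N (e r s m u) = (\<Sum>a\<in>?I. e p q a (e p q (N - a) (e r s m u)))"
      using B by (intro current_square_eq[OF pq M(1)] current_square_eq[OF pq M(2)]; simp)+
    then have "e r s m (current_square p q N u) - current_square p q N (e r s m u)
      = (\<Sum>a\<in>?I. e r s m (e p q a (e p q (N - a) u)) - e p q a (e p q (N - a) (e r s m u)))"
      using rs by (simp add: e_simps sum_subtractf)
    also have "\<dots> = (\<Sum>a\<in>?I. e p q (N - a) (Z (m + a) u)) + (\<Sum>a\<in>?I. e p q a (Z (m + N - a) u))
        - (\<Sum>a\<in>?I. (2 * kr) *s e p q (m + N) u)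
        + (\<Sum>a\<in>?I. if - m = a then (of_int m * kr) *s e p q (N + m) u else 0)
        + (\<Sum>a\<in>?I. if m + N = a then (of_int m * kr) *s e p q (m + N) u else 0)"
      unfolding t by (simp only: sum.distrib sum_subtractf)
    also have "(\<Sum>a\<in>?I. e p q a (Z (m + N - a) u)) = (\<Sum>a\<in>?I. e p q (N - a) (Z (m + a) u))"
      by (rule sum.reindex_bij_witness[of _ "\<lambda>a. N - a" "\<lambda>a. N - a"]) (auto simp: algebra_simps)
    also have "(\<Sum>a\<in>?I. (2 * kr) *s e p q (m + N) u) = (2 * kr * of_int (2 * B - N + 1)) *s e p q (m + N) u"
      using B by (simp add: sum_constant_scale flip: scale_sum_left)
    also have "(\<Sum>a\<in>?I. if - m = a then (of_int m * kr) *s e p q (N + m) u else 0) = (of_int m * kr) *s e p q (m + N) u"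
      using bnd by (simp add: add.commute)
    also have "(\<Sum>a\<in>?I. if m + N = a then (of_int m * kr) *s e p q (m + N) u else 0) = (of_int m * kr) *s e p q (m + N) u"
      using bnd by simp
    finally show "e r s m (current_square p q N u) - current_square p q N (e r s m u)
      = 2 *s (\<Sum>a\<in>?I. e p q (N - a) (Z (m + a) u))
        + (2 * kr * of_int (m - (2 * B - N + 1))) *s e p q (m + N) u"
      unfolding split by (simp add: scale_left_distrib[of 1 1, simplified])
  qed
qed

text \<open>The commutator depends only on \<open>N + m\<close>, so that it may be computed with \<open>m\<close> large.\<close>

lemma current_square_shift:
  assumes pq: "p < n" "q < n" "p \<noteq> q" and rs: "r < n" "s < n"
  shows "e r s m (current_square p q N u) - current_square p q N (e r s m u)
    = e r s 0 (current_square p q (N + m) u) - current_square p q (N + m) (e r s 0 u)"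
proof -
  define kr :: complex where "kr = (if s = p \<and> r = q then 1 else 0)"
  define Z where "Z = (\<lambda>a w. (if s = p then e r q a w else 0) - (if r = q then e p s a w else 0))"
  have comm: "\<exists>B0. \<forall>B\<ge>B0. e r s m (current_square p q N u) - current_square p q N (e r s m u)
    = 2 *s (\<Sum>a\<in>{N - B..B}. e p q (N - a) (Z (m + a) u))
      + (2 * kr * of_int (m - (2 * B - N + 1))) *s e p q (m + N) u" for m N u
    unfolding kr_def Z_def by (rule current_square_commutator[OF pq rs])
  obtain B1 where B1: "\<And>B. B \<ge> B1 \<Longrightarrow> e r s m (current_square p q N u) - current_square p q N (e r s m u)
    = 2 *s (\<Sum>a\<in>{N - B..B}. e p q (N - a) (Z (m + a) u))
      + (2 * kr * of_int (m - (2 * B - N + 1))) *s e p q (m + N) u"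
    using comm[of m N u] by blast
  obtain B2 where B2: "\<And>B. B \<ge> B2 \<Longrightarrow> e r s 0 (current_square p q (N + m) u) - current_square p q (N + m) (e r s 0 u)
    = 2 *s (\<Sum>a\<in>{N + m - B..B}. e p q (N + m - a) (Z (0 + a) u))
      + (2 * kr * of_int (0 - (2 * B - (N + m) + 1))) *s e p q (0 + (N + m)) u"
    using comm[of 0 "N + m" u] by blast
  obtain M where M: "bounded_by u M" using bounded_ex by blast
  define B where "B = max (max B1 B2) (\<bar>M\<bar> + \<bar>m\<bar>)"
  have B: "B1 \<le> B" "B2 \<le> B" "M \<le> B" "M \<le> B + m" by (auto simp: B_def)
  have Z0: "Z a u = 0" if "M \<le> a" for a
    using bounded_byD[OF M that] pq rs by (auto simp: Z_def)
  \<comment> \<open>The scalar terms of \<open>B1\<close> and \<open>B2\<close> agree, both being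
    \<open>2 * kr * (N + m - 2 * B - 1)\<close>; this is where level 1 is used. The sums differ only
    in modes \<open>Z a\<close> with \<open>a \<ge> M\<close>, which kill \<open>u\<close>.\<close>
  have "(\<Sum>a\<in>{N - B..B}. e p q (N - a) (Z (m + a) u)) = (\<Sum>a\<in>{N + m - B..B + m}. e p q (N + m - a) (Z a u))"
    by (rule sum.reindex_bij_witness[of _ "\<lambda>a. a - m" "\<lambda>a. a + m"]) (auto simp: algebra_simps)
  also have "\<dots> = (\<Sum>a\<in>{N + m - B..B + \<bar>m\<bar>}. e p q (N + m - a) (Z a u))"
    using pq B(3,4) by (intro sum.mono_neutral_left) (auto simp: e_0 Z0)
  also have "\<dots> = (\<Sum>a\<in>{N + m - B..B}. e p q (N + m - a) (Z a u))"
    using pq B(3,4) by (intro sum.mono_neutral_right) (auto simp: e_0 Z0)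
  finally show ?thesis
    unfolding B1[OF B(1)] B2[OF B(2)] by (simp add: algebra_simps)
qed

end

text \<open>All zero modes kill \<open>v\<close>, lowering and Cartan ones included, as in
  \<open>L(Lambda_0)\<close>. Hence \<open>[e r s 0, R_N] v\<close> vanishes as soon as
  \<open>R_N v\<close> does, for every \<open>r\<close> and \<open>s\<close>.\<close>

locale vacuum_module = current_module +
  fixes v and wt :: complex
  assumes v_nonzero: "v \<noteq> 0" and d_v: "d v = wt *s v"
    and e_v: "p < n \<Longrightarrow> q < n \<Longrightarrow> 0 \<le> m \<Longrightarrow> e p q m v = 0"
begin

lemma current_square_v:
  assumes pq: "p < n" "q < n" "p \<noteq> q"
  shows "current_square p q N v = 0"
proof (induction "nat (- N)" arbitrary: N rule: less_induct)
  case less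
  have b: "bounded_by v 0" by (simp add: bounded_by_def e_v)
  show ?case
  \<comment> \<open>The first square that could survive is \<open>x(-1)^2 v\<close>, in degree
    \<open>N = -2\<close>; above it one of the two modes is nonnegative.\<close>
  proof (cases "N \<ge> - 1")
    case True
    show ?thesis
      unfolding current_square_eq[OF pq b order.refl]
    proof (intro sum.neutral ballI)
      fix a assume "a \<in> {N - 0..0}"
      then show "e p q a (e p q (N - a) v) = 0"
        using True pq by (cases "N - a \<ge> 0") (auto simp: e_v e_0 root_commute[of p q a])
    qed
  next
    case False
    have "e r s m (current_square p q N v) = 0" if rs: "r < n" "s < n" and m: "0 < m" for r s m
    proof -
      have "current_square p q (N + m) v = 0" using less False m by simp
      then show ?thesis
        using current_square_shift[OF pq rs, of m N v] rs m
        by (simp add: e_v e_0) (simp add: current_square_def pq e_0)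
    qed
    moreover have "d (current_square p q N v) = (wt + of_nat (nat (- N))) *s current_square p q N v"
      unfolding current_square_eq[OF pq b order.refl] d_sum scale_sum_right
      using pq False
      by (intro sum.cong refl) (simp add: comm_d e_simps d_v algebra_simps of_nat_nat)
    ultimately show ?thesis
      using False by (intro singular_vector_zero[OF v_nonzero d_v, of "current_square p q N v" "nat (- N)"]) auto
  qed
qed

lemma submodule_UNIV:
  assumes "subspace S" "\<And>p q m u. p < n \<Longrightarrow> q < n \<Longrightarrow> u \<in> S \<Longrightarrow> e p q m u \<in> S" "v \<in> S"
  shows "S = UNIV"
  using irreducible[OF assms(1,2)] assms(3) v_nonzero by blast

theorem current_square_zero:
  assumes pq: "p < n" "q < n" "p \<noteq> q"
  shows "current_square p q N u = 0"
proof -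
  let ?S = "{u. \<forall>N. current_square p q N u = 0}"
  have add: "current_square p q N (u + w) = current_square p q N u + current_square p q N w" for N u w
  proof -
    obtain M where M: "bounded_by u M" "bounded_by w M"
      using bounded_ex bounded_mono by (metis linorder_le_cases)
    then have "bounded_by (u + w) M" by (simp add: bounded_by_def e_simps)
    then show ?thesis
      using M pq by (simp add: current_square_eq[of p q _ M M] e_simps sum.distrib)
  qed
  have scale: "current_square p q N (z *s u) = z *s current_square p q N u" for N z u
  proof -
    obtain M where M: "bounded_by u M" using bounded_ex by blast
    then have "bounded_by (z *s u) M" by (simp add: bounded_by_def e_simps)
    then show ?thesis
      using M pq by (simp add: current_square_eq[of p q _ M M] e_simps scale_sum_right)
  qed
  have zero: "current_square p q N 0 = 0" for N
    using pq by (simp add: current_square_def e_0)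
  have "?S = UNIV"
  proof (rule submodule_UNIV)
    show "subspace ?S" by (auto simp: subspace_def add scale zero)
    show "v \<in> ?S" by (simp add: current_square_v pq)
  next
    fix r s m u assume rs: "r < n" "s < n" and u: "u \<in> ?S"
    \<comment> \<open>The value depends on \<open>N + m\<close> only, so \<open>m\<close> can be
      traded for a mode \<open>M\<close> with \<open>e r s M u = 0\<close>.\<close>
    have *: "current_square p q N (e r s m u) = current_square p q (N + m) (e r s 0 u)" for N m
      using current_square_shift[OF pq rs, of m N u] u rs by (simp add: e_0)
    obtain M where M: "bounded_by u M" using bounded_ex by blast
    have "current_square p q N (e r s m u) = 0" for N
    proof -
      have "current_square p q N (e r s m u) = current_square p q (N + m - M) (e r s M u)"
        using *[of N m] *[of "N + m - M" M] by simp
      then show ?thesis using bounded_byD[OF M order.refl rs] zero by simp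
    qed
    then show "e r s m u \<in> ?S" by simp
  qed
  then show ?thesis by blast
qed

end

text \<open>\<open>cs\<close> lists the colours of a word, \<open>ms\<close> its modes, both with the letter acting first at the head; \<open>c i\<close> is the
  least mode from which on \<open>x_i(m)\<close> kills the vector acted on. Applying \<open>x_i(m)\<close> changes it to \<open>m - 1\<close> for colour \<open>i\<close>
  (the difference-two condition) and raises it by 1 for colour \<open>i + 1\<close>.\<close>

fun admissible :: "(nat \<Rightarrow> int) \<Rightarrow> nat list \<Rightarrow> int list \<Rightarrow> bool" where
  "admissible c [] ms \<longleftrightarrow> ms = []"
| "admissible c (i # cs) [] \<longleftrightarrow> False"
| "admissible c (i # cs) (m # ms) \<longleftrightarrow>
     m < c i \<and> admissible (c(i := m - 1, Suc i := c (Suc i) + 1)) cs ms"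

fun raise_modes :: "nat \<Rightarrow> nat list \<Rightarrow> int list \<Rightarrow> int list" where
  "raise_modes j (i # cs) (m # ms) = (if i = j then m + 1 else m) # raise_modes j cs ms"
| "raise_modes j _ _ = []"

lemma admissible_length: "admissible c cs ms \<Longrightarrow> length ms = length cs"
  by (induction c cs ms rule: admissible.induct) auto

lemma admissible_cong:
  "(\<And>k. j \<le> k \<Longrightarrow> c k = c' k) \<Longrightarrow> (\<And>k. k \<in> set cs \<Longrightarrow> j \<le> k) \<Longrightarrow> admissible c cs ms = admissible c' cs ms"
proof (induction cs arbitrary: c c' ms)
  case (Cons i cs)
  show ?case
  proof (cases ms)
    case (Cons m ms')
    have "admissible (c(i := m - 1, Suc i := c (Suc i) + 1)) cs ms'
        = admissible (c'(i := m - 1, Suc i := c' (Suc i) + 1)) cs ms'"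
      using Cons.prems by (intro Cons.IH) auto
    then show ?thesis using Cons Cons.prems by simp
  qed simp
qed simp

text \<open>With no letter of colour \<open>i - 1\<close> left, the bound for colour
  \<open>i\<close> is driven by the modes of colour \<open>i\<close> alone, and the larger colours
  see only how many letters of colour \<open>i\<close> there are. A common shift of those modes and
  of their bound is therefore invisible.\<close>

lemma admissible_raise:
  assumes "\<And>k. k \<in> set cs \<Longrightarrow> i \<le> k" "length ms = length cs"
  shows "admissible (c(i := z + 1)) cs (raise_modes i cs ms) = admissible (c(i := z)) cs ms"
  using assms
proof (induction cs arbitrary: c z ms)
  case (Cons j cs)
  then obtain m ms' where ms: "ms = m # ms'" by (cases ms) auto
  show ?case
  proof (cases "j = i")
    case True
    have "admissible ((c(Suc i := c (Suc i) + 1))(i := m - 1 + 1)) cs (raise_modes i cs ms')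
        = admissible ((c(Suc i := c (Suc i) + 1))(i := m - 1)) cs ms'"
      using Cons.prems ms by (intro Cons.IH) auto
    moreover have "c(i := y, i := m', Suc i := (c(i := y)) (Suc i) + 1) = (c(Suc i := c (Suc i) + 1))(i := m')" for y m'
      by (auto simp: fun_eq_iff)
    ultimately show ?thesis
      unfolding ms True raise_modes.simps admissible.simps if_P[OF refl] fun_upd_same by (simp add: add1_zle_eq)
  next
    case False
    then have ij: "i < j" using Cons.prems(1)[of j] by auto
    have "admissible ((c(j := m - 1, Suc j := c (Suc j) + 1))(i := z + 1)) cs (raise_modes i cs ms')
        = admissible ((c(j := m - 1, Suc j := c (Suc j) + 1))(i := z)) cs ms'"
      using Cons.prems ms by (intro Cons.IH) auto
    moreover have "c(i := y, j := m - 1, Suc j := (c(i := y)) (Suc j) + 1) = (c(j := m - 1, Suc j := c (Suc j) + 1))(i := y)" for y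
      using ij by (auto simp: fun_eq_iff)
    moreover have "(c(i := y)) j = c j" for y using ij by simp
    ultimately show ?thesis unfolding ms raise_modes.simps admissible.simps if_not_P[OF False] by simp
  qed
qed simp

lemma inj_on_raise_modes: "inj_on (raise_modes j cs) {ms. length ms = length cs}"
proof (induction cs)
  case (Cons i cs)
  show ?case
  proof (rule inj_onI)
    fix xs ys assume a: "xs \<in> {ms. length ms = length (i # cs)}" "ys \<in> {ms. length ms = length (i # cs)}"
      and eq: "raise_modes j (i # cs) xs = raise_modes j (i # cs) ys"
    obtain x xs' y ys' where "xs = x # xs'" "ys = y # ys'" using a by (cases xs; cases ys) auto
    then show "xs = ys" using a eq inj_onD[OF Cons.IH] by (auto split: if_splits)
  qed
qed (auto simp: inj_on_def)

definition shift_word :: "nat \<Rightarrow> (nat \<times> int) list \<Rightarrow> (nat \<times> int) list" where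
  "shift_word j = map (\<lambda>(i, m). (i, if i = j then m + 1 else m))"

lemma zip_raise_modes:
  "length ms = length cs \<Longrightarrow> zip cs (raise_modes j cs ms) = shift_word j (zip cs ms)"
  by (induction j cs ms rule: raise_modes.induct) (auto simp: shift_word_def)

context vacuum_module
begin

section \<open>Extremal vectors\<close>

text \<open>The model is the lattice vector \<open>e^b\<close>, on which the current of a root
  \<open>alpha\<close> starts with the power \<open>z^<alpha, b>\<close>; in modes this is the bound
  \<open>b q - b p\<close>.\<close>

definition extremal :: "(nat \<Rightarrow> int) \<Rightarrow> 'a \<Rightarrow> bool" where
  "extremal b u \<longleftrightarrow> u \<noteq> 0 \<and>
     (\<forall>p<n. \<forall>q<n. \<forall>m. p \<noteq> q \<longrightarrow> b q - b p \<le> m \<longrightarrow> e p q m u = 0) \<and>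
     (\<forall>p<n. \<forall>m\<ge>0. e p p m u = (if m = 0 then of_int (b p) *s u else 0))"

lemma extremal_v: "extremal (\<lambda>_. 0) v"
  by (auto simp: extremal_def v_nonzero e_v)

text \<open>These are the two leading coefficients of \<open>x(z)^2 u = 0\<close>: in total mode
  \<open>2 k\<close> a single product survives, in \<open>2 k - 1\<close> two equal ones.\<close>

lemma root_square_zero:
  assumes pq: "p < n" "q < n" "p \<noteq> q" and k: "\<And>a. k < a \<Longrightarrow> e p q a u = 0"
  shows "e p q k (e p q k u) = 0" "e p q (k - 1) (e p q k u) = 0"
proof -
  have z: "e p q a (e p q b u) = 0" if "k < a \<or> k < b" for a b
    using that k root_commute[OF pq, of a b u] pq by (auto simp: e_0)
  have "current_square p q (2 * k) u = (\<Sum>a\<in>{k}. e p q a (e p q (2 * k - a) u))"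
    unfolding current_square_def using z by (intro Sum_any.expand_superset) force+
  then show "e p q k (e p q k u) = 0" using current_square_zero[OF pq] by simp
  have "current_square p q (2 * k - 1) u = (\<Sum>a\<in>{k - 1, k}. e p q a (e p q (2 * k - 1 - a) u))"
    unfolding current_square_def using z by (intro Sum_any.expand_superset) force+
  then have "e p q (k - 1) (e p q k u) + e p q k (e p q (k - 1) u) = 0"
    using current_square_zero[OF pq] by (simp add: algebra_simps)
  then have "2 *s e p q (k - 1) (e p q k u) = 0"
    using root_commute[OF pq, of k "k - 1" u] scale_left_distrib[of 1 1] by simp
  then show "e p q (k - 1) (e p q k u) = 0" by simp
qed

text \<open>Bracketing \<open>x(z)^2 = 0\<close> with \<open>e r s 0\<close> gives
  \<open>x(z) y(z) = 0\<close> for the current \<open>y\<close> of a root that shares one index with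
  \<open>(p, q)\<close>; the claim is its leading coefficient, in total mode
  \<open>k + m\<close>.\<close>

lemma polarized_relation:
  assumes pq: "p < n" "q < n" "p \<noteq> q" and rs: "r < n" "s < n"
    and disj: "s = p \<and> r \<noteq> q \<and> r \<noteq> p \<and> (p', q') = (r, q) \<or> r = q \<and> s \<noteq> p \<and> s \<noteq> q \<and> (p', q') = (p, s)"
    and k: "\<And>a. k < a \<Longrightarrow> e p q a u = 0" and m: "\<And>a. m < a \<Longrightarrow> e p' q' a u = 0"
  shows "e p' q' m (e p q k u) = 0"
proof -
  have p'q': "p' < n" "q' < n" using disj pq rs by auto
  have comm: "e p' q' a (e p q b u) = e p q b (e p' q' a u)" for a b
    using disj pq rs comm_e[of p' q' p q a b u] by auto
  obtain B0 where B0: "\<And>B. B \<ge> B0 \<Longrightarrow> e r s 0 (current_square p q (k + m) u) - current_square p q (k + m) (e r s 0 u)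
    = 2 *s (\<Sum>a\<in>{k + m - B..B}. e p q (k + m - a)
        ((if s = p then e r q (0 + a) u else 0) - (if r = q then e p s (0 + a) u else 0)))
      + (2 * (if s = p \<and> r = q then 1 else 0) * of_int (0 - (2 * B - (k + m) + 1))) *s e p q (0 + (k + m)) u"
    using current_square_commutator[OF pq rs, of 0 "k + m" u] by blast
  define B where "B = max B0 (\<bar>k\<bar> + \<bar>m\<bar>)"
  let ?I = "{k + m - B..B}"
  have B: "B0 \<le> B" "m \<in> ?I" by (auto simp: B_def)
  have "(\<Sum>a\<in>?I. e p q (k + m - a) ((if s = p then e r q (0 + a) u else 0) - (if r = q then e p s (0 + a) u else 0)))
      = (if s = p then 1 else - 1) *s (\<Sum>a\<in>?I. e p q (k + m - a) (e p' q' a u))"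
    using disj pq rs by (auto simp: e_simps sum_negf)
  moreover have "(\<Sum>a\<in>?I. e p q (k + m - a) (e p' q' a u)) = (\<Sum>a\<in>{m}. e p q (k + m - a) (e p' q' a u))"
  proof (rule sum.mono_neutral_right)
    show "\<forall>a\<in>?I - {m}. e p q (k + m - a) (e p' q' a u) = 0"
    proof
      fix a assume "a \<in> ?I - {m}"
      then have "m < a \<or> k < k + m - a" by auto
      then show "e p q (k + m - a) (e p' q' a u) = 0"
        using m k comm[of a "k + m - a"] pq p'q' by (auto simp: e_0)
    qed
  qed (use B in auto)
  ultimately have "(2 * (if s = p then 1 else - 1)) *s e p q k (e p' q' m u) = 0"
    using B0[OF B(1)] disj pq rs by (auto simp: current_square_zero e_0)
  then show ?thesis using comm[of m k] by (auto split: if_splits)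
qed

text \<open>The step realises \<open>e^b\<close> to \<open>e^(b + alpha)\<close> with
  \<open>alpha = eps_p - eps_q\<close>. The killing bound of a root \<open>gamma\<close> moves by
  \<open>- <gamma, alpha>\<close>. Where it rises or stays, commutators suffice; where it drops by 2
  or 1, the missing vanishing is supplied by \<open>x(z)^2 = 0\<close> or by its polarized
  form.\<close>

theorem extremal_step:
  assumes b: "extremal b u" and pq: "p < n" "q < n" "p \<noteq> q"
  shows "extremal (b(p := b p + 1, q := b q - 1)) (e p q (b q - b p - 1) u)"
proof -
  define k where "k = b q - b p - 1"
  let ?b = "b(p := b p + 1, q := b q - 1)"
  have kill: "e r s m u = 0" if "r < n" "s < n" "r \<noteq> s" "b s - b r \<le> m" for r s m
    using b that by (auto simp: extremal_def)
  have diag: "e r r m u = (if m = 0 then of_int (b r) *s u else 0)" if "r < n" "0 \<le> m" for r m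
    using b that by (auto simp: extremal_def)
  have kill_k: "e p q a u = 0" if "k < a" for a
    using that pq by (intro kill) (auto simp: k_def)
  have off: "e r s m (e p q k u) = 0" if rs: "r < n" "s < n" "r \<noteq> s" and m: "?b s - ?b r \<le> m" for r s m
  proof -
    consider "r = p" "s = q" | "r = q" "s = p" | "s = p" "r \<noteq> q" | "r = q" "s \<noteq> p"
      | "r = p" "s \<noteq> q" | "s = q" "r \<noteq> p" | "r \<noteq> p" "r \<noteq> q" "s \<noteq> p" "s \<noteq> q" by blast
    then show ?thesis
    proof cases
      case 1
      then have "m = k - 1 \<or> m = k \<or> k < m" using m pq by (auto simp: k_def)
      then show ?thesis
        using 1 root_square_zero[OF pq kill_k] kill_k root_commute[OF pq, of m k u] pq by (auto simp: e_0)
    next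
      case 2
      then have m': "b p - b q + 2 \<le> m" using m pq by auto
      then have "0 < m + k" "e q p m u = 0" using pq by (auto simp: k_def intro!: kill)
      then show ?thesis
        using 2 pq comm_e[of q p p q m k u] by (simp add: diag e_0)
    next
      case 3
      then have m': "b p + 1 - b r \<le> m" using m pq rs by auto
      have "e r p m u = 0" using m' pq rs 3 by (intro kill) auto
      moreover have "e r q (m + k) u = 0" using m' pq rs 3 by (intro kill) (auto simp: k_def)
      ultimately show ?thesis
        using 3 pq rs comm_e[of r p p q m k u] by (simp add: e_0)
    next
      case 4
      then have m': "b s - b q + 1 \<le> m" using m pq rs by auto
      have "e q s m u = 0" using m' pq rs 4 by (intro kill) auto
      moreover have "e p s (m + k) u = 0" using m' pq rs 4 by (intro kill) (auto simp: k_def)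
      ultimately show ?thesis
        using 4 pq rs comm_e[of q s p q m k u] by (simp add: e_0)
    next
      case 5
      then have m': "m + 1 > b s - b p - 1" using m pq rs by auto
      show ?thesis
        using 5 pq rs m' by (intro polarized_relation[OF pq, of q s]) (auto intro: kill kill_k)
    next
      case 6
      then have m': "m + 1 > b q - b r - 1" using m pq rs by auto
      show ?thesis
        using 6 pq rs m' by (intro polarized_relation[OF pq, of r p]) (auto intro: kill kill_k)
    next
      case 7
      then have "e r s m u = 0" using m rs by (intro kill) auto
      then show ?thesis using 7 pq rs comm_e[of r s p q m k u] by (simp add: e_0)
    qed
  qed
  have on: "e r r m (e p q k u) = (if m = 0 then of_int (?b r) *s e p q k u else 0)" if r: "r < n" "0 \<le> m" for r m
  proof -
    have "e p q (m + k) u = 0" if "m \<noteq> 0" using that r by (intro kill_k) auto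
    then show ?thesis
      using pq r comm_e[of r r p q m k u] by (auto simp: diag e_simps scale_left_distrib scale_left_diff_distrib)
  qed
  \<comment> \<open>Nonvanishing: the commutator is the scalar \<open>b q - b p - k\<close>, which
    is 1 for this choice of \<open>k\<close>.\<close>
  have "e q p (- k) (e p q k u) = u"
  proof -
    have "e q p (- k) u = 0" using pq by (intro kill) (auto simp: k_def)
    then have "e q p (- k) (e p q k u) = of_int (b q) *s u - of_int (b p) *s u + (of_int (- k)) *s u"
      using pq comm_e[of q p p q "- k" k u] by (simp add: diag e_0)
    also have "\<dots> = of_int (b q - b p - k) *s u"
      by (simp add: scale_left_diff_distrib scale_left_distrib)
    finally show ?thesis by (simp add: k_def)
  qed
  then have "e p q k u \<noteq> 0" using b pq by (auto simp: extremal_def e_0)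
  then show ?thesis
    using off on unfolding extremal_def k_def[symmetric] by blast
qed

section \<open>Words in the simple root currents\<close>

definition x :: "nat \<Rightarrow> int \<Rightarrow> 'a \<Rightarrow> 'a" where
  "x i = e (i - 1) i"

fun act_word :: "(nat \<times> int) list \<Rightarrow> 'a \<Rightarrow> 'a" where
  "act_word [] u = u"
| "act_word ((i, m) # w) u = act_word w (x i m u)"

lemma x_add: "i < n \<Longrightarrow> x i m (u + w) = x i m u + x i m w"
  and x_scale: "i < n \<Longrightarrow> x i m (a *s u) = a *s x i m u"
  and x_0: "i < n \<Longrightarrow> x i m 0 = 0"
  and x_sum: "i < n \<Longrightarrow> x i m (sum f A) = (\<Sum>a\<in>A. x i m (f a))"
  by (simp_all add: x_def e_simps)

lemma act_word_0: "fst ` set w \<subseteq> {1..<n} \<Longrightarrow> act_word w 0 = 0"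
  by (induction w) (auto simp: x_0)

lemma act_word_add: "fst ` set w \<subseteq> {1..<n} \<Longrightarrow> act_word w (u + u') = act_word w u + act_word w u'"
  by (induction w arbitrary: u u') (auto simp: x_add)

lemma act_word_scale: "fst ` set w \<subseteq> {1..<n} \<Longrightarrow> act_word w (a *s u) = a *s act_word w u"
  by (induction w arbitrary: u) (auto simp: x_scale)

lemma act_word_append: "act_word (w @ w') u = act_word w' (act_word w u)"
  by (induction w arbitrary: u) auto

section \<open>Elementary symmetric functions in the Heisenberg modes\<close>

definition h :: "nat \<Rightarrow> int \<Rightarrow> 'a \<Rightarrow> 'a" where
  "h j k u = (\<Sum>p<j. e p p k u)"

lemma h_add: "j \<le> n \<Longrightarrow> h j k (u + w) = h j k u + h j k w"
  by (simp add: h_def e_simps sum.distrib)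

lemma h_scale: "j \<le> n \<Longrightarrow> h j k (a *s u) = a *s h j k u"
  by (simp add: h_def e_simps scale_sum_right)

lemma h_0: "j \<le> n \<Longrightarrow> h j k 0 = 0"
  by (simp add: h_def e_simps)

lemma h_x:
  assumes "j \<le> n" "i \<in> {1..<n}"
  shows "h j k (x i m u) = x i m (h j k u) + (if i = j then x i (m + k) u else 0)"
proof -
  have "h j k (x i m u) = (\<Sum>p<j. x i m (e p p k u)
      + (if i - 1 = p then x i (m + k) u else 0) - (if i = p then x i (m + k) u else 0))"
    unfolding h_def
  proof (intro sum.cong refl)
    fix p assume "p \<in> {..<j}"
    then show "e p p k (x i m u) = x i m (e p p k u)
        + (if i - 1 = p then x i (m + k) u else 0) - (if i = p then x i (m + k) u else 0)"
      using assms comm_e[of p p "i - 1" i k m u] by (auto simp: x_def add.commute)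
  qed
  then show ?thesis
    using assms by (auto simp: sum_subtractf sum.distrib h_def x_sum)
qed

text \<open>Newton's identities with the power sums \<open>p_k\<close> replaced by the operators \<open>h j k\<close>: on
  \<open>x_j(z_1) \<dots> x_j(z_r) u\<close>, with \<open>u\<close> a Heisenberg vacuum, \<open>h j k\<close> multiplies by \<open>p_k(z)\<close> and hence \<open>elem j t\<close> by
  the elementary symmetric polynomial \<open>e_t(z)\<close>.\<close>

function elem :: "nat \<Rightarrow> nat \<Rightarrow> 'a \<Rightarrow> 'a" where
  "elem j 0 u = u"
| "elem j (Suc t) u = (1 / of_nat (Suc t)) *s (\<Sum>i<Suc t. (- 1) ^ i *s h j (int i + 1) (elem j (t - i) u))"
  by pat_completeness auto
termination by (relation "measure (\<lambda>(j, t, u). t)") auto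

lemma newton: "of_nat t *s elem j t u = (\<Sum>i<t. (- 1) ^ i *s h j (int i + 1) (elem j (t - 1 - i) u))"
  by (cases t) (simp_all del: of_nat_Suc sum.lessThan_Suc)

lemma elem_add: "j \<le> n \<Longrightarrow> elem j t (u + w) = elem j t u + elem j t w"
proof (induction t rule: less_induct)
  case (less t)
  then show ?case
    by (cases t) (simp_all add: h_add scale_right_distrib sum.distrib del: of_nat_Suc sum.lessThan_Suc)
qed

lemma elem_scale: "j \<le> n \<Longrightarrow> elem j t (a *s u) = a *s elem j t u"
proof (induction t rule: less_induct)
  case (less t)
  then show ?case
    by (cases t) (simp_all add: h_scale scale_sum_right mult.commute mult.left_commute del: of_nat_Suc sum.lessThan_Suc)
qed

lemma elem_0: "j \<le> n \<Longrightarrow> elem j t 0 = 0"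
  using elem_scale[of j t 0 0] by simp

lemma elem_sum: "j \<le> n \<Longrightarrow> elem j t (sum f A) = (\<Sum>a\<in>A. elem j t (f a))"
  by (induction A rule: infinite_finite_induct) (auto simp: elem_0 elem_add)

text \<open>This is \<open>e_t(z, ...) = e_t + z * e_(t-1)\<close> for one more variable
  \<open>z\<close>, multiplication by \<open>z\<close> being the shift of the new mode by 1. The
  induction runs through Newton's identity, since only the commutators of the power sums are
  given.\<close>

lemma elem_x:
  assumes "j \<le> n" "i \<in> {1..<n}"
  shows "elem j t (x i m u) = x i m (elem j t u)
    + (if i = j \<and> 0 < t then x i (m + 1) (elem j (t - 1) u) else 0)"
proof (induction t rule: less_induct)
  case (less t)
  show ?case
  proof (cases t)
    case 0
    then show ?thesis by simp
  next
    case (Suc s)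
    have i: "i < n" using assms by simp
    define d where "d = (if i = j then 1 else 0 :: complex)"
    define y where "y k = x i (m + 1 + int k) (elem j (s - k) u)" for k
    have comm: "h j (int k + 1) (elem j (s - k) (x i m u))
        = x i m (h j (int k + 1) (elem j (s - k) u)) + d *s y k
          + (if k < s then d *s x i (m + 1) (h j (int k + 1) (elem j (s - 1 - k) u)) + d *s y (Suc k) else 0)"
      if k: "k < Suc s" for k
    proof -
      have "elem j (s - k) (x i m u) = x i m (elem j (s - k) u)
          + (if k < s then d *s x i (m + 1) (elem j (s - 1 - k) u) else 0)"
        using less.IH[of "s - k"] Suc by (auto simp: d_def)
      then show ?thesis
        using assms k by (auto simp: h_add h_scale h_0 h_x d_def y_def algebra_simps)
    qed
    \<comment> \<open>Modes shifted by more than 1 cancel in pairs by alternating signs; only the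
      shift by 1 remains.\<close>
    have alt: "(\<Sum>k<Suc s. (- 1) ^ k *s (d *s y k)) + (\<Sum>k<s. (- 1) ^ k *s (d *s y (Suc k))) = d *s y 0"
      by (subst sum.lessThan_Suc_shift) (simp add: sum_negf)
    have "of_nat (Suc s) *s elem j t (x i m u)
        = (\<Sum>k<Suc s. (- 1) ^ k *s h j (int k + 1) (elem j (s - k) (x i m u)))"
      using newton[of "Suc s" j "x i m u"] Suc by simp
    also have "\<dots> = (\<Sum>k<Suc s. (- 1) ^ k *s x i m (h j (int k + 1) (elem j (s - k) u)))
        + (\<Sum>k<Suc s. (- 1) ^ k *s (d *s y k))
        + (\<Sum>k<Suc s. if k < s then (- 1) ^ k *s (d *s x i (m + 1) (h j (int k + 1) (elem j (s - 1 - k) u)))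
            + (- 1) ^ k *s (d *s y (Suc k)) else 0)"
      unfolding sum.distrib[symmetric]
      by (intro sum.cong refl) (simp add: comm scale_right_distrib)
    also have "(\<Sum>k<Suc s. if k < s then (- 1) ^ k *s (d *s x i (m + 1) (h j (int k + 1) (elem j (s - 1 - k) u)))
            + (- 1) ^ k *s (d *s y (Suc k)) else 0)
        = (\<Sum>k<s. (- 1) ^ k *s (d *s x i (m + 1) (h j (int k + 1) (elem j (s - 1 - k) u))))
          + (\<Sum>k<s. (- 1) ^ k *s (d *s y (Suc k)))"
      by (simp add: sum.distrib)
    also have "(\<Sum>k<Suc s. (- 1) ^ k *s x i m (h j (int k + 1) (elem j (s - k) u)))
        = x i m (of_nat (Suc s) *s elem j (Suc s) u)"
      unfolding newton using i by (simp add: x_sum x_scale del: sum.lessThan_Suc)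
    also have "(\<Sum>k<s. (- 1) ^ k *s (d *s x i (m + 1) (h j (int k + 1) (elem j (s - 1 - k) u))))
        = d *s x i (m + 1) (of_nat s *s elem j s u)"
      unfolding newton using i by (simp add: x_sum x_scale scale_sum_right mult.commute)
    finally have "of_nat (Suc s) *s elem j t (x i m u)
        = x i m (of_nat (Suc s) *s elem j (Suc s) u) + d *s x i (m + 1) (of_nat s *s elem j s u) + d *s y 0"
      using alt by (simp add: algebra_simps del: elem.simps sum.lessThan_Suc)
    also have "\<dots> = of_nat (Suc s) *s (x i m (elem j (Suc s) u) + d *s x i (m + 1) (elem j s u))"
      using i by (simp add: x_scale x_add y_def scale_right_distrib scale_left_distrib mult.commute distrib_left del: elem.simps)
    finally have "elem j t (x i m u) = x i m (elem j (Suc s) u) + d *s x i (m + 1) (elem j s u)"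
      by (metis of_nat_neq_0 scale_cancel_left)
    then show ?thesis using Suc by (simp add: d_def del: elem.simps)
  qed
qed

lemma elem_extremal:
  assumes "extremal b u" "j \<le> n" "0 < t"
  shows "elem j t u = 0"
  using assms(3)
proof (induction t rule: less_induct)
  case (less t)
  have h: "h j (int i + 1) u = 0" for i
    using assms(1,2) by (auto simp: h_def extremal_def intro!: sum.neutral)
  have "h j (int i + 1) (elem j (t - 1 - i) u) = 0" if "i < t" for i
    using less.IH[of "t - 1 - i"] h that assms(2) by (cases "t - 1 - i") (auto simp: h_0 simp del: elem.simps(2))
  then have "of_nat t *s elem j t u = 0" unfolding newton by simp
  then show ?case using less.prems by simp
qed

text \<open>\<open>T\<close> is the largest index for which \<open>elem j\<close> may be nonzero on
  the vector reached so far. Each letter of colour \<open>j\<close> raises it by 1, and at the top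
  index only the product of all the shifts survives.\<close>

lemma elem_act_word:
  assumes "j \<le> n" "fst ` set w \<subseteq> {1..<n}" "\<And>t. T < t \<Longrightarrow> elem j t u = 0" "elem j T u = u'"
  shows "elem j (T + count_list (map fst w) j) (act_word w u) = act_word (shift_word j w) u'"
  using assms(2-)
proof (induction w arbitrary: u u' T)
  case Nil
  then show ?case by (simp add: shift_word_def)
next
  case (Cons a w)
  obtain i m where a: "a = (i, m)" by (cases a)
  have i: "i \<in> {1..<n}" "i < n" using Cons.prems a by auto
  show ?case
  proof (cases "i = j")
    case True
    have 1: "elem j t (x i m u) = 0" if "Suc T < t" for t
      using that Cons.prems(2)[of t] Cons.prems(2)[of "t - 1"] elem_x[OF assms(1) i(1)] i by (simp add: x_0)
    have 2: "elem j (Suc T) (x i m u) = x i (m + 1) u'"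
      using Cons.prems(2)[of "Suc T"] Cons.prems(3) elem_x[OF assms(1) i(1), of "Suc T"] True i
      by (simp add: x_0 del: elem.simps)
    show ?thesis
      using Cons.IH[OF _ 1 2] Cons.prems(1) True a by (simp add: shift_word_def del: elem.simps)
  next
    case False
    have 1: "elem j t (x i m u) = 0" if "T < t" for t
      using that Cons.prems(2)[of t] elem_x[OF assms(1) i(1)] False i by (simp add: x_0)
    have 2: "elem j T (x i m u) = x i m u'"
      using Cons.prems(3) elem_x[OF assms(1) i(1)] False by simp
    show ?thesis
      using Cons.IH[OF _ 1 2] Cons.prems(1) False a by (simp add: shift_word_def)
  qed
qed

section \<open>Linear independence\<close>

text \<open>The mode from which \<open>x i\<close> kills an extremal vector of weight
  \<open>b\<close>.\<close>

definition cutoff :: "(nat \<Rightarrow> int) \<Rightarrow> nat \<Rightarrow> int" where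
  "cutoff b i = b i - b (i - 1)"

theorem admissible_words_independent:
  assumes "extremal b u" "sorted cs" "set cs \<subseteq> {1..<n}" "finite S"
    "\<And>ms. ms \<in> S \<Longrightarrow> admissible (cutoff b) cs ms"
    "(\<Sum>ms\<in>S. a ms *s act_word (zip cs ms) u) = 0"
  shows "\<forall>ms\<in>S. a ms = 0"
  using assms
proof (induction cs arbitrary: b u S a)
  case Nil
  then have "S \<subseteq> {[]}" by auto
  then have "S = {} \<or> S = {[]}" by blast
  then show ?case using Nil.prems(1,6) by (auto simp: extremal_def)
next
  case (Cons i cs)
  define c where "c = cutoff b"
  define b' where "b' = b(i - 1 := b (i - 1) + 1, i := b i - 1)"
  have i: "i \<in> {1..<n}" "i < n" "i \<le> n" "i - 1 < n" "i - 1 \<noteq> i" and le: "\<And>k. k \<in> set cs \<Longrightarrow> i \<le> k"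
    using Cons.prems(2,3) by auto
  have ext: "extremal b' (x i (c i - 1) u)"
    using extremal_step[OF Cons.prems(1) i(4,2,5)] by (simp add: b'_def x_def c_def cutoff_def)
  have xc: "x i (c i) u = 0"
    using Cons.prems(1) i by (auto simp: extremal_def x_def c_def cutoff_def)
  \<comment> \<open>If all first modes are maximal, the common first letter is absorbed into the
    vector, which becomes extremal of weight \<open>b'\<close>, and the outer induction hypothesis
    applies.\<close>
  have base: "\<forall>ms\<in>S. a ms = 0"
    if S: "finite S" "\<And>ms. ms \<in> S \<Longrightarrow> admissible c (i # cs) ms" "\<And>ms. ms \<in> S \<Longrightarrow> hd ms = c i - 1"
      "(\<Sum>ms\<in>S. a ms *s act_word (zip (i # cs) ms) u) = 0" for S a
  proof -
    have ms: "ms = (c i - 1) # tl ms" if "ms \<in> S" for ms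
      using S(2,3)[OF that] by (cases ms) auto
    have inj: "inj_on tl S" using ms by (metis inj_onI)
    have "\<forall>ms\<in>tl ` S. a ((c i - 1) # ms) = 0"
    proof (rule Cons.IH[OF ext])
      show "(\<Sum>ms\<in>tl ` S. a ((c i - 1) # ms) *s act_word (zip cs ms) (x i (c i - 1) u)) = 0"
        unfolding sum.reindex[OF inj] S(4)[symmetric] o_def
      proof (intro sum.cong refl)
        fix ms assume "ms \<in> S"
        from ms[OF this] obtain t where "ms = (c i - 1) # t" by blast
        then show "a ((c i - 1) # tl ms) *s act_word (zip cs (tl ms)) (x i (c i - 1) u)
            = a ms *s act_word (zip (i # cs) ms) u" by simp
      qed
    next
      fix t assume "t \<in> tl ` S"
      then have "(c i - 1) # t \<in> S" using ms by auto
      then have "admissible (c(i := c i - 1 - 1, Suc i := c (Suc i) + 1)) cs t"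
        using S(2) by fastforce
      \<comment> \<open>The two bounds can differ at colour \<open>i - 1\<close>, which no longer
        occurs in \<open>cs\<close>.\<close>
      moreover have "admissible (c(i := c i - 1 - 1, Suc i := c (Suc i) + 1)) cs t = admissible (cutoff b') cs t"
      proof (rule admissible_cong[OF _ le])
        fix k assume "i \<le> k"
        then consider "k = i" | "k = Suc i" | "Suc i < k" by linarith
        then show "(c(i := c i - 1 - 1, Suc i := c (Suc i) + 1)) k = cutoff b' k"
          using i by cases (auto simp: c_def cutoff_def b'_def)
      qed
      ultimately show "admissible (cutoff b') cs t" by simp
    qed (use Cons.prems S in auto)
    then show ?thesis using ms by (metis imageI)
  qed
  \<comment> \<open>\<open>K\<close> bounds how far the first modes lie below the maximum.
    \<open>elem i r\<close> turns the first letter of a word in \<open>S1\<close> into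
    \<open>x i (c i)\<close>, which kills \<open>u\<close>, and brings the words in
    \<open>S2\<close> one step closer to the maximum. So the coefficients on \<open>S2\<close>
    vanish by induction, and \<open>base\<close> handles what is left.\<close>
  have gap: "\<forall>ms\<in>S. a ms = 0"
    if S: "finite S" "\<And>ms. ms \<in> S \<Longrightarrow> admissible c (i # cs) ms" "\<And>ms. ms \<in> S \<Longrightarrow> c i - 1 - int K \<le> hd ms"
      "(\<Sum>ms\<in>S. a ms *s act_word (zip (i # cs) ms) u) = 0" for K S a
    using S
  proof (induction K arbitrary: S a)
    case 0
    have "hd ms = c i - 1" if "ms \<in> S" for ms
      using 0(2,3)[OF that] by (cases ms) auto
    then show ?case using 0 by (intro base) auto
  next
    case (Suc K)
    define r where "r = count_list (i # cs) i"
    let ?R = "raise_modes i (i # cs)"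
    define S1 where "S1 = {ms \<in> S. hd ms = c i - 1}"
    define S2 where "S2 = {ms \<in> S. hd ms < c i - 1}"
    have len: "length ms = Suc (length cs)" if "ms \<in> S" for ms
      using admissible_length[OF Suc.prems(2)[OF that]] by simp
    have S12: "S = S1 \<union> S2" "S1 \<inter> S2 = {}" "finite S1" "finite S2"
    proof -
      have "hd ms < c i" if "ms \<in> S" for ms using Suc.prems(2)[OF that] by (cases ms) auto
      then show "S = S1 \<union> S2" by (force simp: S1_def S2_def)
    qed (use Suc.prems(1) in \<open>auto simp: S1_def S2_def\<close>)
    have inj: "inj_on ?R S2"
      using inj_on_raise_modes by (rule inj_on_subset) (auto simp: S2_def len)
    have elem: "elem i r (act_word (zip (i # cs) ms) u) = act_word (zip (i # cs) (?R ms)) u" if "ms \<in> S" for ms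
    proof -
      have mf: "map fst (zip (i # cs) ms) = i # cs" using len[OF that] by simp
      then have "fst ` set (zip (i # cs) ms) = set (i # cs)" by (metis set_map)
      then show ?thesis
        using elem_act_word[of i "zip (i # cs) ms" 0 u u] elem_extremal[OF Cons.prems(1) i(3)] Cons.prems(3) i(3)
          len[OF that] unfolding mf r_def by (simp add: zip_raise_modes del: zip_Cons raise_modes.simps)
    qed
    have S1z: "act_word (zip (i # cs) (?R ms)) u = 0" if "ms \<in> S1" for ms
    proof -
      have "ms \<in> S" "hd ms = c i - 1" using that by (auto simp: S1_def)
      then obtain t where t: "ms = (c i - 1) # t" using len[of ms] by (cases ms) auto
      have "fst ` set (zip cs (raise_modes i cs t)) \<subseteq> {1..<n}"
        using Cons.prems(3) by (auto dest: set_zip_leftD)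
      then show ?thesis using t xc by (simp add: act_word_0)
    qed
    have "elem i r (\<Sum>ms\<in>S. a ms *s act_word (zip (i # cs) ms) u) = 0"
      using Suc.prems(4) elem_0[OF i(3)] by simp
    then have "(\<Sum>ms\<in>S. a ms *s act_word (zip (i # cs) (?R ms)) u) = 0"
      using elem by (simp add: elem_sum[OF i(3)] elem_scale[OF i(3)])
    then have "(\<Sum>ms\<in>S2. a ms *s act_word (zip (i # cs) (?R ms)) u) = 0"
      unfolding S12(1) using S12(2-4) S1z by (subst (asm) sum.union_disjoint) auto
    then have z2: "(\<Sum>ms\<in>?R ` S2. a (the_inv_into S2 ?R ms) *s act_word (zip (i # cs) ms) u) = 0"
      unfolding sum.reindex[OF inj] o_def by (simp add: the_inv_into_f_f[OF inj] cong: sum.cong del: raise_modes.simps zip_Cons)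
    have "\<forall>ms\<in>?R ` S2. a (the_inv_into S2 ?R ms) = 0"
    proof (rule Suc.IH[OF _ _ _ z2])
      fix ms assume "ms \<in> ?R ` S2"
      then obtain ms0 where ms0: "ms0 \<in> S2" "ms = ?R ms0" by blast
      then have ms0S: "ms0 \<in> S" "hd ms0 < c i - 1" by (auto simp: S2_def)
      then obtain m t where t: "ms0 = m # t" using len[of ms0] by (cases ms0) auto
      have l: "length t = length cs" using len[OF ms0S(1)] t by simp
      have "admissible (c(i := m - 1, Suc i := c (Suc i) + 1)) cs t"
        using Suc.prems(2)[OF ms0S(1)] t by simp
      then have "admissible ((c(Suc i := c (Suc i) + 1))(i := m - 1)) cs t"
        by (simp add: fun_upd_twist)
      then have "admissible ((c(Suc i := c (Suc i) + 1))(i := m - 1 + 1)) cs (raise_modes i cs t)"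
        using le l by (subst admissible_raise) auto
      then have "admissible (c(i := m, Suc i := c (Suc i) + 1)) cs (raise_modes i cs t)"
        by (simp add: fun_upd_twist)
      then show "admissible c (i # cs) ms" using ms0 ms0S t by simp
      show "c i - 1 - int K \<le> hd ms" using Suc.prems(3)[OF ms0S(1)] ms0 t by simp
    qed (use S12 in auto)
    then have a2: "\<forall>ms\<in>S2. a ms = 0" by (simp add: the_inv_into_f_f[OF inj])
    then have "(\<Sum>ms\<in>S1. a ms *s act_word (zip (i # cs) ms) u) = 0"
      using Suc.prems(4) unfolding S12(1) using S12(2-4) by (subst (asm) sum.union_disjoint) auto
    then have "\<forall>ms\<in>S1. a ms = 0"
      using S12(3) Suc.prems(2) by (intro base[of S1 a]) (auto simp: S1_def)
    then show ?case using a2 S12(1) by blast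
  qed
  have "\<exists>K. \<forall>ms\<in>S. c i - 1 - int K \<le> hd ms"
  proof (cases "S = {}")
    case False
    let ?m = "Min (hd ` S)"
    have "?m \<le> hd ms" if "ms \<in> S" for ms using that Cons.prems(4) by simp
    then show ?thesis by (intro exI[of _ "nat (c i - 1 - ?m)"]) force
  qed simp
  then obtain K where "\<forall>ms\<in>S. c i - 1 - int K \<le> hd ms" by blast
  then show ?case
    using Cons.prems(4-6) unfolding c_def[symmetric] by (intro gap[of S K]) auto
qed

end

context vacuum_module
begin

section \<open>Spanning\<close>

lemma x_far: "i \<in> {1..<n} \<Longrightarrow> j \<in> {1..<n} \<Longrightarrow> Suc i < j \<Longrightarrow> x i m (x j a u) = x j a (x i m u)"
  using comm_e[of "i - 1" i "j - 1" j m a u] by (auto simp: x_def)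

lemma x_same: "i \<in> {1..<n} \<Longrightarrow> x i m (x i a u) = x i a (x i m u)"
  unfolding x_def by (intro root_commute) auto

lemma x_adjacent: "i \<in> {1..<n} \<Longrightarrow> Suc i < n \<Longrightarrow>
    x i m (x (Suc i) a u) = x (Suc i) a (x i m u) + e (i - 1) (Suc i) (m + a) u"
  using comm_e[of "i - 1" i i "Suc i" m a u] by (auto simp: x_def)

lemma x_in_span:
  assumes "i < n" "\<And>u. u \<in> A \<Longrightarrow> x i m u \<in> span B" "u \<in> span A"
  shows "x i m u \<in> span B"
  using assms e_in_span[of "i - 1" i A m B u] by (simp add: x_def)

lemma colours: "mset (map fst w) = s \<Longrightarrow> fst ` set w = set_mset s"
  by (metis set_map set_mset_mset)

text \<open>Letters of the smallest colour \<open>i\<close> are carried past the others to the place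
  acting first. Only colour \<open>i + 1\<close> resists, and its commutator with \<open>x i\<close>
  depends just on the sum of the two modes.\<close>

lemma leading_letter:
  assumes "fst ` set w \<subseteq> {1..<n}" "\<And>k. k \<in> fst ` set w \<Longrightarrow> i \<le> k" "i \<in> fst ` set w"
  shows "act_word w u \<in> span {act_word ((i, m) # w') u | m w'.
    add_mset i (mset (map fst w')) = mset (map fst w) \<and> m + sum_list (map snd w') = sum_list (map snd w)}"
  (is "_ \<in> span (?W w u)")
  using assms
proof (induction w arbitrary: u)
  case Nil
  then show ?case by simp
next
  case (Cons p w)
  obtain k a where p: "p = (k, a)" by (cases p)
  let ?G = "?W (p # w) u"
  have G: "act_word ((i, m) # w') u \<in> span ?G"
    if "add_mset i (mset (map fst w')) = mset (map fst (p # w))" "m + sum_list (map snd w') = sum_list (map snd (p # w))"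
    for m w' using that by (intro span_base) blast
  show ?case
  proof (cases "k = i")
    case True
    then show ?thesis using G[of w a] p by simp
  next
    case False
    then have k: "i < k" "k \<in> {1..<n}" and i: "i \<in> {1..<n}" "i \<in> fst ` set w"
      using Cons.prems(1,3) Cons.prems(2)[of k] p by auto
    have "act_word w (x k a u) \<in> span (?W w (x k a u))"
      using Cons.prems i by (intro Cons.IH) auto
    moreover have "act_word ((i, m) # w') (x k a u) \<in> span ?G"
      if w': "add_mset i (mset (map fst w')) = mset (map fst w)" "m + sum_list (map snd w') = sum_list (map snd w)" for m w'
    proof (cases "k = Suc i")
      case False
      then have "x i m (x k a u) = x k a (x i m u)" using i k by (intro x_far) auto
      then show ?thesis using G[of "(k, a) # w'" m] w' p by (simp add: add_mset_commute add.left_commute)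
    next
      case True
      obtain M where M: "bounded_by u M" using bounded_ex by blast
      \<comment> \<open>Splitting \<open>m + a\<close> as \<open>?m + M\<close> with
        \<open>x k M u = 0\<close> leaves one ordering of the commutator, and in it colour
        \<open>i\<close> acts first.\<close>
      let ?m = "m + a - M"
      have "x k M u = 0" using bounded_byD[OF M order.refl] k by (auto simp: x_def)
      then have "e (i - 1) k (m + a) u = - x k M (x i ?m u)"
        using x_adjacent[OF i(1), of ?m M u] k True i by (simp add: x_0 eq_neg_iff_add_eq_0 add.commute)
      then have "x i m (x k a u) = x k a (x i m u) + (- 1) *s x k M (x i ?m u)"
        using x_adjacent[OF i(1), of m a u] k True by simp
      moreover have "fst ` set w' \<subseteq> {1..<n}"
      proof -
        have "fst ` set w' \<subseteq> fst ` set w" using arg_cong[OF w'(1), of set_mset] by auto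
        then show ?thesis using Cons.prems(1) by auto
      qed
      ultimately have "act_word ((i, m) # w') (x k a u)
          = act_word ((i, m) # (k, a) # w') u + (- 1) *s act_word ((i, ?m) # (k, M) # w') u"
        by (simp only: act_word.simps act_word_add act_word_scale)
      moreover have "act_word ((i, m) # (k, a) # w') u \<in> span ?G" "act_word ((i, ?m) # (k, M) # w') u \<in> span ?G"
        using w' p by (intro G; simp add: add_mset_commute)+
      ultimately show ?thesis by (simp only: span_add span_scale)
    qed
    then have "span (?W w (x k a u)) \<subseteq> span ?G"
      by (intro span_minimal) auto
    ultimately show ?thesis using p by auto
  qed
qed

text \<open>The family \<open>F\<close> stands for the vectors that are already understood, graded by colour content and
  total mode; the induction works modulo \<open>F\<close> and applies the induction hypothesis to \<open>x i m u\<close> modulo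
  the words whose first letter is \<open>(i, m')\<close> with \<open>m' > m\<close>.\<close>

theorem admissible_words_span:
  fixes F :: "nat multiset \<Rightarrow> int \<Rightarrow> 'a set" and c :: "nat \<Rightarrow> int"
  assumes "sorted cs" "set cs \<subseteq> {1..<n}"
    and "\<And>s N. subspace (F s N)"
    and "\<And>i m s N w. i \<in> {1..<n} \<Longrightarrow> w \<in> F s N \<Longrightarrow> x i m w \<in> F (add_mset i s) (N + m)"
    and "\<And>i m. i \<in> set cs \<Longrightarrow> c i \<le> m \<Longrightarrow> x i m u \<in> F {#i#} m"
    and "mset (map fst w) = mset cs"
  shows "act_word w u \<in> span (F (mset cs) (sum_list (map snd w)) \<union>
    {act_word (zip cs ms) u | ms. admissible c cs ms \<and> sum_list ms = sum_list (map snd w)})"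
  using assms
proof (induction cs arbitrary: c F u w)
  case Nil
  then have "act_word w u \<in> {act_word (zip [] ms) u | ms. admissible c [] ms \<and> sum_list ms = sum_list (map snd w)}"
    by auto
  then show ?case by (auto intro: span_base)
next
  case (Cons i cs)
  note subF = Cons.prems(3) and xF = Cons.prems(4) and cF = Cons.prems(5)
  have i: "i \<in> {1..<n}" "i < n" and cs: "set cs \<subseteq> {1..<n}" and le: "\<And>k. k \<in> set cs \<Longrightarrow> i \<le> k"
    using Cons.prems(1,2) by auto
  define T where "T K = span (F (mset (i # cs)) K \<union>
    {act_word (zip (i # cs) ms) u | ms. admissible c (i # cs) ms \<and> sum_list ms = K})" for K
  have wF: "act_word w y \<in> F (mset (map fst w) + s) (N + sum_list (map snd w))"
    if "y \<in> F s N" "fst ` set w \<subseteq> {1..<n}" for w y s N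
    using that
  proof (induction w arbitrary: y s N)
    case (Cons p w)
    obtain k a where p: "p = (k, a)" by (cases p)
    have "act_word w (x k a y) \<in> F (mset (map fst w) + add_mset k s) (N + a + sum_list (map snd w))"
      using Cons.prems p by (intro Cons.IH xF) auto
    then show ?case using p by (simp add: add.assoc)
  qed simp
  \<comment> \<open>The induction descends in \<open>m\<close>: from \<open>c i\<close> upwards the
    vector already lies in \<open>F\<close>.\<close>
  have main: "act_word w (x i m u) \<in> T (m + sum_list (map snd w))" if "mset (map fst w) = mset cs" for m w
    using that
  proof (induction "nat (c i - m)" arbitrary: m w rule: less_induct)
    case less
    have fw: "fst ` set w \<subseteq> {1..<n}" using colours[OF less.prems] cs by simp
    show ?case
    proof (cases "c i \<le> m")
      case True
      then show ?thesis
        using wF[OF cF[OF _ True] fw] less.prems unfolding T_def by (intro span_base) simp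
    next
      case False
      let ?H = "\<lambda>s K. {act_word w (x i m' u) | w m'.
        m < m' \<and> mset (map fst w) = s \<and> fst ` set w \<subseteq> {1..<n} \<and> m' + sum_list (map snd w) = K + m}"
      \<comment> \<open>The new family counts colours and modes without the letter
        \<open>(i, m)\<close>, hence the shifted indices of \<open>F\<close>.\<close>
      define F' where "F' s K = span (F (add_mset i s) (K + m) \<union> ?H s K)" for s K
      have subF': "subspace (F' s K)" for s K unfolding F'_def by simp
      define c' where "c' = c(i := m - 1, Suc i := c (Suc i) + 1)"
      have F'F: "y \<in> F' s K" if "y \<in> F (add_mset i s) (K + m)" for y s K
        using that unfolding F'_def by (intro span_base) simp
      have F'w: "act_word w (x i m' u) \<in> F' s K"
        if "m < m'" "mset (map fst w) = s" "fst ` set w \<subseteq> {1..<n}" "m' + sum_list (map snd w) = K + m" for w m' s K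
        using that unfolding F'_def by (intro span_base) blast
      have "act_word w (x i m u) \<in> span (F' (mset cs) (sum_list (map snd w)) \<union>
        {act_word (zip cs ms) (x i m u) | ms. admissible c' cs ms \<and> sum_list ms = sum_list (map snd w)})"
      proof (rule Cons.IH[OF _ cs _ _ _ less.prems])
        show "sorted cs" using Cons.prems(1) by simp
        show "subspace (F' s N)" for s N by (rule subF')
      next
        fix j a s N y assume j: "j \<in> {1..<n}" and y: "y \<in> F' s N"
        show "x j a y \<in> F' (add_mset j s) (N + a)"
          unfolding F'_def[of "add_mset j s"]
        proof (rule x_in_span[OF _ _ y[unfolded F'_def]])
          fix z assume "z \<in> F (add_mset i s) (N + m) \<union> ?H s N"
          then have "x j a z \<in> F' (add_mset j s) (N + a)"
          proof
            assume "z \<in> F (add_mset i s) (N + m)"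
            then have "x j a z \<in> F (add_mset j (add_mset i s)) (N + m + a)" using j by (intro xF)
            then show ?thesis by (intro F'F) (simp add: add_mset_commute algebra_simps)
          next
            assume "z \<in> ?H s N"
            then obtain w m' where z: "z = act_word w (x i m' u)" "m < m'" "mset (map fst w) = s"
              "fst ` set w \<subseteq> {1..<n}" "m' + sum_list (map snd w) = N + m" by blast
            have "act_word (w @ [(j, a)]) (x i m' u) \<in> F' (add_mset j s) (N + a)"
              using z j by (intro F'w[of m']) auto
            then show ?thesis using z by (simp add: act_word_append)
          qed
          then show "x j a z \<in> span (F (add_mset i (add_mset j s)) (N + a + m) \<union> ?H (add_mset j s) (N + a))"
            unfolding F'_def .
        qed (use j in auto)
      next
        fix j a assume j: "j \<in> set cs" "c' j \<le> a"
        have jn: "j \<in> {1..<n}" using j cs by blast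
        consider "j = i" "m < a" | "j = i" "a = m \<or> a = m - 1" | "j = Suc i" | "Suc i < j"
          using le[OF j(1)] j(2) by (fastforce simp: c'_def)
        then show "x j a (x i m u) \<in> F' {#j#} a"
        proof cases
          case 1
          have "act_word [(i, m)] (x i a u) \<in> F' {#j#} a"
            using 1 i by (intro F'w) auto
          then show ?thesis using 1 x_same[OF i(1)] by simp
        next
          case 2
          \<comment> \<open>The coefficient of \<open>x_i(z)^2 = 0\<close> in total mode
            \<open>a + m\<close>. Apart from \<open>b = a\<close> and \<open>b = m\<close>, one of
            the two modes exceeds \<open>m\<close>, so the term lies in \<open>F'\<close>. The two
            exceptional terms are equal, or coincide when \<open>a = m\<close>; hence the later
            factor \<open>1 / 2\<close> or 1.\<close>
          define g where "g b = x i b (x i (a + m - b) u)" for b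
          obtain M where M: "bounded_by u M" using bounded_ex by blast
          define B where "B = max M (\<bar>a\<bar> + \<bar>m\<bar>)"
          let ?I = "{a + m - B..B}"
          have "(\<Sum>b\<in>?I. g b) = 0"
          proof -
            have "(\<Sum>b\<in>?I. g b) = current_square (i - 1) i (a + m) u"
              unfolding g_def x_def using i by (intro current_square_eq[OF _ _ _ M, symmetric]) (auto simp: B_def)
            also have "\<dots> = 0" using i by (intro current_square_zero) auto
            finally show ?thesis .
          qed
          moreover have "{a, m} \<subseteq> ?I" by (auto simp: B_def)
          ultimately have "(\<Sum>b\<in>{a, m}. g b) = - (\<Sum>b\<in>?I - {a, m}. g b)"
            by (metis add.inverse_unique add.commute finite_atLeastAtMost_int sum.subset_diff)
          moreover have "(\<Sum>b\<in>?I - {a, m}. g b) \<in> F' {#i#} a"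
            unfolding F'_def
          proof (rule span_sum, fold F'_def)
            fix b assume b: "b \<in> ?I - {a, m}"
            then consider "m < b" | "m < a + m - b" using 2 by force
            then show "g b \<in> F' {#i#} a"
            proof cases
              case 1
              have "act_word [(i, a + m - b)] (x i b u) \<in> F' {#i#} a"
                using 1 i by (intro F'w) auto
              then show ?thesis using x_same[OF i(1)] by (simp add: g_def)
            next
              case 2
              have "act_word [(i, b)] (x i (a + m - b) u) \<in> F' {#i#} a"
                using 2 i by (intro F'w) auto
              then show ?thesis by (simp add: g_def)
            qed
          qed
          ultimately have s: "(\<Sum>b\<in>{a, m}. g b) \<in> F' {#i#} a"
            using subspace_neg[OF subF'] by simp
          have "g a = x i a (x i m u)" "g m = x i a (x i m u)"
            using x_same[OF i(1)] by (auto simp: g_def)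
          then have "x i a (x i m u) = (if a = m then 1 else 1 / 2) *s (\<Sum>b\<in>{a, m}. g b)"
            by (auto simp flip: scale_left_distrib simp: scale_right_distrib)
          then show ?thesis using subspace_scale[OF subF' s] 2 by simp
        next
          case 3
          \<comment> \<open>Locality in the form
            \<open>[x i m, x j a] = [x i (m + 1), x j (a - 1)]\<close> needs both
            \<open>x j a u\<close> and \<open>x j (a - 1) u\<close> in \<open>F\<close>; this is why
            the bound of colour \<open>i + 1\<close> rises by 1.\<close>
          then have a: "c j \<le> a - 1" "c j \<le> a" using j(2) by (auto simp: c'_def)
          have "x i m (x j a u) \<in> F' {#j#} a"
            using xF[OF i(1) cF[OF _ a(2)], of m] j by (intro F'F) (simp add: add.commute)
          moreover have "x i (m + 1) (x j (a - 1) u) \<in> F' {#j#} a"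
            using xF[OF i(1) cF[OF _ a(1)], of "m + 1"] j by (intro F'F) (simp add: add.commute)
          moreover have "act_word [(j, a - 1)] (x i (m + 1) u) \<in> F' {#j#} a"
            using jn by (intro F'w) auto
          moreover have "x j a (x i m u) = act_word [(j, a - 1)] (x i (m + 1) u)
              + (x i m (x j a u) - x i (m + 1) (x j (a - 1) u))"
            using x_adjacent[OF i(1), of m a u] x_adjacent[OF i(1), of "m + 1" "a - 1" u] 3 jn by simp
          ultimately show ?thesis unfolding F'_def by (simp only: span_add span_diff)
        next
          case 4
          then have "c j \<le> a" using j(2) by (auto simp: c'_def)
          then have "x i m (x j a u) \<in> F' {#j#} a"
            using xF[OF i(1) cF, of j a m] j by (intro F'F) (simp add: add.commute)
          then show ?thesis using x_far[OF i(1) jn 4] by simp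
        qed
      qed
      moreover have "span (F' (mset cs) (sum_list (map snd w)) \<union>
        {act_word (zip cs ms) (x i m u) | ms. admissible c' cs ms \<and> sum_list ms = sum_list (map snd w)})
        \<subseteq> T (m + sum_list (map snd w))" (is "_ \<subseteq> ?T")
      proof (rule span_minimal)
        have "F' (mset cs) (sum_list (map snd w)) \<subseteq> ?T"
          unfolding F'_def
        proof (rule span_minimal)
          show "F (add_mset i (mset cs)) (sum_list (map snd w) + m) \<union> ?H (mset cs) (sum_list (map snd w)) \<subseteq> ?T"
          proof
            fix z assume "z \<in> F (add_mset i (mset cs)) (sum_list (map snd w) + m) \<union> ?H (mset cs) (sum_list (map snd w))"
            then show "z \<in> ?T"
            proof
              assume "z \<in> F (add_mset i (mset cs)) (sum_list (map snd w) + m)"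
              then show ?thesis unfolding T_def by (intro span_base) (simp add: add.commute)
            next
              assume "z \<in> ?H (mset cs) (sum_list (map snd w))"
              then obtain w' m' where z: "z = act_word w' (x i m' u)" "m < m'" "mset (map fst w') = mset cs"
                "m' + sum_list (map snd w') = m + sum_list (map snd w)" by (auto simp: add.commute)
              have "z \<in> T (m' + sum_list (map snd w'))"
                unfolding z(1) using z False by (intro less.hyps) auto
              then show ?thesis using z(4) by simp
            qed
          qed
        qed (simp add: T_def)
        moreover have "act_word (zip cs ms) (x i m u) \<in> ?T"
          if "admissible c' cs ms" "sum_list ms = sum_list (map snd w)" for ms
        proof -
          have "admissible c (i # cs) (m # ms)" using that False by (simp add: c'_def)
          moreover have "act_word (zip (i # cs) (m # ms)) u = act_word (zip cs ms) (x i m u)" by simp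
          ultimately show ?thesis using that unfolding T_def
            by (intro span_base UnI2 CollectI exI[of _ "m # ms"]) simp
        qed
        ultimately show "F' (mset cs) (sum_list (map snd w)) \<union>
          {act_word (zip cs ms) (x i m u) | ms. admissible c' cs ms \<and> sum_list ms = sum_list (map snd w)} \<subseteq> ?T"
          by blast
      qed (simp add: T_def)
      ultimately show ?thesis by blast
    qed
  qed
  have w: "fst ` set w = set (i # cs)" using colours[OF Cons.prems(6)] by simp
  let ?W = "{act_word ((i, m) # w') u | m w'.
        add_mset i (mset (map fst w')) = mset (map fst w) \<and> m + sum_list (map snd w') = sum_list (map snd w)}"
  have "act_word w u \<in> span ?W"
    using w Cons.prems(2) le by (intro leading_letter) auto
  moreover have "?W \<subseteq> T (sum_list (map snd w))"
  proof
    fix z assume "z \<in> ?W"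
    then obtain m w' where z: "z = act_word w' (x i m u)" "add_mset i (mset (map fst w')) = mset (map fst w)"
      "m + sum_list (map snd w') = sum_list (map snd w)" by auto
    then have "mset (map fst w') = mset cs" using Cons.prems(6) by simp
    from main[OF this, of m] show "z \<in> T (sum_list (map snd w))" using z by simp
  qed
  ultimately show ?case unfolding T_def using span_minimal[OF _ subspace_span] by blast
qed

corollary admissible_words_span_v:
  assumes "sorted cs" "set cs \<subseteq> {1..<n}" "mset (map fst w) = mset cs"
  shows "act_word w v \<in> span {act_word (zip cs ms) v | ms. admissible (\<lambda>_. 0) cs ms \<and> sum_list ms = sum_list (map snd w)}"
proof -
  have "act_word w v \<in> span ((\<lambda>_ _. {0}) (mset cs) (sum_list (map snd w)) \<union>
    {act_word (zip cs ms) v | ms. admissible (\<lambda>_. 0) cs ms \<and> sum_list ms = sum_list (map snd w)})"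
  proof (rule admissible_words_span[OF assms(1,2) _ _ _ assms(3)])
    fix i and m :: int assume "i \<in> set cs" "0 \<le> m"
    then show "x i m v \<in> {0}" using assms(2) by (fastforce simp: x_def e_v)
  qed (auto simp: subspace_single_0 x_0)
  then show ?thesis by (simp add: span_insert_0)
qed

end

section \<open>Counting admissible mode lists\<close>

definition admissible_lists :: "(nat \<Rightarrow> int) \<Rightarrow> nat list \<Rightarrow> int \<Rightarrow> int list set" where
  "admissible_lists c cs N = {ms. admissible c cs ms \<and> sum_list ms = - N}"

text \<open>The degree of the list in which every mode is the largest still allowed, that is
  \<open>c i - 1\<close> at each letter.\<close>

fun min_degree :: "(nat \<Rightarrow> int) \<Rightarrow> nat list \<Rightarrow> int" where
  "min_degree c [] = 0"
| "min_degree c (i # cs) = 1 - c i + min_degree (c(i := c i - 2, Suc i := c (Suc i) + 1)) cs"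

text \<open>The letters of one colour contribute the exponents \<open>r\<close>,
  \<open>r - 1\<close>, ..., 1 in turn, so that their product is \<open>(q)_r\<close>.\<close>

fun denominator :: "nat list \<Rightarrow> complex fps" where
  "denominator [] = 1"
| "denominator (i # cs) = denominator cs * (1 - fps_X ^ (count_list (i # cs) i))"

text \<open>A crude bound: each letter raises the modes allowed later by at most 1. It gives the
  induction on the degree a starting point.\<close>

lemma admissible_sum_bound:
  assumes "admissible c cs ms" "\<And>i. c i \<le> C" "0 \<le> C"
  shows "sum_list ms \<le> int (length cs) * (C + int (length cs))"
  using assms
proof (induction c cs ms arbitrary: C rule: admissible.induct)
  case (3 c i cs m ms)
  have "sum_list ms \<le> int (length cs) * (C + 1 + int (length cs))"
  proof (rule 3(1))
    show "admissible (c(i := m - 1, Suc i := c (Suc i) + 1)) cs ms" using 3(2) by simp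
  next
    fix k show "(c(i := m - 1, Suc i := c (Suc i) + 1)) k \<le> C + 1"
      using 3(3)[of i] 3(3)[of k] 3(3)[of "Suc i"] 3(2) by auto
  next
    show "0 \<le> C + 1" using 3(4) by simp
  qed
  moreover have "m \<le> C" using 3(2) 3(3)[of i] by auto
  ultimately show ?case using 3(4) by (simp add: algebra_simps)
qed auto

lemma min_degree_bound:
  assumes "\<And>i. c i \<le> C" "0 \<le> C"
  shows "- (int (length cs) * (C + int (length cs))) \<le> min_degree c cs"
  using assms
proof (induction cs arbitrary: c C)
  case (Cons i cs)
  have "- (int (length cs) * (C + 1 + int (length cs))) \<le> min_degree (c(i := c i - 2, Suc i := c (Suc i) + 1)) cs"
  proof (rule Cons.IH)
    fix k show "(c(i := c i - 2, Suc i := c (Suc i) + 1)) k \<le> C + 1"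
      using Cons.prems(1)[of i] Cons.prems(1)[of k] Cons.prems(1)[of "Suc i"] by auto
  qed (use Cons.prems in auto)
  moreover have "c i \<le> C" using Cons.prems by auto
  ultimately show ?case using Cons.prems(2) by (simp add: algebra_simps)
qed simp

lemma sum_list_raise_modes:
  "length ms = length cs \<Longrightarrow> sum_list (raise_modes j cs ms) = sum_list ms + int (count_list cs j)"
  by (induction j cs ms rule: raise_modes.induct) auto

lemma raise_modes_surj:
  "length ms = length cs \<Longrightarrow> \<exists>ms'. length ms' = length cs \<and> raise_modes j cs ms' = ms"
proof (induction cs arbitrary: ms)
  case (Cons i cs)
  then obtain m t where ms: "ms = m # t" "length t = length cs" by (cases ms) auto
  then obtain t' where "length t' = length cs" "raise_modes j cs t' = t" using Cons.IH by blast
  then show ?case using ms by (intro exI[of _ "(if i = j then m - 1 else m) # t'"]) simp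
qed simp

text \<open>Either the first mode is maximal and can be deleted, or all modes of colour
  \<open>i\<close> can be raised by 1. For the generating functions this reads
  \<open>f = q^(1 - c i) f' + q^r f\<close>, with \<open>r\<close> the number of letters of colour
  \<open>i\<close>.\<close>

lemma admissible_lists_split:
  fixes c :: "nat \<Rightarrow> int" and N :: int
  assumes "\<forall>k\<in>set cs. i \<le> k"
  defines "c' \<equiv> c(i := c i - 2, Suc i := c (Suc i) + 1)"
  defines "A1 \<equiv> (#) (c i - 1) ` admissible_lists c' cs (N + c i - 1)"
  defines "A2 \<equiv> {ms \<in> admissible_lists c (i # cs) N. hd ms < c i - 1}"
  shows "admissible_lists c (i # cs) N = A1 \<union> A2" "A1 \<inter> A2 = {}"
    "bij_betw (raise_modes i (i # cs)) A2 (admissible_lists c (i # cs) (N - int (count_list (i # cs) i)))"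
proof -
  show "admissible_lists c (i # cs) N = A1 \<union> A2"
  proof (intro equalityI subsetI)
    fix ms assume ms: "ms \<in> admissible_lists c (i # cs) N"
    then obtain m t where t: "ms = m # t" by (cases ms) (auto simp: admissible_lists_def)
    show "ms \<in> A1 \<union> A2"
    proof (cases "m < c i - 1")
      case True then show ?thesis using ms t by (auto simp: A2_def)
    next
      case False
      then have "m = c i - 1" using ms t by (auto simp: admissible_lists_def)
      then show ?thesis using ms t by (auto simp: A1_def admissible_lists_def c'_def intro!: image_eqI)
    qed
  qed (auto simp: A1_def A2_def admissible_lists_def c'_def)
  show "A1 \<inter> A2 = {}" by (auto simp: A1_def A2_def)
  have adm: "admissible c (i # cs) ((m + 1) # raise_modes i cs t) \<longleftrightarrow> m < c i - 1 \<and> admissible c (i # cs) (m # t)"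
    if "length t = length cs" for m t
  proof -
    have "admissible (c(i := m - 1 + 1, Suc i := c (Suc i) + 1)) cs (raise_modes i cs t)
        = admissible (c(i := m - 1, Suc i := c (Suc i) + 1)) cs t"
      using admissible_raise[OF bspec[OF assms(1)] that, of "c(Suc i := c (Suc i) + 1)" "m - 1"]
      by (simp add: fun_upd_twist[of i "Suc i"])
    then show ?thesis by auto
  qed
  show "bij_betw (raise_modes i (i # cs)) A2 (admissible_lists c (i # cs) (N - int (count_list (i # cs) i)))"
    unfolding bij_betw_def
  proof (intro conjI equalityI subsetI)
    show "inj_on (raise_modes i (i # cs)) A2"
      by (rule inj_on_subset[OF inj_on_raise_modes]) (auto simp: A2_def admissible_lists_def dest: admissible_length)
  next
    fix ms assume "ms \<in> raise_modes i (i # cs) ` A2"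
    then obtain ms' where ms': "ms' \<in> A2" "ms = raise_modes i (i # cs) ms'" by blast
    then have l: "length ms' = length (i # cs)"
      using admissible_length by (fastforce simp: A2_def admissible_lists_def)
    then obtain m t where t: "ms' = m # t" by (cases ms') auto
    show "ms \<in> admissible_lists c (i # cs) (N - int (count_list (i # cs) i))"
      using ms' t l adm[of t m] sum_list_raise_modes[OF l, of i]
      by (auto simp: admissible_lists_def A2_def simp del: admissible.simps)
  next
    fix ms assume ms: "ms \<in> admissible_lists c (i # cs) (N - int (count_list (i # cs) i))"
    then have "length ms = length (i # cs)"
      using admissible_length by (fastforce simp: admissible_lists_def)
    then obtain ms' where l: "length ms' = length (i # cs)" and ms': "raise_modes i (i # cs) ms' = ms"
      using raise_modes_surj by blast
    then obtain m t where t: "ms' = m # t" by (cases ms') auto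
    have "ms' \<in> A2"
      using ms ms' t l adm[of t m] sum_list_raise_modes[OF l, of i]
      by (auto simp: admissible_lists_def A2_def simp del: admissible.simps)
    then show "ms \<in> raise_modes i (i # cs) ` A2" using ms' by blast
  qed
qed

theorem card_admissible_lists:
  assumes "sorted cs" "\<And>i. c i \<le> C" "0 \<le> C"
  shows "finite (admissible_lists c cs N) \<and> of_nat (card (admissible_lists c cs N))
    = (if min_degree c cs \<le> N then fps_nth (inverse (denominator cs)) (nat (N - min_degree c cs)) else 0)"
  using assms
proof (induction cs arbitrary: c C N)
  case Nil
  have "admissible_lists c [] N = (if N = 0 then {[]} else {})"
    by (auto simp: admissible_lists_def)
  then show ?case by auto
next
  case (Cons i cs)
  define L where "L = - (int (length (i # cs)) * (C + int (length (i # cs))))"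
  define D where "D = min_degree c (i # cs)"
  define r where "r = count_list (i # cs) i"
  define c' where "c' = c(i := c i - 2, Suc i := c (Suc i) + 1)"
  define g where "g = inverse (denominator (i # cs))"
  have r: "0 < r" by (simp add: r_def)
  have le: "\<forall>k\<in>set cs. i \<le> k" using Cons.prems(1) by auto
  have LD: "L \<le> D" using min_degree_bound[of c C "i # cs", OF Cons.prems(2,3)] by (simp add: L_def D_def)
  have D': "min_degree c' cs = D - 1 + c i" by (simp add: D_def c'_def)
  have f: "inverse (denominator cs) = g * (1 - fps_X ^ r)"
  proof -
    have "inverse (1 - fps_X ^ r) * (1 - fps_X ^ r) = (1 :: complex fps)"
      using r by (intro inverse_mult_eq_1) simp
    moreover have den: "denominator (i # cs) = denominator cs * (1 - fps_X ^ r)" by (simp add: r_def)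
    ultimately show ?thesis unfolding g_def den fps_inverse_mult mult.assoc by (simp only: mult_1_right)
  qed
  have fg: "fps_nth (inverse (denominator cs)) k = fps_nth g k - (if k < r then 0 else fps_nth g (k - r))" for k
    unfolding f by (simp add: right_diff_distrib fps_X_power_mult_right_nth)
  have "c' k \<le> C + 1" for k
    using Cons.prems(2)[of i] Cons.prems(2)[of k] Cons.prems(2)[of "Suc i"] by (auto simp: c'_def)
  then have IH: "finite (admissible_lists c' cs N) \<and> of_nat (card (admissible_lists c' cs N))
    = (if min_degree c' cs \<le> N then fps_nth (inverse (denominator cs)) (nat (N - min_degree c' cs)) else 0)" for N
    using Cons.prems by (intro Cons.IH[of c' "C + 1"]) auto
  show ?case
    unfolding D_def[symmetric] g_def[symmetric]
  \<comment> \<open>Induction on the degree: below \<open>L\<close> there are no lists, and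
    \<open>L\<close> does not exceed the minimal degree \<open>D\<close>.\<close>
  proof (induction "nat (N - L + 1)" arbitrary: N rule: less_induct)
    case less
    show ?case
    proof (cases "N < L")
      case True
      have "admissible_lists c (i # cs) N = {}"
        using admissible_sum_bound[of c "i # cs" _ C, OF _ Cons.prems(2,3)] True
        by (fastforce simp: admissible_lists_def L_def)
      then show ?thesis using True LD by simp
    next
      case False
      let ?A1 = "(#) (c i - 1) ` admissible_lists c' cs (N + c i - 1)"
      let ?A2 = "{ms \<in> admissible_lists c (i # cs) N. hd ms < c i - 1}"
      let ?A = "admissible_lists c (i # cs) (N - int r)"
      note split = admissible_lists_split[where c = c and N = N, OF le, folded c'_def r_def]
      have IH2: "finite ?A \<and> of_nat (card ?A) = (if D \<le> N - int r then fps_nth g (nat (N - int r - D)) else 0)"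
        using False r by (intro less) auto
      have "finite ?A1" using IH by simp
      moreover have "finite ?A2" using IH2 bij_betw_finite[OF split(3)] by simp
      moreover have "card ?A1 = card (admissible_lists c' cs (N + c i - 1))"
        by (rule card_image) simp
      moreover have "card ?A2 = card ?A" by (rule bij_betw_same_card[OF split(3)])
      ultimately have "finite (admissible_lists c (i # cs) N)"
        and card: "card (admissible_lists c (i # cs) N) = card (admissible_lists c' cs (N + c i - 1)) + card ?A"
        by (metis split(1) finite_UnI, metis split(1,2) card_Un_disjoint)
      moreover have "of_nat (card (admissible_lists c (i # cs) N)) = (if D \<le> N then fps_nth g (nat (N - D)) else 0)"
      proof (cases "D \<le> N")
        case True
        have "nat (N - D) < r \<longleftrightarrow> \<not> D \<le> N - int r" "nat (N - int r - D) = nat (N - D) - r"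
          using True by auto
        then show ?thesis using True unfolding card of_nat_add IH[THEN conjunct2] IH2[THEN conjunct2] D'
          by (simp add: fg)
      next
        case False
        then show ?thesis unfolding card of_nat_add IH[THEN conjunct2] IH2[THEN conjunct2] D' by simp
      qed
      ultimately show ?thesis by blast
    qed
  qed
qed

text \<open>A new letter \<open>i\<close> in front changes only the summand \<open>k = i\<close>, by
  \<open>1 - c i\<close>. At \<open>k = i + 1\<close> the additional mixed product cancels against
  the raised bound, and colour \<open>i - 1\<close> is absent because the word is sorted.\<close>

lemma min_degree_formula:
  assumes "sorted cs" "set cs \<subseteq> {1..l}"
  shows "min_degree c cs = (\<Sum>k=1..l. int (count_list cs k) ^ 2 - int (count_list cs k) * int (count_list cs (k - 1))
    - c k * int (count_list cs k))"
  using assms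
proof (induction cs arbitrary: c)
  case (Cons i cs)
  let ?r = "\<lambda>k. int (count_list cs k)"
  let ?r' = "\<lambda>k. int (count_list (i # cs) k)"
  let ?c = "c(i := c i - 2, Suc i := c (Suc i) + 1)"
  have i: "i \<in> {1..l}" using Cons.prems by simp
  have "i - 1 \<notin> set cs" using Cons.prems i by fastforce
  then have z: "?r (i - 1) = 0" using count_list_0_iff by fastforce
  have "(?r' k ^ 2 - ?r' k * ?r' (k - 1) - c k * ?r' k) - (?r k ^ 2 - ?r k * ?r (k - 1) - ?c k * ?r k)
      = (if k = i then 1 - c i else 0)" if "k \<in> {1..l}" for k
  proof -
    consider "k = i" | "k = Suc i" | "k \<noteq> i" "k - 1 \<noteq> i" using that by linarith
    then show ?thesis
    proof cases
      case 1
      moreover have "i - 1 \<noteq> i" using i by auto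
      ultimately show ?thesis using z by (simp add: power2_eq_square algebra_simps)
    qed (use that in \<open>auto simp: algebra_simps\<close>)
  qed
  then have "(\<Sum>k=1..l. ?r' k ^ 2 - ?r' k * ?r' (k - 1) - c k * ?r' k)
      - (\<Sum>k=1..l. ?r k ^ 2 - ?r k * ?r (k - 1) - ?c k * ?r k) = (\<Sum>k=1..l. if k = i then 1 - c i else 0)"
    unfolding sum_subtractf[symmetric] by (intro sum.cong) auto
  also have "\<dots> = 1 - c i" using i by simp
  finally have "(\<Sum>k=1..l. ?r' k ^ 2 - ?r' k * ?r' (k - 1) - c k * ?r' k)
      = 1 - c i + (\<Sum>k=1..l. ?r k ^ 2 - ?r k * ?r (k - 1) - ?c k * ?r k)" by linarith
  moreover have "min_degree ?c cs = (\<Sum>k=1..l. ?r k ^ 2 - ?r k * ?r (k - 1) - ?c k * ?r k)"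
    by (rule Cons.IH) (use Cons.prems in auto)
  ultimately show ?case unfolding min_degree.simps by (simp only:)
qed simp

lemma min_degree_quad:
  assumes "sorted cs" "set cs \<subseteq> {1..l}"
  shows "min_degree (\<lambda>_. 0) cs = quad l (count_list cs)"
proof -
  have "(\<Sum>k=1..l. int (count_list cs k) * int (count_list cs (k - 1)))
      = (\<Sum>k=2..l. int (count_list cs k) * int (count_list cs (k - 1)))"
  proof (rule sum.mono_neutral_right)
    have "0 \<notin> set cs" using assms(2) by auto
    then have "count_list cs 0 = 0" using count_list_0_iff by fastforce
    moreover have "k = 1" if "k \<in> {1..l} - {2..l}" for k using that by auto
    ultimately show "\<forall>k\<in>{1..l} - {2..l}. int (count_list cs k) * int (count_list cs (k - 1)) = 0" by auto
  qed auto
  then show ?thesis by (simp add: min_degree_formula[OF assms] quad_def sum_subtractf)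
qed

lemma denominator_eq:
  assumes "set cs \<subseteq> {1..l}"
  shows "denominator cs = (\<Prod>i=1..l. q_poch (count_list cs i))"
  using assms
proof (induction cs)
  case Nil
  then show ?case by (simp add: q_poch_def)
next
  case (Cons i cs)
  then have i: "i \<in> {1..l}" by simp
  have "(\<Prod>k=1..l. q_poch (count_list (i # cs) k))
      = (\<Prod>k=1..l. q_poch (count_list cs k) * (if k = i then 1 - fps_X ^ (count_list (i # cs) i) else 1))"
    by (intro prod.cong refl) (auto simp: q_poch_def)
  then show ?case using Cons i by (simp add: prod.distrib)
qed

section \<open>Spectral flow\<close>

text \<open>Conjugation by a diagonal matrix of powers of \<open>t\<close> moves the modes of
  \<open>e p q\<close> by \<open>b q - b p\<close>. The central term of
  \<open>[e p q, e q p]\<close> changes accordingly, and the scalars at the diagonal zero modes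
  compensate for it; only their differences enter commutators, so \<open>s\<close> is free. The
  coweight subtracted from \<open>d\<close> restores the degrees. Invariant subspaces are the same
  for both actions.\<close>

lemma (in current_module) spectral_flow:
  fixes b :: "nat \<Rightarrow> int" and s :: complex
  shows "current_module scale n kap
    (\<lambda>p q m u. e p q (m - b p + b q) u - (if p = q \<and> m = 0 then (of_int (b p) - s) *s u else 0))
    (\<lambda>u. d u - (\<Sum>p<n. of_int (b p) *s e p p 0 u))"
proof -
  define e' where "e' p q m u = e p q (m - b p + b q) u - (if p = q \<and> m = 0 then (of_int (b p) - s) *s u else 0)"
    for p q m u
  define d' where "d' u = d u - (\<Sum>p<n. of_int (b p) *s e p p 0 u)" for u
  have "current_module scale n kap e' d'"
  proof (intro current_module.intro current_rep.intro current_rep_axioms.intro current_module_axioms.intro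
      vector_space_axioms)
    fix p q m assume pq: "p < n" "q < n"
    show "Vector_Spaces.linear scale scale (e' p q m)"
      unfolding Vector_Spaces.linear_iff using pq vector_space_axioms
      by (auto simp: e'_def e_simps scale_right_distrib scale_right_diff_distrib mult.commute)
  next
    fix p q r s' m k u assume pq: "p < n" "q < n" "r < n" "s' < n"
    have *: "e' p q m (e' r s' k u) - e' r s' k (e' p q m u)
      = e p q (m - b p + b q) (e r s' (k - b r + b s') u) - e r s' (k - b r + b s') (e p q (m - b p + b q) u)"
      using pq by (auto simp: e'_def e_simps scale_right_diff_distrib mult.commute)
    have "e' p q m (e' r s' k u) - e' r s' k (e' p q m u) =
        (if q = r then e' p s' (m + k) u else 0) - (if p = s' then e' r q (m + k) u else 0)
        + (if m + k = 0 then (of_int m * ((if q = r \<and> p = s' then 1 else 0)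
            - (if p = q \<and> r = s' then kap else 0))) *s u else 0)"
    proof -
      define m' where "m' = m - b p + b q"
      define k' where "k' = k - b r + b s'"
      have c: "e p q m' (e r s' k' u) - e r s' k' (e p q m' u) =
        (if q = r then e p s' (m' + k') u else 0) - (if p = s' then e r q (m' + k') u else 0)
        + (if m' + k' = 0 then (of_int m' * ((if q = r \<and> p = s' then 1 else 0)
            - (if p = q \<and> r = s' then kap else 0))) *s u else 0)"
        using comm_e[OF pq, of m' k' u] by simp
      consider "q = r" "p = s'" | "q = r" "p \<noteq> s'" | "q \<noteq> r" "p = s'" | "q \<noteq> r" "p \<noteq> s'" by blast
      then show ?thesis
      proof cases
        case 1
        have mk: "m' + k' = m + k" using 1 by (simp add: m'_def k'_def)
        have m': "of_int m' = (of_int m - of_int (b p) + of_int (b q) :: complex)"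
          by (simp add: m'_def)
        have "(if p = q \<and> r = s' then kap else 0) = (if p = q then kap else 0)" using 1 by auto
        note eqs = this 1[symmetric] simp_thms if_True if_False refl
        show ?thesis
        proof (cases "p = q")
          case True
          then have "m' = m" by (simp add: m'_def)
          then show ?thesis
            unfolding * m'_def[symmetric] k'_def[symmetric] c mk using True by (simp only: eqs) (simp add: e'_def)
        next
          case False
          show ?thesis
            unfolding * m'_def[symmetric] k'_def[symmetric] c mk using False
            by (simp only: eqs) (simp add: e'_def m' scale_left_distrib scale_left_diff_distrib)
        qed
      next
        case 2
        have "m' + k' = m + k - b p + b s'" using 2 by (simp add: m'_def k'_def)
        then show ?thesis unfolding * m'_def[symmetric] k'_def[symmetric] c using 2 by (auto simp: e'_def)
      next
        case 3
        have "m' + k' = m + k - b r + b q" using 3 by (simp add: m'_def k'_def)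
        then show ?thesis unfolding * m'_def[symmetric] k'_def[symmetric] c using 3 by (auto simp: e'_def)
      next
        case 4
        show ?thesis
        proof (cases "p = q \<and> r = s'")
          case True
          then have "m' = m" "k' = k" by (simp_all add: m'_def k'_def)
          then show ?thesis unfolding * m'_def[symmetric] k'_def[symmetric] c using 4 by simp
        next
          case False
          then show ?thesis unfolding * m'_def[symmetric] k'_def[symmetric] c using 4 by auto
        qed
      qed
    qed
    then show "e' p q m (e' r s' k u) = e' r s' k (e' p q m u)
        + (if q = r then e' p s' (m + k) u else 0) - (if p = s' then e' r q (m + k) u else 0)
        + (if m + k = 0 then (of_int m * ((if q = r \<and> p = s' then 1 else 0)
            - (if p = q \<and> r = s' then kap else 0))) *s u else 0)"
      by (simp add: algebra_simps)
  next
    fix u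
    obtain M where M: "bounded_by u M" using bounded_ex by blast
    let ?M = "max 1 (Max ((\<lambda>(p, q). M + b p - b q) ` ({..<n} \<times> {..<n})))"
    have "e' p q m u = 0" if "?M \<le> m" "p < n" "q < n" for p q m
    proof -
      have "M + b p - b q \<le> Max ((\<lambda>(p, q). M + b p - b q) ` ({..<n} \<times> {..<n}))"
        using that by (intro Max_ge) auto
      then have "M \<le> m - b p + b q" "m \<noteq> 0" using that(1) by auto
      then show ?thesis using bounded_byD[OF M] that by (simp add: e'_def)
    qed
    then show "\<exists>M. \<forall>m\<ge>M. \<forall>p<n. \<forall>q<n. e' p q m u = 0" by blast
  next
    show "Vector_Spaces.linear scale scale d'"
      unfolding Vector_Spaces.linear_iff using vector_space_axioms
      by (auto simp: d'_def d_add d_scale e_simps scale_right_distrib sum.distrib scale_right_diff_distrib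
          scale_sum_right mult.commute)
  next
    fix p q m u assume pq: "p < n" "q < n"
    let ?m = "m - b p + b q"
    have "(\<Sum>r<n. of_int (b r) *s e r r 0 (e p q ?m u))
        = (\<Sum>r<n. of_int (b r) *s e p q ?m (e r r 0 u) + (if r = p then of_int (b r) *s e p q ?m u else 0)
            - (if r = q then of_int (b r) *s e p q ?m u else 0))"
    proof (intro sum.cong refl)
      fix r assume "r \<in> {..<n}"
      then show "of_int (b r) *s e r r 0 (e p q ?m u) = of_int (b r) *s e p q ?m (e r r 0 u)
          + (if r = p then of_int (b r) *s e p q ?m u else 0) - (if r = q then of_int (b r) *s e p q ?m u else 0)"
        using pq comm_e[of r r p q 0 ?m u] by (auto simp: scale_right_distrib scale_right_diff_distrib)
    qed
    also have "\<dots> = e p q ?m (\<Sum>r<n. of_int (b r) *s e r r 0 u) + of_int (b p) *s e p q ?m u - of_int (b q) *s e p q ?m u"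
      using pq by (simp add: sum.distrib sum_subtractf e_simps)
    finally have "d' (e p q ?m u) = e p q ?m (d' u) - of_int m *s e p q ?m u"
      using pq by (simp add: d'_def comm_d e_simps algebra_simps)
    moreover have "d' (u - w) = d' u - d' w" "d' (a *s u) = a *s d' u" for u w a
      using d_add[of "u - w" w]
      by (auto simp: d'_def d_scale e_simps scale_right_diff_distrib sum_subtractf scale_sum_right mult.commute algebra_simps)
    moreover have "d' 0 = 0" by (simp add: d'_def d_0 e_0)
    ultimately show "d' (e' p q m u) = e' p q m (d' u) - of_int m *s e' p q m u"
      by (auto simp: e'_def)
  next
    fix S assume S: "subspace S" and cl: "\<And>p q m u. p < n \<Longrightarrow> q < n \<Longrightarrow> u \<in> S \<Longrightarrow> e' p q m u \<in> S"
    show "S = {0} \<or> S = UNIV"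
    proof (rule irreducible[OF S])
      fix p q m u assume pq: "p < n" "q < n" "u \<in> S"
      let ?m = "m + b p - b q"
      have "e p q m u = e' p q ?m u + (if p = q \<and> ?m = 0 then (of_int (b p) - s) *s u else 0)"
        by (simp add: e'_def)
      moreover have "e' p q ?m u \<in> S" using cl pq by blast
      ultimately show "e p q m u \<in> S"
        using S pq by (auto intro: subspace_add subspace_scale)
    qed
  qed
  then show ?thesis unfolding e'_def d'_def by simp
qed

section \<open>The Segal-Sugawara operator\<close>

text \<open>Shifting the index by \<open>k\<close> leaves a window of \<open>|k|\<close> terms,
  which the reflection from \<open>m\<close> to \<open>k - m\<close> pairs into copies of
  \<open>E\<close>. This is the finite remainder of the reordering that produces the dual Coxeter
  number.\<close>

lemma (in vector_space) telescoping_sum: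
  fixes f :: "int \<Rightarrow> 'b"
  assumes f0: "\<And>m. M \<le> m \<Longrightarrow> f m = 0" and sym: "\<And>m. f m + f (k - m) = E" and B: "\<bar>M\<bar> + \<bar>k\<bar> \<le> B"
  shows "f 0 - f k + scale 2 (\<Sum>m=1..B. f m - f (k + m)) = scale (of_int k) E"
proof -
  have two: "scale 2 x = x + x" for x using scale_left_distrib[of 1 1 x] by simp
  have shift: "(\<Sum>m=1..B. f (k + m)) = (\<Sum>m=k+1..k+B. f m)"
    by (rule sum.reindex_bij_witness[of _ "\<lambda>m. m - k" "\<lambda>m. k + m"]) auto
  have const: "(\<Sum>m\<in>A. f m + f (k - m)) = scale (of_nat (card A)) E" for A
    by (simp add: sym sum_constant_scale)
  have E: "f 0 = E - f k" using sym[of k] by (simp add: algebra_simps)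
  show ?thesis
  proof (cases "0 \<le> k")
    case True
    have "(\<Sum>m=k+1..k+B. f m) = (\<Sum>m=k+1..B. f m)"
      using B True by (intro sum.mono_neutral_right) (auto intro!: f0)
    moreover have "(\<Sum>m=1..B. f m) = (\<Sum>m=1..k. f m) + (\<Sum>m=k+1..B. f m)"
      using B True by (subst sum.union_disjoint[symmetric]) (auto intro!: sum.cong)
    moreover have "(\<Sum>m=0..k-1. f m) = (\<Sum>m=1..k. f (k - m))"
      by (rule sum.reindex_bij_witness[of _ "\<lambda>m. k - m" "\<lambda>m. k - m"]) auto
    moreover have *: "f 0 + (\<Sum>m=1..k. f m) = (\<Sum>m=0..k-1. f m) + f k"
    proof -
      have "insert 0 {1..k} = insert k {0..k-1}" using True by auto
      moreover have "sum f (insert 0 {1..k}) = f 0 + (\<Sum>m=1..k. f m)" by (rule sum.insert) auto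
      moreover have "sum f (insert k {0..k-1}) = f k + (\<Sum>m=0..k-1. f m)" by (rule sum.insert) auto
      ultimately show ?thesis by (metis add.commute)
    qed
    moreover have "f 0 - f k = (\<Sum>m=0..k-1. f m) - (\<Sum>m=1..k. f m)"
      using * by (simp add: algebra_simps)
    moreover have "(\<Sum>m=1..k. f m) + (\<Sum>m=1..k. f (k - m)) = scale (of_int k) E"
      using const[of "{1..k}"] True by (simp add: sum.distrib of_nat_nat)
    moreover have "A = P + Q \<Longrightarrow> Q' = Q \<Longrightarrow> R' = R \<Longrightarrow> D = R' - P \<Longrightarrow> P + R = z \<Longrightarrow> D + ((A - Q') + (A - Q')) = z"
      for A P Q Q' R R' D z :: 'b by (auto simp: algebra_simps)
    ultimately show ?thesis
      unfolding sum_subtractf shift two by blast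
  next
    case False
    have "(\<Sum>m=k+1..k+B. f m) = (\<Sum>m=k+1..B. f m)"
      using B False by (intro sum.mono_neutral_left) (auto intro!: f0)
    moreover have "(\<Sum>m=k+1..B. f m) = (\<Sum>m=k+1..0. f m) + (\<Sum>m=1..B. f m)"
      using B False by (subst sum.union_disjoint[symmetric]) (auto intro!: sum.cong)
    moreover have "(\<Sum>m=k..-1. f m) = (\<Sum>m=k+1..0. f (k - m))"
      by (rule sum.reindex_bij_witness[of _ "\<lambda>m. k - m" "\<lambda>m. k - m"]) auto
    moreover have *: "f k + (\<Sum>m=k+1..0. f m) = (\<Sum>m=k..-1. f m) + f 0"
    proof -
      have "insert k {k+1..0} = insert 0 {k..-1}" using False by auto
      moreover have "sum f (insert k {k+1..0}) = f k + (\<Sum>m=k+1..0. f m)" by (rule sum.insert) auto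
      moreover have "sum f (insert 0 {k..-1}) = f 0 + (\<Sum>m=k..-1. f m)" by (rule sum.insert) auto
      ultimately show ?thesis by (metis add.commute)
    qed
    moreover have "f 0 - f k = (\<Sum>m=k+1..0. f m) - (\<Sum>m=k..-1. f m)"
      using * by (simp add: algebra_simps)
    moreover have "scale (of_int k) E = - ((\<Sum>m=k+1..0. f m) + (\<Sum>m=k+1..0. f (k - m)))"
      using const[of "{k+1..0}"] False by (simp add: sum.distrib of_nat_nat)
    moreover have "Q' = Q \<Longrightarrow> Q = P + A \<Longrightarrow> R' = R \<Longrightarrow> D = P - R' \<Longrightarrow> z = - (P + R) \<Longrightarrow> D + ((A - Q') + (A - Q')) = z"
      for A P Q Q' R R' D z :: 'b by (simp only:) (simp add: algebra_simps)
    ultimately show ?thesis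
      unfolding sum_subtractf shift two by blast
  qed
qed

locale traceless_rep = current_rep scale n kap e
  for scale :: "complex \<Rightarrow> 'v::ab_group_add \<Rightarrow> 'v" (infixr \<open>*s\<close> 75) and n :: nat and kap :: complex
    and e :: "nat \<Rightarrow> nat \<Rightarrow> int \<Rightarrow> 'v \<Rightarrow> 'v" +
  assumes traceless: "(\<Sum>p<n. e p p m u) = 0"
begin

definition cas :: "int \<Rightarrow> 'v \<Rightarrow> 'v" where
  "cas m u = (\<Sum>p<n. \<Sum>q<n. e p q (- m) (e q p m u))"

definition sugawara :: "'v \<Rightarrow> 'v" where
  "sugawara u = (1 / (2 * (1 + of_nat n))) *s
     (cas 0 u + 2 *s Sum_any (\<lambda>m::nat. if m > 0 then cas (int m) u else 0))"

lemma cas_0: "bounded_by u M \<Longrightarrow> M \<le> m \<Longrightarrow> cas m u = 0"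
  unfolding cas_def by (intro sum.neutral ballI) (simp add: bounded_byD e_0)

lemma sugawara_eq:
  assumes "bounded_by u M" "M \<le> B"
  shows "sugawara u = (1 / (2 * (1 + of_nat n))) *s (cas 0 u + 2 *s (\<Sum>m=1..B. cas m u))"
proof -
  have "Sum_any (\<lambda>m::nat. if m > 0 then cas (int m) u else 0) = (\<Sum>m\<in>{1..nat B}. if m > 0 then cas (int m) u else 0)"
  proof (rule Sum_any.expand_superset)
    show "{m. (if 0 < m then cas (int m) u else 0) \<noteq> 0} \<subseteq> {1..nat B}"
    proof
      fix m assume m: "m \<in> {m. (if 0 < m then cas (int m) u else 0) \<noteq> 0}"
      then have "0 < m" "cas (int m) u \<noteq> 0" by (auto split: if_splits)
      then have "int m < M" using cas_0[OF assms(1)] by (meson not_less)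
      then show "m \<in> {1..nat B}" using \<open>0 < m\<close> assms(2) by auto
    qed
  qed simp
  also have "\<dots> = (\<Sum>m=1..B. cas m u)"
    by (rule sum.reindex_bij_witness[of _ nat int]) auto
  finally show ?thesis by (simp add: sugawara_def)
qed

lemma cas_add: "cas m (u + w) = cas m u + cas m w"
  by (simp add: cas_def e_simps sum.distrib)

lemma cas_scale: "cas m (a *s u) = a *s cas m u"
  by (simp add: cas_def e_simps scale_sum_right)

lemma linear_sugawara: "Vector_Spaces.linear scale scale sugawara"
  unfolding Vector_Spaces.linear_iff
proof (intro conjI allI vector_space_axioms)
  fix u w
  obtain M where M: "bounded_by u M" "bounded_by w M"
    using bounded_ex bounded_mono by (metis linorder_le_cases)
  then have "bounded_by (u + w) M" by (simp add: bounded_by_def e_simps)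
  then show "sugawara (u + w) = sugawara u + sugawara w"
    using M by (simp add: sugawara_eq[of _ M M] cas_add sum.distrib scale_right_distrib)
next
  fix a u
  obtain M where M: "bounded_by u M" using bounded_ex by blast
  then have "bounded_by (a *s u) M" by (simp add: bounded_by_def e_simps)
  then show "sugawara (a *s u) = a *s sugawara u"
    using M by (simp add: sugawara_eq[of _ M M] cas_scale scale_right_distrib mult.commute flip: scale_sum_right)
qed

text \<open>The bracket of \<open>e r s\<close> with one factor of the Casimir tensor, with modes
  \<open>a\<close> and \<open>b\<close> on the two factors. By invariance the bracket with the other
  factor gives the negative of the same expression.\<close>

definition crossed :: "nat \<Rightarrow> nat \<Rightarrow> int \<Rightarrow> int \<Rightarrow> 'v \<Rightarrow> 'v" where
  "crossed r s a b u = (\<Sum>q<n. e r q a (e q s b u)) - (\<Sum>p<n. e p s a (e r p b u))"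

text \<open>Exchanging the modes turns the sum into commutators, which add up to \<open>n\<close>
  copies of \<open>e r s (a + b)\<close> twice: \<open>n\<close> is the dual Coxeter number. The
  traces vanish, and the central terms cancel because \<open>a\<close> and \<open>b\<close> enter
  with opposite signs.\<close>

lemma crossed_symmetry:
  assumes "r < n" "s < n"
  shows "crossed r s a b u + crossed r s b a u = (2 * of_nat n) *s e r s (a + b) u"
proof -
  define kq where "kq q = (if r = s then 1 else 0) - (if r = q \<and> q = s then kap else 0)" for q
  define K where "K = (\<Sum>q<n. kq q)"
  have *: "(\<Sum>q<n. e r q a (e q s b u)) - (\<Sum>q<n. e q s b (e r q a u))
      = of_nat n *s e r s (a + b) u + (if a + b = 0 then (of_int a * K) *s u else 0)" for a b
  proof -
    have "(\<Sum>q<n. e r q a (e q s b u)) - (\<Sum>q<n. e q s b (e r q a u))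
        = (\<Sum>q<n. e r s (a + b) u - (if r = s then e q q (a + b) u else 0)
          + (if a + b = 0 then (of_int a * kq q) *s u else 0))"
      unfolding sum_subtractf[symmetric]
    proof (intro sum.cong refl)
      fix q assume "q \<in> {..<n}"
      then show "e r q a (e q s b u) - e q s b (e r q a u) = e r s (a + b) u
          - (if r = s then e q q (a + b) u else 0) + (if a + b = 0 then (of_int a * kq q) *s u else 0)"
        using assms comm_e[of r q q s a b u] by (simp add: kq_def)
    qed
    also have "\<dots> = of_nat n *s e r s (a + b) u - (if r = s then (\<Sum>q<n. e q q (a + b) u) else 0)
        + (if a + b = 0 then (of_int a * K) *s u else 0)"
      by (simp add: K_def sum.distrib sum_subtractf sum_constant_scale sum_distrib_left scale_sum_left)
    finally show ?thesis by (simp add: traceless)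
  qed
  have "crossed r s a b u + crossed r s b a u
      = ((\<Sum>q<n. e r q a (e q s b u)) - (\<Sum>q<n. e q s b (e r q a u)))
        + ((\<Sum>q<n. e r q b (e q s a u)) - (\<Sum>q<n. e q s a (e r q b u)))"
    by (simp add: crossed_def algebra_simps)
  also have "\<dots> = of_nat n *s e r s (a + b) u + of_nat n *s e r s (a + b) u"
  proof -
    have "(if a + b = 0 then (of_int a * K) *s u else 0) + (if b + a = 0 then (of_int b * K) *s u else 0) = 0"
    proof (cases "a + b = 0")
      case True
      then have "b = - a" by simp
      then show ?thesis by simp
    qed (simp add: add.commute)
    then show ?thesis
      unfolding * add.commute[of b a] by (simp add: add.assoc add.left_commute)
  qed
  also have "\<dots> = (2 * of_nat n) *s e r s (a + b) u"
    by (simp flip: scale_left_distrib)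
  finally show ?thesis .
qed

lemma scale_delta: "(z * ((if P then 1 else 0) - (if Q then y else 0))) *s w
    = (if P then z *s w else 0) - (if Q then (z * y) *s w else 0)"
  by (simp add: scale_left_diff_distrib right_diff_distrib)

lemma sum_pair_delta:
  fixes g :: "nat \<Rightarrow> nat \<Rightarrow> 'v"
  assumes "a < n" "b < n"
  shows "(\<Sum>p<n. \<Sum>q<n. if a = p \<and> b = q then g p q else 0) = g a b"
proof -
  have "(\<Sum>q<n. if a = p \<and> b = q then g p q else 0) = (if a = p then g p b else 0)" for p
    using assms by (cases "a = p") auto
  then show ?thesis using assms by simp
qed

lemma sum_diagonal_zero:
  "(\<Sum>p<n. \<Sum>q<n. if P \<and> p = q then z *s e q p m u else 0) = 0"
  "(\<Sum>p<n. \<Sum>q<n. if P \<and> q = p then z *s e p q m u else 0) = 0"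
proof -
  have "(\<Sum>p<n. \<Sum>q<n. if P \<and> p = q then z *s e q p m u else 0) = (\<Sum>p<n. if P then z *s e p p m u else 0)"
    by (intro sum.cong refl) (cases P; simp)
  then show *: "(\<Sum>p<n. \<Sum>q<n. if P \<and> p = q then z *s e q p m u else 0) = 0"
    by (cases P) (simp_all add: traceless flip: scale_sum_right)
  then show "(\<Sum>p<n. \<Sum>q<n. if P \<and> q = p then z *s e p q m u else 0) = 0"
    by (subst sum.swap)
qed

lemma cas_commutator:
  assumes rs: "r < n" "s < n"
  shows "e r s k (cas m u) - cas m (e r s k u) = crossed r s (k - m) m u - crossed r s (- m) (k + m) u
    + (if k = m \<or> k = - m then of_int k *s e r s k u else 0)"
proof -
  define t1 where "t1 = (\<lambda>p q. (if s = p then e r q (k - m) (e q p m u) else 0) - (if r = q then e p s (k - m) (e q p m u) else 0)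
    + (if k = m then (if s = p \<and> r = q then of_int k *s e q p m u else 0)
        - (if r = s \<and> p = q then (of_int k * kap) *s e q p m u else 0) else 0))"
  define t2 where "t2 = (\<lambda>p q. (if s = q then e p q (- m) (e r p (k + m) u) else 0) - (if r = p then e p q (- m) (e q s (k + m) u) else 0)
    + (if k = - m then (if r = p \<and> s = q then of_int k *s e p q (- m) u else 0)
        - (if r = s \<and> q = p then (of_int k * kap) *s e p q (- m) u else 0) else 0))"
  have "e r s k (e p q (- m) (e q p m u)) - e p q (- m) (e q p m (e r s k u)) = t1 p q + t2 p q"
    if "p < n" "q < n" for p q
  proof -
    have eq: "k + - m = 0 \<longleftrightarrow> k = m" "k + m = 0 \<longleftrightarrow> k = - m" "k + - m = k - m" by auto
    have "e r s k (e p q (- m) (e q p m u)) = e p q (- m) (e r s k (e q p m u)) + t1 p q"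
      unfolding comm_e[OF rs that] scale_delta t1_def eq
      by (simp only: diff_conv_add_uminus[where 'a = 'v] add.assoc right_minus_eq)
    moreover have "e p q (- m) (e r s k (e q p m u)) = e p q (- m) (e q p m (e r s k u)) + t2 p q"
      unfolding comm_e[OF rs that(2,1)] scale_delta t2_def eq conj_commute[of "s = q" "r = p"] using that
      by (simp only: e_simps diff_conv_add_uminus[where 'a = 'v] add.assoc if_distrib[of "e p q (- m)"])
    ultimately show ?thesis by (simp add: algebra_simps)
  qed
  then have "e r s k (cas m u) - cas m (e r s k u) = (\<Sum>p<n. \<Sum>q<n. t1 p q + t2 p q)"
    using rs by (simp add: cas_def e_simps sum_subtractf[symmetric])
  also have "\<dots> = (\<Sum>p<n. \<Sum>q<n. t1 p q) + (\<Sum>p<n. \<Sum>q<n. t2 p q)"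
    by (simp add: sum.distrib)
  also have "(\<Sum>p<n. \<Sum>q<n. t1 p q) = crossed r s (k - m) m u + (if k = m then of_int k *s e r s k u else 0)"
  proof -
    have a: "(\<Sum>p<n. \<Sum>q<n. if s = p then e r q (k - m) (e q p m u) else 0) = (\<Sum>q<n. e r q (k - m) (e q s m u))"
      using rs by (subst sum.swap) simp
    have b: "(\<Sum>p<n. \<Sum>q<n. if r = q then e p s (k - m) (e q p m u) else 0) = (\<Sum>p<n. e p s (k - m) (e r p m u))"
      using rs by simp
    have "(\<Sum>p<n. \<Sum>q<n. t1 p q) = (\<Sum>p<n. \<Sum>q<n. if s = p then e r q (k - m) (e q p m u) else 0) - (\<Sum>p<n. \<Sum>q<n. if r = q then e p s (k - m) (e q p m u) else 0)
        + (if k = m then (\<Sum>p<n. \<Sum>q<n. if s = p \<and> r = q then of_int k *s e q p m u else 0)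
            - (\<Sum>p<n. \<Sum>q<n. if r = s \<and> p = q then (of_int k * kap) *s e q p m u else 0) else 0)"
      unfolding t1_def by (cases "k = m") (simp_all only: if_True if_False refl sum.distrib sum_subtractf add_0_right)
    then show ?thesis unfolding a b sum_pair_delta[OF rs(2,1)] sum_diagonal_zero by (simp add: crossed_def)
  qed
  also have "(\<Sum>p<n. \<Sum>q<n. t2 p q) = - crossed r s (- m) (k + m) u + (if k = - m then of_int k *s e r s k u else 0)"
  proof -
    have a: "(\<Sum>p<n. \<Sum>q<n. if s = q then e p q (- m) (e r p (k + m) u) else 0) = (\<Sum>p<n. e p s (- m) (e r p (k + m) u))"
      using rs by simp
    have b: "(\<Sum>p<n. \<Sum>q<n. if r = p then e p q (- m) (e q s (k + m) u) else 0) = (\<Sum>q<n. e r q (- m) (e q s (k + m) u))"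
      using rs by (subst sum.swap) simp
    have "(\<Sum>p<n. \<Sum>q<n. t2 p q) = (\<Sum>p<n. \<Sum>q<n. if s = q then e p q (- m) (e r p (k + m) u) else 0) - (\<Sum>p<n. \<Sum>q<n. if r = p then e p q (- m) (e q s (k + m) u) else 0)
        + (if k = - m then (\<Sum>p<n. \<Sum>q<n. if r = p \<and> s = q then of_int k *s e p q (- m) u else 0)
            - (\<Sum>p<n. \<Sum>q<n. if r = s \<and> q = p then (of_int k * kap) *s e p q (- m) u else 0) else 0)"
      unfolding t2_def by (cases "k = - m") (simp_all only: if_True if_False refl sum.distrib sum_subtractf add_0_right)
    then show ?thesis unfolding a b sum_pair_delta[OF rs] sum_diagonal_zero by (simp add: crossed_def)
  qed
  \<comment> \<open>For \<open>k = 0\<close> both central conditions can hold at once, but then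
    their contributions are zero.\<close>
  finally show ?thesis by (cases "k = 0") auto
qed

text \<open>The telescoping yields \<open>2 n k\<close> and the central terms, met once at
  \<open>m = |k|\<close>, yield \<open>2 k\<close>; the normalisation divides out the sum
  \<open>2 (1 + n) k\<close>.\<close>

theorem sugawara_commutator:
  assumes rs: "r < n" "s < n"
  shows "sugawara (e r s k u) = e r s k (sugawara u) - of_int k *s e r s k u"
proof -
  obtain M where M: "bounded_by u M" "bounded_by (e r s k u) M"
    using bounded_ex bounded_mono by (metis linorder_le_cases)
  define B where "B = \<bar>M\<bar> + \<bar>k\<bar> + 1"
  have MB: "M \<le> B" by (simp add: B_def)
  let ?f = "\<lambda>m. crossed r s (k - m) m u"
  let ?sug = "\<lambda>u. cas 0 u + 2 *s (\<Sum>m=1..B. cas m u)"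
  have f0: "?f m = 0" if "M \<le> m" for m
    using bounded_byD[OF M(1) that] rs by (auto simp: crossed_def e_0)
  have "e r s k (?sug u) - ?sug (e r s k u)
      = (e r s k (cas 0 u) - cas 0 (e r s k u)) + 2 *s (\<Sum>m=1..B. e r s k (cas m u) - cas m (e r s k u))"
    using rs by (simp add: e_simps sum_subtractf scale_right_diff_distrib)
  also have "\<dots> = (?f 0 - ?f k) + 2 *s (\<Sum>m=1..B. ?f m - ?f (k + m) + (if k = m \<or> k = - m then of_int k *s e r s k u else 0))"
    by (simp add: cas_commutator[OF rs])
  also have "(\<Sum>m=1..B. ?f m - ?f (k + m) + (if k = m \<or> k = - m then of_int k *s e r s k u else 0))
      = (\<Sum>m=1..B. ?f m - ?f (k + m)) + of_int k *s e r s k u"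
  proof -
    have "(\<Sum>m=1..B. if k = m \<or> k = - m then of_int k *s e r s k u else 0)
        = (\<Sum>m=1..B. if m = \<bar>k\<bar> then of_int k *s e r s k u else 0)"
      by (intro sum.cong refl) auto
    also have "\<dots> = of_int k *s e r s k u" by (cases "k = 0") (auto simp: B_def)
    finally show ?thesis by (simp add: sum.distrib)
  qed
  also have "(?f 0 - ?f k) + 2 *s ((\<Sum>m=1..B. ?f m - ?f (k + m)) + of_int k *s e r s k u)
      = of_int k *s ((2 * of_nat n) *s e r s k u) + (2 * of_int k) *s e r s k u"
  proof -
    have "?f m + ?f (k - m) = (2 * of_nat n) *s e r s k u" for m
      using crossed_symmetry[OF rs, of "k - m" m u] by simp
    from telescoping_sum[of M ?f k _ B, OF f0 this] show ?thesis
      by (simp add: scale_right_distrib B_def algebra_simps)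
  qed
  also have "\<dots> = (2 * (1 + of_nat n) * of_int k) *s e r s k u"
    by (simp add: algebra_simps flip: scale_left_distrib)
  finally have *: "?sug (e r s k u) = e r s k (?sug u) - (2 * (1 + of_nat n) * of_int k) *s e r s k u"
    by (simp add: algebra_simps)
  have "of_nat (2 + 2 * n) \<noteq> (0 :: complex)"
    unfolding of_nat_eq_0_iff by simp
  then have "2 + 2 * of_nat n \<noteq> (0 :: complex)" by simp
  then show ?thesis
    unfolding sugawara_eq[OF M(1) MB] sugawara_eq[OF M(2) MB] *
    using rs by (simp add: e_simps scale_right_diff_distrib)
qed

end

section \<open>Standard modules\<close>

definition traceless_entry :: "nat \<Rightarrow> nat \<Rightarrow> nat \<Rightarrow> nat \<Rightarrow> nat \<Rightarrow> complex" where
  "traceless_entry n p q a b = (if a = p \<and> b = q then 1 else 0) - (if p = q \<and> a = b then 1 / of_nat n else 0)"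

definition traceless_unit :: "nat \<Rightarrow> nat \<Rightarrow> nat \<Rightarrow> complex mat" where
  "traceless_unit l p q = mat (l + 1) (l + 1) (\<lambda>(a, b). traceless_entry (l + 1) p q a b)"

lemma traceless_unit_carrier: "traceless_unit l p q \<in> carrier_mat (l + 1) (l + 1)"
  by (simp add: traceless_unit_def)

lemma traceless_unit_index:
  "a < l + 1 \<Longrightarrow> b < l + 1 \<Longrightarrow> traceless_unit l p q $$ (a, b) = traceless_entry (l + 1) p q a b"
  by (simp add: traceless_unit_def)

lemma traceless_unit_offdiag: "p \<noteq> q \<Longrightarrow> traceless_unit l p q = root_vec l p q"
  by (rule eq_matI) (auto simp: traceless_unit_def traceless_entry_def root_vec_def)

lemma traceless_entry_mult:
  assumes "p < n" "q < n" "r < n" "s < n" "a < n" "b < n"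
  shows "(\<Sum>c<n. traceless_entry n p q a c * traceless_entry n r s c b)
    = (if q = r \<and> a = p \<and> b = s then 1 else 0) - (if r = s \<and> a = p \<and> b = q then 1 / of_nat n else 0)
      - (if p = q \<and> a = r \<and> b = s then 1 / of_nat n else 0)
      + (if p = q \<and> r = s \<and> a = b then 1 / of_nat n * (1 / of_nat n) else 0)"
proof -
  define z :: complex where "z = 1 / of_nat n"
  have prod: "(if P then y else 0) * (if Q then y' else 0) = (if P \<and> Q then y * y' else (0 :: complex))" for P Q y y'
    by simp
  have diff_mult: "(y - y') * (w - w') = y * w - y * w' - y' * w + y' * w'" for y y' w w' :: complex
    by (simp add: algebra_simps)
  have "(\<Sum>c<n. traceless_entry n p q a c * traceless_entry n r s c b)
    = (\<Sum>c<n. if (a = p \<and> c = q) \<and> c = r \<and> b = s then 1 * 1 else 0)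
      - (\<Sum>c<n. if (a = p \<and> c = q) \<and> r = s \<and> c = b then 1 * z else 0)
      - (\<Sum>c<n. if (p = q \<and> a = c) \<and> c = r \<and> b = s then z * 1 else 0)
      + (\<Sum>c<n. if (p = q \<and> a = c) \<and> r = s \<and> c = b then z * z else 0)"
    unfolding sum_subtractf[symmetric] sum.distrib[symmetric] traceless_entry_def z_def[symmetric]
    by (intro sum.cong refl) (simp only: diff_mult prod)
  also have "(\<Sum>c<n. if (a = p \<and> c = q) \<and> c = r \<and> b = s then 1 * 1 else (0 :: complex))
    = (\<Sum>c<n. if c = q then (if q = r \<and> a = p \<and> b = s then 1 else 0) else 0)"
    by (intro sum.cong refl) auto
  also have "(\<Sum>c<n. if (a = p \<and> c = q) \<and> r = s \<and> c = b then 1 * z else 0)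
    = (\<Sum>c<n. if c = q then (if r = s \<and> a = p \<and> b = q then z else 0) else 0)"
    by (intro sum.cong refl) auto
  also have "(\<Sum>c<n. if (p = q \<and> a = c) \<and> c = r \<and> b = s then z * 1 else 0)
    = (\<Sum>c<n. if c = a then (if p = q \<and> a = r \<and> b = s then z else 0) else 0)"
    by (intro sum.cong refl) auto
  also have "(\<Sum>c<n. if (p = q \<and> a = c) \<and> r = s \<and> c = b then z * z else 0)
    = (\<Sum>c<n. if c = a then (if p = q \<and> r = s \<and> a = b then z * z else 0) else 0)"
    by (intro sum.cong refl) auto
  finally show ?thesis using assms by (simp add: z_def)
qed

lemma mult_index:
  "A \<in> carrier_mat n n \<Longrightarrow> B \<in> carrier_mat n n \<Longrightarrow> a < n \<Longrightarrow> b < n \<Longrightarrow>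
    (A * B) $$ (a, b) = (\<Sum>c<n. A $$ (a, c) * B $$ (c, b))"
  by (simp add: scalar_prod_def atLeast0LessThan)

lemma form_eq:
  assumes "A \<in> carrier_mat n n" "B \<in> carrier_mat n n"
  shows "form A B = (\<Sum>a<n. \<Sum>c<n. A $$ (a, c) * B $$ (c, a))"
  using assms by (simp add: form_def mtrace_def mult_index del: index_mult_mat(1))

lemma form_commute:
  assumes "A \<in> carrier_mat n n" "B \<in> carrier_mat n n"
  shows "form A B = form B A"
  unfolding form_eq[OF assms] form_eq[OF assms(2,1)] by (subst sum.swap) (simp add: mult.commute)

lemma traceless_unit_sl:
  assumes "p \<le> l" shows "traceless_unit l p q \<in> sl l"
proof -
  have "(\<Sum>a<l + 1. traceless_entry (l + 1) p q a a)
      = (\<Sum>a<l + 1. (if a = p then (if p = q then 1 else 0) else 0) - (if p = q then 1 / of_nat (l + 1) else 0))"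
    by (intro sum.cong) (auto simp: traceless_entry_def)
  also have "\<dots> = 0"
    using assms by (simp add: sum_subtractf del: sum.lessThan_Suc of_nat_Suc of_nat_add)
  finally show ?thesis
    by (simp add: sl_def mtrace_def traceless_unit_def del: sum.lessThan_Suc of_nat_Suc)
qed

lemma traceless_unit_commutator:
  assumes "p \<le> l" "q \<le> l" "r \<le> l" "s \<le> l"
  shows "traceless_unit l p q * traceless_unit l r s - traceless_unit l r s * traceless_unit l p q
    = (if q = r then traceless_unit l p s else 0\<^sub>m (l + 1) (l + 1))
      + (- 1) \<cdot>\<^sub>m (if p = s then traceless_unit l r q else 0\<^sub>m (l + 1) (l + 1))" (is "?L = ?R")
proof (rule eq_matI)
  fix a b assume "a < dim_row ?R" "b < dim_col ?R"
  then have ab: "a < l + 1" "b < l + 1"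
    by (auto simp: traceless_unit_def split: if_splits)
  have lt: "p < l + 1" "q < l + 1" "r < l + 1" "s < l + 1" using assms by auto
  note C = traceless_unit_carrier
  have "?L $$ (a, b) = (traceless_unit l p q * traceless_unit l r s) $$ (a, b)
      - (traceless_unit l r s * traceless_unit l p q) $$ (a, b)"
    using ab by (intro index_minus_mat) (simp_all add: traceless_unit_def)
  also have "\<dots> = (\<Sum>c<l + 1. traceless_entry (l + 1) p q a c * traceless_entry (l + 1) r s c b)
      - (\<Sum>c<l + 1. traceless_entry (l + 1) r s a c * traceless_entry (l + 1) p q c b)"
    unfolding mult_index[OF C C ab]
    by (intro arg_cong2[of _ _ _ _ "(-)"] sum.cong refl) (use ab in \<open>auto simp: traceless_unit_index\<close>)
  also have "\<dots> = (if q = r then traceless_entry (l + 1) p s a b else 0)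
      - (if p = s then traceless_entry (l + 1) r q a b else 0)"
  proof -
    have sw: "(r = s \<and> p = q \<and> a = b) = (p = q \<and> r = s \<and> a = b)" by auto
    show ?thesis
      unfolding traceless_entry_mult[OF lt ab] traceless_entry_mult[OF lt(3,4,1,2) ab] sw
      by (cases "q = r"; cases "p = s"; simp add: traceless_entry_def split del: if_split)
  qed
  also have "\<dots> = ?R $$ (a, b)"
    using ab by (auto simp: traceless_unit_def)
  finally show "?L $$ (a, b) = ?R $$ (a, b)" .
qed (auto simp: traceless_unit_def)

lemma form_traceless_unit:
  assumes "p \<le> l" "q \<le> l" "r \<le> l" "s \<le> l"
  shows "form (traceless_unit l p q) (traceless_unit l r s)
    = (if q = r \<and> p = s then 1 else 0) - (if p = q \<and> r = s then 1 / of_nat (l + 1) else 0)"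
proof -
  let ?n = "l + 1"
  have lt: "p < l + 1" "q < l + 1" "r < l + 1" "s < l + 1" using assms by auto
  have "form (traceless_unit l p q) (traceless_unit l r s)
      = (\<Sum>a<?n. \<Sum>c<?n. traceless_entry ?n p q a c * traceless_entry ?n r s c a)"
    unfolding form_eq[OF traceless_unit_carrier traceless_unit_carrier]
    by (intro sum.cong refl) (simp add: traceless_unit_index)
  also have "\<dots> = (\<Sum>a<?n. (if a = p then (if q = r \<and> p = s then 1 else 0) - (if r = s \<and> p = q then 1 / of_nat ?n else 0) else 0)
      - (if a = r then (if p = q \<and> r = s then 1 / of_nat ?n else 0) else 0)
      + (if p = q \<and> r = s then 1 / of_nat ?n * (1 / of_nat ?n) else 0))"
  proof (intro sum.cong refl)
    fix a assume "a \<in> {..<?n}"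
    then have a: "a < ?n" by simp
    show "(\<Sum>c<?n. traceless_entry ?n p q a c * traceless_entry ?n r s c a)
      = (if a = p then (if q = r \<and> p = s then 1 else 0) - (if r = s \<and> p = q then 1 / of_nat ?n else 0) else 0)
      - (if a = r then (if p = q \<and> r = s then 1 / of_nat ?n else 0) else 0)
      + (if p = q \<and> r = s then 1 / of_nat ?n * (1 / of_nat ?n) else 0)"
      unfolding traceless_entry_mult[OF lt a a] by auto
  qed
  also have "\<dots> = (if q = r \<and> p = s then 1 else 0) - (if r = s \<and> p = q then 1 / of_nat ?n else 0)
      - (if p = q \<and> r = s then 1 / of_nat ?n else 0)
      + (of_nat ?n :: complex) * (if p = q \<and> r = s then 1 / of_nat ?n * (1 / of_nat ?n) else 0)"
    using lt by (simp add: sum.distrib sum_subtractf del: sum.lessThan_Suc of_nat_Suc of_nat_add)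
  also have "\<dots> = (if q = r \<and> p = s then 1 else 0) - (if p = q \<and> r = s then 1 / of_nat ?n else 0)"
    by (auto simp del: of_nat_Suc of_nat_add)
  finally show ?thesis .
qed

section \<open>From a standard module to its currents\<close>

locale standard = vector_space scale
  for scale :: "complex \<Rightarrow> 'v::ab_group_add \<Rightarrow> 'v" (infixr \<open>*s\<close> 75) +
  fixes l j :: nat and act :: "affine \<Rightarrow> 'v \<Rightarrow> 'v" and v :: 'v
  assumes std: "standard_module l j scale act v" and j: "j \<le> l"
begin

abbreviation "n \<equiv> l + 1"

definition e :: "nat \<Rightarrow> nat \<Rightarrow> int \<Rightarrow> 'v \<Rightarrow> 'v" where
  "e p q m = act (loop l (traceless_unit l p q) m)"

lemma aff_mod: "aff_module l scale act" and irred: "irreducible_module l scale act"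
  and integr: "integrable_module l scale act" and v_nz: "v \<noteq> 0"
  and v_pos: "\<And>x m. x \<in> sl l \<Longrightarrow> 0 < m \<Longrightarrow> act (loop l x m) v = 0"
  and v_root: "\<And>p q. p < q \<Longrightarrow> q \<le> l \<Longrightarrow> act (loop l (root_vec l p q) 0) v = 0"
  and v_cartan: "\<And>H. H \<in> cartan l \<Longrightarrow> act (loop l H 0) v = form (fund_weight l j) H *s v"
  and v_central: "act (central l) v = v"
  using std by (auto simp: standard_module_def)

lemma zero_sl: "0\<^sub>m n n \<in> sl l"
  by (simp add: sl_def mtrace_def)

lemma add_sl: "x \<in> sl l \<Longrightarrow> y \<in> sl l \<Longrightarrow> x + y \<in> sl l"
  by (auto simp: sl_def mtrace_def sum.distrib simp del: sum.lessThan_Suc)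

lemma scale_sl: "x \<in> sl l \<Longrightarrow> z \<cdot>\<^sub>m x \<in> sl l"
  by (auto simp: sl_def mtrace_def simp flip: sum_distrib_left simp del: sum.lessThan_Suc)

lemma loop_aff: "x \<in> sl l \<Longrightarrow> loop l x m \<in> aff l"
  using zero_sl by (auto simp: aff_def loop_def intro: finite_subset[of _ "{m}"])

lemma central_aff: "central l \<in> aff l"
  using zero_sl by (auto simp: aff_def central_def)

lemma act_add: "X \<in> aff l \<Longrightarrow> Y \<in> aff l \<Longrightarrow> act (aff_add X Y) u = act X u + act Y u"
  and act_scale: "X \<in> aff l \<Longrightarrow> act (aff_scale z X) u = z *s act X u"
  and act_bracket: "X \<in> aff l \<Longrightarrow> Y \<in> aff l \<Longrightarrow> act (aff_bracket l X Y) u = act X (act Y u) - act Y (act X u)"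
  and act_linear: "X \<in> aff l \<Longrightarrow> Vector_Spaces.linear scale scale (act X)"
  using aff_mod by (auto simp: aff_module_def)

lemma act_u_add: "X \<in> aff l \<Longrightarrow> act X (u + w) = act X u + act X w"
  and act_u_scale: "X \<in> aff l \<Longrightarrow> act X (z *s u) = z *s act X u"
  using act_linear by (auto simp: Vector_Spaces.linear_iff)

lemma act_zero: "act (\<lambda>k. 0\<^sub>m n n, 0) u = 0"
proof -
  have "(\<lambda>k. 0\<^sub>m n n, 0) = aff_scale 0 (central l)"
    by (auto simp: aff_scale_def central_def intro!: ext eq_matI)
  then show ?thesis using act_scale[OF central_aff, of 0 u] by simp
qed

lemma loop_add: "x \<in> sl l \<Longrightarrow> y \<in> sl l \<Longrightarrow> act (loop l (x + y) m) u = act (loop l x m) u + act (loop l y m) u"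
proof -
  assume x: "x \<in> sl l" "y \<in> sl l"
  have "loop l (x + y) m = aff_add (loop l x m) (loop l y m)"
    by (auto simp: loop_def aff_add_def intro!: ext)
  then show ?thesis using act_add loop_aff x by simp
qed

lemma loop_scale: "x \<in> sl l \<Longrightarrow> act (loop l (z \<cdot>\<^sub>m x) m) u = z *s act (loop l x m) u"
proof -
  assume x: "x \<in> sl l"
  have "loop l (z \<cdot>\<^sub>m x) m = aff_scale z (loop l x m)"
    by (auto simp: loop_def aff_scale_def intro!: ext)
  then show ?thesis using act_scale loop_aff x by simp
qed

lemma loop_0: "act (loop l (0\<^sub>m n n) m) u = 0"
proof -
  have "loop l (0\<^sub>m n n) m = (\<lambda>k. 0\<^sub>m n n, 0)" by (auto simp: loop_def)
  then show ?thesis using act_zero by simp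
qed

text \<open>The traceless units are linearly dependent, but expanding \<open>x\<close> with its own
  entries as coefficients is still correct: the error is a multiple of the trace of
  \<open>x\<close>.\<close>

lemma act_loop:
  assumes x: "x \<in> sl l"
  shows "act (loop l x m) u = (\<Sum>p<n. \<Sum>q<n. x $$ (p, q) *s e p q m u)"
proof -
  define P where "P S = mat n n (\<lambda>(a, b). \<Sum>(p, q)\<in>S. x $$ (p, q) * traceless_entry n p q a b)" for S
  have *: "P S \<in> sl l \<and> act (loop l (P S) m) u = (\<Sum>(p, q)\<in>S. x $$ (p, q) *s e p q m u)"
    if "finite S" "S \<subseteq> {..<n} \<times> {..<n}" for S
    using that
  proof (induction S)
    case empty
    have "P {} = 0\<^sub>m n n" by (rule eq_matI) (auto simp: P_def)
    then show ?case using zero_sl loop_0 by simp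
  next
    case (insert pq S)
    obtain p q where pq: "pq = (p, q)" by (cases pq)
    have "P (insert pq S) = P S + x $$ (p, q) \<cdot>\<^sub>m traceless_unit l p q"
      using insert.hyps pq by (intro eq_matI) (auto simp: P_def traceless_unit_def)
    moreover have "traceless_unit l p q \<in> sl l" using insert.prems pq by (intro traceless_unit_sl) auto
    ultimately show ?case
      using insert pq by (simp add: add_sl scale_sl loop_add loop_scale e_def add.commute)
  qed
  have xc: "x \<in> carrier_mat n n" and tr: "(\<Sum>p<n. x $$ (p, p)) = 0"
    using x by (auto simp: sl_def mtrace_def)
  have "P ({..<n} \<times> {..<n}) = x"
  proof (rule eq_matI)
    fix a b assume "a < dim_row x" "b < dim_col x"
    then have ab: "a < n" "b < n" using xc by auto
    have "P ({..<n} \<times> {..<n}) $$ (a, b) = (\<Sum>p<n. \<Sum>q<n. x $$ (p, q) * traceless_entry n p q a b)"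
      using ab by (simp add: P_def sum.cartesian_product del: sum.lessThan_Suc)
    also have "\<dots> = (\<Sum>p<n. \<Sum>q<n. (if q = b then (if p = a then x $$ (a, b) else 0) else 0)
        - (if q = p then (if a = b then x $$ (p, p) * (1 / of_nat n) else 0) else 0))"
      by (intro sum.cong refl) (auto simp: traceless_entry_def algebra_simps)
    also have "\<dots> = x $$ (a, b) - (if a = b then (\<Sum>p<n. x $$ (p, p) * (1 / of_nat n)) else 0)"
      using ab by (simp add: sum_subtractf del: sum.lessThan_Suc)
    also have "(\<Sum>p<n. x $$ (p, p) * (1 / of_nat n)) = 0"
      unfolding sum_distrib_right[symmetric] tr by simp
    finally show "P ({..<n} \<times> {..<n}) $$ (a, b) = x $$ (a, b)" by simp
  qed (use xc in \<open>auto simp: P_def\<close>)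
  then show ?thesis
    using *[of "{..<n} \<times> {..<n}"] by (simp add: sum.cartesian_product del: sum.lessThan_Suc)
qed

text \<open>Only units at nonzero entries of \<open>X\<close> are required to preserve the subspace,
  so that strictly upper triangular \<open>X\<close> can be treated with positive root currents
  alone.\<close>

lemma act_in_subspace:
  assumes S: "subspace S" and X: "X \<in> aff l" and u: "u \<in> S" and c: "snd X \<noteq> 0 \<Longrightarrow> act (central l) u \<in> S"
    and e: "\<And>p q m. p \<le> l \<Longrightarrow> q \<le> l \<Longrightarrow> fst X m $$ (p, q) \<noteq> 0 \<Longrightarrow> e p q m u \<in> S"
  shows "act X u \<in> S"
proof -
  obtain f a where fa: "X = (f, a)" by (cases X)
  have loop_in: "act (loop l (f m) m) u \<in> S" for m
  proof -
    have "f m \<in> sl l" using X fa by (auto simp: aff_def)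
    moreover have "f m $$ (p, q) *s e p q m u \<in> S" if "p < n" "q < n" for p q
      using e[of p q m] fa that subspace_scale[OF S] subspace_0[OF S]
      by (cases "f m $$ (p, q) = 0") auto
    ultimately show ?thesis
      unfolding act_loop[OF \<open>f m \<in> sl l\<close>] by (intro subspace_sum[OF S]) auto
  qed
  have *: "(\<lambda>m. if m \<in> A then f m else 0\<^sub>m n n, 0) \<in> aff l \<and> act (\<lambda>m. if m \<in> A then f m else 0\<^sub>m n n, 0) u \<in> S"
    if "finite A" for A
    using that
  proof (induction A)
    case empty
    have "(\<lambda>k. 0\<^sub>m n n, 0) \<in> aff l" using zero_sl by (auto simp: aff_def)
    then show ?case using act_zero subspace_0[OF S] by simp
  next
    case (insert k A)
    have fk: "f k \<in> sl l" "f k \<in> carrier_mat n n" using X fa by (auto simp: aff_def sl_def)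
    have "(\<lambda>m. if m \<in> insert k A then f m else 0\<^sub>m n n, 0) = aff_add (loop l (f k) k) (\<lambda>m. if m \<in> A then f m else 0\<^sub>m n n, 0)"
      using insert.hyps fk X fa by (auto simp: aff_add_def loop_def aff_def sl_def intro!: ext)
    moreover have "(\<lambda>m. if m \<in> insert k A then f m else 0\<^sub>m n n, 0) \<in> aff l"
      using insert.hyps(1) zero_sl X fa by (auto simp: aff_def intro: finite_subset[of _ "insert k A"])
    ultimately show ?case
      using insert.IH act_add[OF loop_aff[OF fk(1)]] loop_in subspace_add[OF S] by simp
  qed
  define A where "A = {m. f m \<noteq> 0\<^sub>m n n}"
  have "finite A" using X fa by (auto simp: aff_def A_def)
  moreover have "(\<lambda>m. if m \<in> A then f m else 0\<^sub>m n n) = f" by (auto simp: A_def)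
  ultimately have f0: "(f, 0) \<in> aff l" "act (f, 0) u \<in> S" using *[of A] by auto
  have "f m + z \<cdot>\<^sub>m 0\<^sub>m n n = f m" for z m using X fa by (intro eq_matI) (auto simp: aff_def sl_def)
  then have "X = aff_add (f, 0) (aff_scale a (central l))"
    by (simp add: fa aff_add_def aff_scale_def central_def)
  moreover have "aff_scale a (central l) \<in> aff l"
    using zero_sl scale_sl[OF zero_sl] by (auto simp: aff_def aff_scale_def central_def intro!: eq_matI)
  ultimately have "act X u = act (f, 0) u + a *s act (central l) u"
    using act_add[OF f0(1)] act_scale[OF central_aff] by simp
  moreover have "a *s act (central l) u \<in> S"
    using c fa subspace_scale[OF S] subspace_0[OF S] by (cases "a = 0") auto
  ultimately show ?thesis using f0(2) subspace_add[OF S] by simp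
qed

lemma submodule_UNIV:
  assumes "subspace S" "\<And>X u. X \<in> aff l \<Longrightarrow> u \<in> S \<Longrightarrow> act X u \<in> S" "v \<in> S"
  shows "S = UNIV"
  using irred assms v_nz by (auto simp: irreducible_module_def)

lemma act_central: "act (central l) u = u"
proof -
  have "{u. act (central l) u = u} = UNIV"
  proof (rule submodule_UNIV)
    show "subspace {u. act (central l) u = u}"
      using act_u_add[OF central_aff] act_u_scale[OF central_aff] act_u_scale[OF central_aff, of 0 0]
      by (auto simp: subspace_def)
  next
    fix X u assume X: "X \<in> aff l" and u: "u \<in> {u. act (central l) u = u}"
    have fm: "fst X m \<in> carrier_mat n n" for m using X by (auto simp: aff_def sl_def)
    have "aff_bracket l X (central l) = (\<lambda>k. 0\<^sub>m n n, 0)"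
    proof -
      have "(fst X m * 0\<^sub>m n n - 0\<^sub>m n n * fst X m) = 0\<^sub>m n n" for m
        using fm[of m] by (intro eq_matI) auto
      moreover have "form (fst X m) (0\<^sub>m n n) = 0" for m
        unfolding form_eq[OF fm zero_carrier_mat] by simp
      ultimately show ?thesis
        unfolding aff_bracket_def Let_def central_def by (auto intro!: ext eq_matI)
    qed
    then show "act X u \<in> {u. act (central l) u = u}"
      using act_bracket[OF X central_aff, of u] act_zero u by simp
  qed (simp add: v_central)
  then show ?thesis by blast
qed

lemma e_rep:
  assumes "p < n" "q < n" "r < n" "s < n"
  shows "e p q m (e r s k u) = e r s k (e p q m u)
    + (if q = r then e p s (m + k) u else 0) - (if p = s then e r q (m + k) u else 0)
    + (if m + k = 0 then (of_int m * ((if q = r \<and> p = s then 1 else 0)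
        - (if p = q \<and> r = s then 1 / of_nat n else 0))) *s u else 0)"
proof -
  let ?E = "traceless_unit l"
  have le: "p \<le> l" "q \<le> l" "r \<le> l" "s \<le> l" using assms by auto
  have sl: "?E p q \<in> sl l" "?E r s \<in> sl l" "?E p s \<in> sl l" "?E r q \<in> sl l"
    using le traceless_unit_sl by auto
  let ?A = "if q = r then ?E p s else 0\<^sub>m n n" and ?B = "if p = s then ?E r q else 0\<^sub>m n n"
  have AB: "?A \<in> sl l" "?B \<in> sl l" using sl zero_sl by auto
  have "e p q m (e r s k u) - e r s k (e p q m u)
      = act (aff_bracket l (loop l (?E p q) m) (loop l (?E r s) k)) u"
    unfolding e_def using sl by (simp add: act_bracket loop_aff)
  also have "\<dots> = act (aff_add (loop l (?A + (- 1) \<cdot>\<^sub>m ?B) (m + k))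
      (aff_scale (if m + k = 0 then of_int m * form (?E p q) (?E r s) else 0) (central l))) u"
    unfolding aff_bracket_loop[OF sl(1,2)] traceless_unit_commutator[OF le] ..
  also have "\<dots> = act (loop l (?A + (- 1) \<cdot>\<^sub>m ?B) (m + k)) u
      + (if m + k = 0 then of_int m * form (?E p q) (?E r s) else 0) *s u"
  proof -
    have "aff_scale z (central l) \<in> aff l" for z
      using zero_sl scale_sl[OF zero_sl] by (auto simp: aff_def aff_scale_def central_def intro!: eq_matI)
    then show ?thesis
      using AB by (simp add: act_add loop_aff add_sl scale_sl act_scale central_aff act_central)
  qed
  also have "act (loop l (?A + (- 1) \<cdot>\<^sub>m ?B) (m + k)) u = act (loop l ?A (m + k)) u - act (loop l ?B (m + k)) u"
    using AB by (simp add: loop_add loop_scale scale_sl)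
  also have "\<dots> = (if q = r then e p s (m + k) u else 0) - (if p = s then e r q (m + k) u else 0)"
    by (auto simp: e_def loop_0[simplified])
  finally show ?thesis
    unfolding form_traceless_unit[OF le] by (auto simp: algebra_simps)
qed

lemma linear_e: "p < n \<Longrightarrow> Vector_Spaces.linear scale scale (e p q m)"
  unfolding e_def by (intro act_linear loop_aff traceless_unit_sl) simp

lemma e_u_add: "p < n \<Longrightarrow> e p q m (u + w) = e p q m u + e p q m w"
  and e_u_scale: "p < n \<Longrightarrow> e p q m (z *s u) = z *s e p q m u"
  using linear_e by (auto simp: Vector_Spaces.linear_iff)

lemma e_u_0: "p < n \<Longrightarrow> e p q m 0 = 0"
  using e_u_scale[of p q m 0 0] by simp

lemma e_restricted: "\<exists>M. \<forall>m\<ge>M. \<forall>p<n. \<forall>q<n. e p q m u = 0"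
proof -
  let ?S = "{u. \<exists>M. \<forall>m\<ge>M. \<forall>p<n. \<forall>q<n. e p q m u = 0}"
  have S: "subspace ?S"
    unfolding subspace_def
  proof (intro conjI ballI allI)
    show "0 \<in> ?S" by (auto simp: e_u_0)
  next
    fix u w assume "u \<in> ?S" "w \<in> ?S"
    then obtain M M' where "\<forall>m\<ge>M. \<forall>p<n. \<forall>q<n. e p q m u = 0" "\<forall>m\<ge>M'. \<forall>p<n. \<forall>q<n. e p q m w = 0" by blast
    then show "u + w \<in> ?S" by (auto simp: e_u_add intro!: exI[of _ "max M M'"])
  next
    fix z u assume "u \<in> ?S"
    then show "z *s u \<in> ?S" by (fastforce simp: e_u_scale)
  qed
  have "?S = UNIV"
  proof (rule submodule_UNIV[OF S])
    fix X u assume X: "X \<in> aff l" and u: "u \<in> ?S"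
    show "act X u \<in> ?S"
    proof (rule act_in_subspace[OF S X u])
      fix r s k assume rs: "r \<le> l" "s \<le> l"
      obtain M where M: "\<And>m p q. M \<le> m \<Longrightarrow> p < n \<Longrightarrow> q < n \<Longrightarrow> e p q m u = 0" using u by blast
      have "e p q m (e r s k u) = 0" if "\<bar>M\<bar> + \<bar>k\<bar> + 1 \<le> m" "p < n" "q < n" for p q m
      proof -
        have "M \<le> m" "M \<le> m + k" "m + k \<noteq> 0" using that(1) by linarith+
        moreover have "r < n" "s < n" using rs by auto
        ultimately show ?thesis using M that e_rep[of p q r s m k u] by (simp add: e_u_0)
      qed
      then show "e r s k u \<in> ?S" by blast
    qed (use u in \<open>simp add: act_central\<close>)
  next
    show "v \<in> ?S"
      using v_pos traceless_unit_sl by (auto simp: e_def intro!: exI[of _ 1])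
  qed
  then show ?thesis by blast
qed

end

lemma sum_atLeast1_shift: "(\<Sum>i=1..l. f i) = (\<Sum>p<l. f (Suc p))"
  by (rule sum.reindex_bij_witness[of _ Suc "\<lambda>i. i - 1"]) auto

context standard
begin

text \<open>Expanding the unit at \<open>(0, 0)\<close> in the dependent family by
  \<open>act_loop\<close> returns it minus \<open>1 / n\<close> times the sum of the diagonal
  units.\<close>

lemma e_traceless: "(\<Sum>p<n. e p p m u) = 0"
proof -
  have "e 0 0 m u = (\<Sum>p<n. \<Sum>q<n. traceless_unit l 0 0 $$ (p, q) *s e p q m u)"
    unfolding e_def[of 0 0] by (intro act_loop traceless_unit_sl) simp
  also have "\<dots> = (\<Sum>p<n. \<Sum>q<n. (if q = 0 then (if p = 0 then e 0 0 m u else 0) else 0)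
      - (if q = p then (1 / of_nat n) *s e p p m u else 0))"
    by (intro sum.cong refl)
      (auto simp: traceless_unit_index traceless_entry_def scale_left_diff_distrib simp del: of_nat_Suc of_nat_add)
  also have "\<dots> = e 0 0 m u - (1 / of_nat n) *s (\<Sum>p<n. e p p m u)"
    by (simp add: sum_subtractf scale_sum_right del: of_nat_Suc of_nat_add sum.lessThan_Suc)
  finally have "(1 / of_nat n) *s (\<Sum>p<n. e p p m u) = 0" by simp
  moreover have "1 / of_nat n \<noteq> (0 :: complex)" by (simp del: of_nat_Suc of_nat_add)
  ultimately show ?thesis using scale_eq_0_iff by blast
qed

sublocale rep: traceless_rep scale n "1 / of_nat n" e
proof (intro traceless_rep.intro current_rep.intro current_rep_axioms.intro traceless_rep_axioms.intro vector_space_axioms)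
  show "Vector_Spaces.linear scale scale (e p q m)" if "p < n" "q < n" for p q m
    by (rule linear_e[OF that(1)])
qed (use e_rep e_restricted e_traceless in blast)+

lemma loop_fund_weight:
  assumes "i \<le> l"
  shows "act (loop l (fund_weight l i) m) u = (\<Sum>p<i. e p p m u)"
proof -
  have "fund_weight l i \<in> sl l" using fund_weight_in_cartan[OF assms] by (simp add: cartan_def)
  then have "act (loop l (fund_weight l i) m) u = (\<Sum>p<n. \<Sum>q<n. fund_weight l i $$ (p, q) *s e p q m u)"
    by (rule act_loop)
  also have "\<dots> = (\<Sum>p<n. \<Sum>q<n. if q = p then (if p < i then e p p m u else 0) - (of_nat i / of_nat n) *s e p p m u else 0)"
    by (intro sum.cong refl)
      (auto simp: fund_weight_def scale_left_diff_distrib simp del: of_nat_Suc of_nat_add)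
  also have "\<dots> = (\<Sum>p<n. if p < i then e p p m u else 0) - (of_nat i / of_nat n) *s (\<Sum>p<n. e p p m u)"
    by (simp add: sum_subtractf scale_sum_right del: of_nat_Suc of_nat_add sum.lessThan_Suc)
  also have "(\<Sum>p<n. if p < i then e p p m u else 0) = (\<Sum>p<i. e p p m u)"
    using assms by (intro sum.mono_neutral_cong_right) auto
  finally show ?thesis by (simp only: e_traceless) simp
qed

lemma loop_simple_root:
  assumes "i \<in> {1..l}"
  shows "act (loop l (simple_root l i) m) u = e (i - 1) (i - 1) m u - e i i m u"
proof -
  have "simple_root l i = traceless_unit l (i - 1) (i - 1) + (- 1) \<cdot>\<^sub>m traceless_unit l i i"
  proof (rule eq_matI)
    fix a c
    assume "a < dim_row (traceless_unit l (i - 1) (i - 1) + (- 1) \<cdot>\<^sub>m traceless_unit l i i)"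
      "c < dim_col (traceless_unit l (i - 1) (i - 1) + (- 1) \<cdot>\<^sub>m traceless_unit l i i)"
    then have ac: "a < Suc l" "c < Suc l" by (simp_all add: traceless_unit_def)
    obtain k where "i = Suc k" using assms by (cases i) auto
    then show "simple_root l i $$ (a, c)
        = (traceless_unit l (i - 1) (i - 1) + (- 1) \<cdot>\<^sub>m traceless_unit l i i) $$ (a, c)"
      using ac by (cases "a = c") (simp_all add: simple_root_def traceless_unit_def traceless_entry_def)
  qed (simp_all add: simple_root_def traceless_unit_def)
  moreover have "traceless_unit l (i - 1) (i - 1) \<in> sl l" "traceless_unit l i i \<in> sl l"
    using assms by (auto intro!: traceless_unit_sl)
  ultimately show ?thesis by (simp add: loop_add loop_scale scale_sl e_def)
qed

text \<open>Summation by parts: the fundamental weights act as partial sums of the diagonal modes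
  and the simple roots as their differences, so the Cartan part becomes the sum of the diagonal
  squares. The boundary term at \<open>n\<close> vanishes by tracelessness.\<close>

lemma casimir_sum_eq:
  "casimir_sum l (\<lambda>x y. act (loop l x (- m)) (act (loop l y m) u)) = rep.cas m u"
proof -
  define y where "y i = (\<Sum>p<i. e p p m u)" for i
  define g where "g p = e p p (- m)" for p
  have g: "g p (a - b) = g p a - g p b" "g p 0 = 0" if "p < n" for p a b
    using that rep.e_diff rep.e_0 by (auto simp: g_def)
  have "(\<Sum>i=1..l. act (loop l (simple_root l i) (- m)) (act (loop l (fund_weight l i) m) u))
      = (\<Sum>i=1..l. g (i - 1) (y i) - g i (y i))"
    by (intro sum.cong refl) (simp add: loop_fund_weight loop_simple_root y_def g_def)
  also have "\<dots> = (\<Sum>p<l. g p (y (Suc p))) - (\<Sum>p<l. g (Suc p) (y (Suc p)))"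
    unfolding sum_atLeast1_shift by (simp add: sum_subtractf)
  also have "(\<Sum>p<l. g p (y (Suc p))) = (\<Sum>p<n. g p (y (Suc p)))"
  proof -
    have "y (Suc l) = 0" using e_traceless by (simp add: y_def)
    then show ?thesis using g(2)[of l] by simp
  qed
  also have "(\<Sum>p<l. g (Suc p) (y (Suc p))) = (\<Sum>p<n. g p (y p))"
    unfolding Suc_eq_plus1[symmetric] sum.lessThan_Suc_shift using g(2)[of 0] by (simp add: y_def)
  also have "(\<Sum>p<n. g p (y (Suc p))) - (\<Sum>p<n. g p (y p)) = (\<Sum>p<n. e p p (- m) (e p p m u))"
    unfolding sum_subtractf[symmetric]
    by (intro sum.cong refl) (simp add: g(1)[symmetric] y_def, simp add: g_def)
  finally have diag: "(\<Sum>i=1..l. act (loop l (simple_root l i) (- m)) (act (loop l (fund_weight l i) m) u))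
      = (\<Sum>p<n. e p p (- m) (e p p m u))" .
  have "(\<Sum>p\<le>l. \<Sum>q\<in>{..l} - {p}. act (loop l (root_vec l p q) (- m)) (act (loop l (root_vec l q p) m) u))
      = (\<Sum>p<n. \<Sum>q\<in>{..<n} - {p}. e p q (- m) (e q p m u))"
    by (intro sum.cong) (auto simp: e_def traceless_unit_offdiag)
  moreover have "(\<Sum>q\<in>{..<n} - {p}. e p q (- m) (e q p m u)) + e p p (- m) (e p p m u)
      = (\<Sum>q<n. e p q (- m) (e q p m u))" if "p \<in> {..<n}" for p
    using sum.remove[OF finite_lessThan that, of "\<lambda>q. e p q (- m) (e q p m u)"] by (simp only: add.commute)
  ultimately show ?thesis
    unfolding casimir_sum_def diag rep.cas_def by (simp only: sum.distrib[symmetric] cong: sum.cong)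
qed

lemma L0_eq: "L0 l scale act = rep.sugawara"
proof
  fix u
  show "L0 l scale act u = rep.sugawara u"
  proof -
    have "casimir_sum l (\<lambda>x y. act (loop l x 0) (act (loop l y 0) u)) = rep.cas 0 u"
      using casimir_sum_eq[of 0 u] by (simp only: minus_zero)
    then show ?thesis unfolding L0_def rep.sugawara_def casimir_sum_eq by (simp only:)
  qed
qed

sublocale cur: current_module scale n "1 / of_nat n" e "L0 l scale act"
proof (intro current_module.intro current_module_axioms.intro rep.current_rep_axioms)
  show "Vector_Spaces.linear scale scale (L0 l scale act)"
    unfolding L0_eq by (rule rep.linear_sugawara)
  show "L0 l scale act (e p q m u) = e p q m (L0 l scale act u) - of_int m *s e p q m u" if "p < n" "q < n" for p q m u
    unfolding L0_eq by (rule rep.sugawara_commutator[OF that])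
next
  fix S assume S: "subspace S" and cl: "\<And>p q m u. p < n \<Longrightarrow> q < n \<Longrightarrow> u \<in> S \<Longrightarrow> e p q m u \<in> S"
  have "act X u \<in> S" if "X \<in> aff l" "u \<in> S" for X u
  proof (rule act_in_subspace[OF S that])
    show "act (central l) u \<in> S" using act_central that(2) by simp
  next
    fix p q m assume "p \<le> l" "q \<le> l"
    then show "e p q m u \<in> S" using that(2) by (intro cl) auto
  qed
  then show "S = {0} \<or> S = UNIV"
    using irred S by (auto simp: irreducible_module_def)
qed

section \<open>The highest weight vector\<close>

definition wt :: "nat \<Rightarrow> complex" where
  "wt p = (if p < j then 1 else 0) - of_nat j / of_nat n"

lemma e_v_pos: "p < n \<Longrightarrow> q < n \<Longrightarrow> 0 < m \<Longrightarrow> e p q m v = 0"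
  unfolding e_def by (intro v_pos traceless_unit_sl) auto

lemma e_v_upper: "p < q \<Longrightarrow> q < n \<Longrightarrow> e p q 0 v = 0"
  unfolding e_def using v_root[of p q] by (simp add: traceless_unit_offdiag)

lemma fund_weight_index: "a < n \<Longrightarrow> b < n \<Longrightarrow> fund_weight l j $$ (a, b) = (if a = b then wt a else 0)"
  by (simp add: fund_weight_def wt_def)

lemma fund_weight_carrier: "fund_weight l i \<in> carrier_mat n n"
  by (simp add: fund_weight_def)

lemma sum_wt: "(\<Sum>a<n. wt a) = 0"
proof -
  have "mtrace (fund_weight l j) = 0" using fund_weight_in_cartan[OF j] by (simp add: cartan_def sl_def)
  moreover have "mtrace (fund_weight l j) = (\<Sum>a<n. wt a)"
    unfolding mtrace_def by (intro sum.cong) (auto simp: fund_weight_def wt_def)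
  ultimately show ?thesis by simp
qed

lemma form_fund_weight:
  assumes "B \<in> carrier_mat n n"
  shows "form (fund_weight l j) B = (\<Sum>a<n. wt a * B $$ (a, a))"
proof -
  have "form (fund_weight l j) B = (\<Sum>a<n. \<Sum>c<n. if c = a then wt a * B $$ (a, a) else 0)"
    unfolding form_eq[OF fund_weight_carrier assms]
    by (intro sum.cong refl) (auto simp: fund_weight_index)
  then show ?thesis by (simp del: sum.lessThan_Suc)
qed

lemma e_v_diag: "p < n \<Longrightarrow> e p p 0 v = wt p *s v"
proof -
  assume p: "p < n"
  have "traceless_unit l p p \<in> cartan l"
    using p traceless_unit_sl[of p l p]
    by (auto simp: cartan_def diagonal_mat_def traceless_unit_def traceless_entry_def)
  then have "e p p 0 v = form (fund_weight l j) (traceless_unit l p p) *s v"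
    unfolding e_def by (rule v_cartan)
  also have "form (fund_weight l j) (traceless_unit l p p)
      = (\<Sum>a<n. (if a = p then wt p else 0) - wt a * (1 / of_nat n))"
    unfolding form_fund_weight[OF traceless_unit_carrier]
    by (intro sum.cong refl) (auto simp: traceless_unit_index traceless_entry_def algebra_simps)
  also have "\<dots> = wt p - (\<Sum>a<n. wt a) * (1 / of_nat n)"
    unfolding sum_subtractf sum_distrib_right using p by (simp del: sum.lessThan_Suc)
  finally show ?thesis by (simp only: sum_wt) simp
qed

text \<open>The modes \<open>e q p (- m)\<close> and \<open>e p q m\<close> generate an
  \<open>sl(2)\<close> for which \<open>v\<close> is a highest weight vector of weight
  \<open>wt q - wt p - m = 0\<close>. With \<open>f\<close> for the lowering mode, raising takes
  \<open>f^(k+1) v\<close> to \<open>- k (k + 1) f^k v\<close>, so nilpotency descends to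
  \<open>f v = 0\<close>.\<close>

lemma lowering_zero:
  assumes pq: "p < n" "q < n" "p \<noteq> q" and raise: "e q p (- m) v = 0" and weight: "wt q - wt p = of_int m"
    and nil: "(e p q m ^^ k) v = 0"
  shows "e p q m v = 0"
proof -
  define a where "a k = (e p q m ^^ k) v" for k
  have a: "a (Suc k) = e p q m (a k)" for k by (simp add: a_def)
  have diag: "e r r 0 (e p q m u) = e p q m (e r r 0 u)
      + (if r = p then e p q m u else 0) - (if r = q then e p q m u else 0)" if "r < n" for r u
    using rep.comm_e[of r r p q 0 m u] that pq by auto
  have wq: "e q q 0 (a k) = (wt q - of_nat k) *s a k" for k
  proof (induction k)
    case (Suc k)
    have "e q q 0 (a (Suc k)) = (wt q - of_nat k) *s a (Suc k) - 1 *s a (Suc k)"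
      using pq by (simp add: a diag Suc rep.e_scale)
    moreover have "wt q - of_nat (Suc k) = wt q - of_nat k - 1" by simp
    ultimately show ?case by (simp only: scale_left_diff_distrib)
  qed (use pq in \<open>simp add: a_def e_v_diag\<close>)
  have wp: "e p p 0 (a k) = (wt p + of_nat k) *s a k" for k
  proof (induction k)
    case (Suc k)
    have "e p p 0 (a (Suc k)) = (wt p + of_nat k) *s a (Suc k) + 1 *s a (Suc k)"
      using pq by (simp add: a diag Suc rep.e_scale)
    moreover have "wt p + of_nat (Suc k) = wt p + of_nat k + 1" by simp
    ultimately show ?case by (simp only: scale_left_distrib)
  qed (use pq in \<open>simp add: a_def e_v_diag\<close>)
  have r: "e q p (- m) (a (Suc k)) = (- of_nat (k * Suc k)) *s a k" for k
  proof (induction k)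
    case 0
    have "(wt q - wt p - of_int m) *s v = 0" using weight by simp
    then show ?case
      using pq rep.comm_e[of q p p q "- m" m v] raise
      by (simp add: a_def e_v_diag rep.e_0 scale_left_diff_distrib algebra_simps)
  next
    case (Suc k)
    have "e q p (- m) (a (Suc (Suc k))) = e p q m (e q p (- m) (a (Suc k)))
        + e q q 0 (a (Suc k)) - e p p 0 (a (Suc k)) + (- of_int m) *s a (Suc k)"
      unfolding a[of "Suc k"] using pq rep.comm_e[of q p p q "- m" m "a (Suc k)"] by simp
    also have "\<dots> = (- of_nat (k * Suc k)) *s a (Suc k) + (wt q - of_nat (Suc k)) *s a (Suc k)
        - (wt p + of_nat (Suc k)) *s a (Suc k) + (- of_int m) *s a (Suc k)"
      unfolding Suc wq wp using pq by (simp only: rep.e_scale a[symmetric])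
    also have "\<dots> = (- of_nat (k * Suc k) + (wt q - of_nat (Suc k)) - (wt p + of_nat (Suc k)) - of_int m) *s a (Suc k)"
      by (simp only: scale_left_distrib scale_left_diff_distrib scale_minus_left diff_conv_add_uminus)
    also have "- of_nat (k * Suc k) + (wt q - of_nat (Suc k)) - (wt p + of_nat (Suc k)) - of_int m
        = (wt q - wt p - of_int m) - of_nat (Suc k * Suc (Suc k))"
      by (simp add: algebra_simps)
    finally show ?case using weight by simp
  qed
  have "a (Suc k) = 0 \<Longrightarrow> a 1 = 0" for k
  proof (induction k)
    case (Suc k)
    then have "(- of_nat (Suc k * Suc (Suc k))) *s a (Suc k) = 0"
      using r[of "Suc k"] pq rep.e_0 by simp
    moreover have "- of_nat (Suc k * Suc (Suc k)) \<noteq> (0 :: complex)"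
      unfolding neg_equal_0_iff_equal of_nat_eq_0_iff by simp
    ultimately have "a (Suc k) = 0" using scale_eq_0_iff by blast
    then show ?case by (rule Suc.IH)
  qed simp
  moreover have "a (Suc k) = 0" unfolding a using nil pq by (simp add: a_def rep.e_0)
  ultimately show ?thesis by (simp add: a_def)
qed

lemma e_v_lower_simple:
  assumes "i \<in> {1..l}" "i \<noteq> j"
  shows "e i (i - 1) 0 v = 0"
proof -
  have "loop l (root_vec l i (i - 1)) 0 \<in> chevalley_gens l" using assms by (auto simp: chevalley_gens_def)
  then obtain k where "(act (loop l (root_vec l i (i - 1)) 0) ^^ k) v = 0"
    using integr unfolding integrable_module_def by blast
  moreover have "root_vec l i (i - 1) = traceless_unit l i (i - 1)"
    using assms by (intro traceless_unit_offdiag[symmetric]) auto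
  ultimately have "(e i (i - 1) 0 ^^ k) v = 0" by (simp add: e_def[abs_def])
  moreover have "e (i - 1) i (- 0) v = 0" using assms e_v_upper[of "i - 1" i] by simp
  moreover have "wt (i - 1) - wt i = of_int 0" using assms by (auto simp: wt_def)
  ultimately show ?thesis using assms by (intro lowering_zero[of i "i - 1" 0 k]) auto
qed

text \<open>\<open>e 0 l (- 1)\<close> is the lowering generator of the affine node, whose coroot
  takes the value \<open>1 - <lambda_j, theta> = 0\<close> on \<open>Lambda_j\<close> for
  \<open>j \<ge> 1\<close>.\<close>

lemma e_v_theta:
  assumes "1 \<le> j"
  shows "e 0 l (- 1) v = 0"
proof -
  have l: "1 \<le> l" using assms j by simp
  have "loop l (root_vec l 0 l) (- 1) \<in> chevalley_gens l" by (auto simp: chevalley_gens_def)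
  then obtain k where "(act (loop l (root_vec l 0 l) (- 1)) ^^ k) v = 0"
    using integr unfolding integrable_module_def by blast
  moreover have "root_vec l 0 l = traceless_unit l 0 l" using l by (simp add: traceless_unit_offdiag)
  ultimately have "(e 0 l (- 1) ^^ k) v = 0" by (simp add: e_def[abs_def])
  moreover have "e l 0 (- (- 1)) v = 0" by (intro e_v_pos) auto
  moreover have "wt l - wt 0 = of_int (- 1)" using assms j by (simp add: wt_def)
  ultimately show ?thesis using l by (intro lowering_zero[of 0 l "- 1" k]) auto
qed

text \<open>If the node \<open>j\<close> is not crossed, the root vector is a bracket of simple
  lowering vectors, each of which kills \<open>v\<close>.\<close>

lemma e_v_lower:
  assumes "q < p" "p \<le> l" "p < j \<or> j \<le> q"
  shows "e p q 0 v = 0"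
  using assms
proof (induction "p - q" arbitrary: p)
  case (Suc d)
  show ?case
  proof (cases "p = Suc q")
    case True
    then show ?thesis using e_v_lower_simple[of p] Suc by auto
  next
    case False
    have "e (p - 1) q 0 v = 0" using False Suc by (intro Suc.hyps(1)) auto
    moreover have "e p (p - 1) 0 v = 0" using Suc.prems by (intro e_v_lower_simple) auto
    ultimately show ?thesis
      using rep.comm_e[of p "p - 1" "p - 1" q 0 0 v] Suc.prems by (simp add: rep.e_0)
  qed
qed simp

text \<open>Brackets with lowering operators on either side of the node \<open>j\<close> carry the
  vanishing from the highest root to every root that crosses \<open>j\<close>.\<close>

lemma e_v_crossing:
  assumes "p < j" "j \<le> q" "q \<le> l"
  shows "e p q (- 1) v = 0"
proof -
  have th: "e 0 l (- 1) v = 0" using assms by (intro e_v_theta) simp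
  have 0: "e 0 q (- 1) v = 0"
  proof (cases "q = l")
    case False
    have "e l q 0 v = 0" using False assms by (intro e_v_lower) auto
    then show ?thesis
      using rep.comm_e[of 0 l l q "- 1" 0 v] assms th False by (simp add: rep.e_0)
  qed (use th in simp)
  show ?thesis
  proof (cases "p = 0")
    case False
    have "e p 0 0 v = 0" using False assms by (intro e_v_lower) auto
    then show ?thesis
      using rep.comm_e[of p 0 0 q 0 "- 1" v] assms 0 False by (simp add: rep.e_0)
  qed (use 0 in simp)
qed

lemma bounded_v: "rep.bounded_by v 1"
  unfolding rep.bounded_by_def using e_v_pos by auto

lemma form_fund_weight_self:
  "form (fund_weight l j) (fund_weight l j) = of_nat (j * (n - j)) / of_nat n"
proof -
  have "form (fund_weight l j) (fund_weight l j) = (\<Sum>a<n. wt a * wt a)"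
    unfolding form_fund_weight[OF fund_weight_carrier]
    by (intro sum.cong refl) (simp add: fund_weight_index)
  also have "\<dots> = (\<Sum>a<n. (if a < j then wt a else 0) - of_nat j / of_nat n * wt a)"
    by (intro sum.cong refl) (simp add: wt_def left_diff_distrib)
  also have "\<dots> = (\<Sum>a<n. if a < j then wt a else 0)"
    unfolding sum_subtractf sum_distrib_left[symmetric] sum_wt by simp
  also have "\<dots> = (\<Sum>a<j. 1 - of_nat j / of_nat n)"
    using j by (intro sum.mono_neutral_cong_right) (auto simp: wt_def)
  also have "\<dots> = of_nat (j * (n - j)) / of_nat n"
    using j by (simp add: field_simps of_nat_diff del: of_nat_Suc)
  finally show ?thesis .
qed

lemma L0_v: "L0 l scale act v = (1 / 2 * form (fund_weight l j) (fund_weight l j)) *s v"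
proof -
  define F where "F = form (fund_weight l j) (fund_weight l j)"
  have t: "e p q 0 (e q p 0 v) = ((if p = q then wt p * wt p else 0) + (if p < j \<and> j \<le> q then 1 else 0)) *s v"
    if "p < n" "q < n" for p q
  proof -
    consider "p = q" | "q < p" | "p < q" by linarith
    then show ?thesis
    proof cases
      case 1
      then show ?thesis using that by (auto simp: e_v_diag rep.e_scale)
    next
      case 2
      then have "e q p 0 v = 0" using that by (intro e_v_upper)
      then show ?thesis using that 2 by (auto simp: rep.e_0)
    next
      case 3
      then have "e p q 0 v = 0" using that by (intro e_v_upper)
      then have "e p q 0 (e q p 0 v) = (wt p - wt q) *s v"
        using rep.comm_e[of p q q p 0 0 v] that 3
        by (simp add: rep.e_0 e_v_diag scale_left_diff_distrib)
      then show ?thesis using 3 by (simp add: wt_def)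
    qed
  qed
  have "rep.cas 0 v = (\<Sum>p<n. \<Sum>q<n. ((if p = q then wt p * wt p else 0) + (if p < j \<and> j \<le> q then 1 else 0))) *s v"
    unfolding rep.cas_def scale_sum_left by (intro sum.cong refl) (simp add: t)
  also have "(\<Sum>p<n. \<Sum>q<n. ((if p = q then wt p * wt p else 0) + (if p < j \<and> j \<le> q then 1 else 0)))
      = (\<Sum>p<n. wt p * wt p) + (\<Sum>p<n. \<Sum>q<n. if p < j \<and> j \<le> q then 1 else (0 :: complex))"
    by (simp add: sum.distrib del: sum.lessThan_Suc)
  also have "(\<Sum>p<n. wt p * wt p) = F"
    unfolding F_def form_fund_weight[OF fund_weight_carrier]
    by (intro sum.cong refl) (simp add: fund_weight_index)
  \<comment> \<open>The \<open>j (n - j)\<close> crossing pairs account for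
    \<open>n <lambda_j, lambda_j>\<close>. Together with the diagonal part this is
    \<open>(1 + n) <lambda_j, lambda_j>\<close>, the denominator of the Sugawara formula up to
    2.\<close>
  also have "(\<Sum>p<n. \<Sum>q<n. if p < j \<and> j \<le> q then 1 else (0 :: complex)) = (\<Sum>p<j. \<Sum>q\<in>{j..<n}. 1)"
  proof (rule sum.mono_neutral_cong_right)
    show "(\<Sum>q<n. if p < j \<and> j \<le> q then 1 else (0 :: complex)) = (\<Sum>q\<in>{j..<n}. 1)" if "p \<in> {..<j}" for p
      using that by (intro sum.mono_neutral_cong_right) auto
  qed (use j in auto)
  also have "\<dots> = of_nat n * F"
    unfolding F_def form_fund_weight_self by (simp del: of_nat_Suc of_nat_add)
  finally have cas: "rep.cas 0 v = ((1 + of_nat n) * F) *s v"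
    by (simp add: algebra_simps)
  have "rep.cas 1 v = 0" by (rule rep.cas_0[OF bounded_v]) simp
  then have "rep.sugawara v = (1 / (2 * (1 + of_nat n))) *s rep.cas 0 v"
    using rep.sugawara_eq[OF bounded_v order.refl] by simp
  also have "\<dots> = (1 / 2 * F) *s v"
  proof -
    have "of_nat (Suc n) \<noteq> (0 :: complex)" by (simp only: of_nat_eq_0_iff)
    then have nz: "1 + of_nat n \<noteq> (0 :: complex)" by simp
    have "1 / (2 * (1 + of_nat n)) * ((1 + of_nat n) * F) = 1 / 2 * F"
    proof -
      have "y \<noteq> 0 \<Longrightarrow> 1 / (2 * y) * (y * F) = 1 / 2 * F" for y by simp
      from this[OF nz] show ?thesis .
    qed
    then show ?thesis unfolding cas by (simp only: scale_scale)
  qed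
  finally show ?thesis by (simp add: L0_eq F_def)
qed

text \<open>The integral form of \<open>lambda_j\<close>; subtracting the scalar
  \<open>shift\<close> makes it traceless.\<close>

definition b :: "nat \<Rightarrow> int" where "b p = (if p < j then 1 else 0)"

definition shift :: complex where "shift = of_nat j / of_nat n"

definition e' :: "nat \<Rightarrow> nat \<Rightarrow> int \<Rightarrow> 'v \<Rightarrow> 'v" where
  "e' = (\<lambda>p q m u. e p q (m - b p + b q) u - (if p = q \<and> m = 0 then (of_int (b p) - shift) *s u else 0))"

definition d' :: "'v \<Rightarrow> 'v" where
  "d' = (\<lambda>u. L0 l scale act u - (\<Sum>p<n. of_int (b p) *s e p p 0 u))"

lemma wt_eq: "wt p = of_int (b p) - shift"
  by (simp add: wt_def b_def shift_def)

text \<open>The spectral flow by the coweight \<open>lambda_j\<close> turns the highest weight vector of \<open>L(Lambda_j)\<close> into a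
  vacuum vector, which reduces \<open>L(Lambda_j)\<close> to \<open>L(Lambda_0)\<close>.\<close>

sublocale vac: vacuum_module scale n "1 / of_nat n" e' d' v
  "1 / 2 * form (fund_weight l j) (fund_weight l j) - (\<Sum>p<n. of_int (b p) * wt p)"
proof (intro vacuum_module.intro vacuum_module_axioms.intro)
  show "current_module scale n (1 / of_nat n) e' d'"
    unfolding e'_def d'_def by (rule cur.spectral_flow)
  show "v \<noteq> 0" by (rule v_nz)
  show "d' v = (1 / 2 * form (fund_weight l j) (fund_weight l j) - (\<Sum>p<n. of_int (b p) * wt p)) *s v"
    unfolding d'_def L0_v scale_left_diff_distrib scale_sum_left
    by (intro arg_cong2[of _ _ _ _ "(-)"] sum.cong refl) (simp add: e_v_diag)
  fix p q m assume pq: "p < n" "q < n" and m: "(0 :: int) \<le> m"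
  show "e' p q m v = 0"
  proof (cases "p = q")
    case True
    then show ?thesis using pq m e_v_pos[of p p m]
      by (cases "m = 0") (auto simp: e'_def e_v_diag wt_eq)
  next
    case False
    have "e p q (m - b p + b q) v = 0"
    proof (cases "0 < m - b p + b q")
      case True
      then show ?thesis using pq by (intro e_v_pos)
    next
      case nonpos: False
      \<comment> \<open>Roots crossing \<open>j\<close> upwards have their modes lowered by 1, so
        the modes -1 and 0 need attention. Those crossing downwards are raised to positive modes,
        and the others are unchanged.\<close>
      consider "p < j" "j \<le> q" "m = 0" | "p < j" "j \<le> q" "m = 1" | "p < j \<longleftrightarrow> q < j" "m = 0"
        using nonpos m unfolding b_def by (auto split: if_splits) linarith
      then show ?thesis
      proof cases
        case 1
        then show ?thesis using pq e_v_crossing[of p q] by (simp add: b_def)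
      next
        case 2
        then show ?thesis using pq e_v_upper[of p q] by (simp add: b_def)
      next
        case 3
        then have "e p q 0 v = 0"
          using pq False e_v_upper[of p q] e_v_lower[of q p] by (cases "p < q") auto
        then show ?thesis using 3 by (simp add: b_def)
      qed
    qed
    then show ?thesis using False by (simp add: e'_def)
  qed
qed

end

section \<open>Dimensions of the homogeneous subspaces\<close>

context vector_space
begin

lemma joint_eigenvector_in_span:
  assumes "finite K"
    and T: "\<And>k u w. k \<in> K \<Longrightarrow> T k (u + w) = T k u + T k w" "\<And>k a u. k \<in> K \<Longrightarrow> T k (scale a u) = scale a (T k u)"
    and G: "\<And>k g. k \<in> K \<Longrightarrow> g \<in> G \<Longrightarrow> \<exists>z. T k g = scale z g"
    and u: "u \<in> span G" "\<And>k. k \<in> K \<Longrightarrow> T k u = scale (c k) u"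
  shows "u \<in> span {g \<in> G. \<forall>k\<in>K. T k g = scale (c k) g}"
  using assms
proof (induction K)
  case (insert k K)
  have "u \<in> span {g \<in> G. \<forall>k\<in>K. T k g = scale (c k) g}"
    using insert.prems by (intro insert.IH) auto
  then have "u \<in> span {g \<in> {g \<in> G. \<forall>k\<in>K. T k g = scale (c k) g}. T k g = scale (c k) g}"
    using insert.prems by (intro eigenvector_in_span) auto
  moreover have "{g \<in> {g \<in> G. \<forall>k\<in>K. T k g = scale (c k) g}. T k g = scale (c k) g}
      = {g \<in> G. \<forall>k\<in>insert k K. T k g = scale (c k) g}" by auto
  ultimately show ?case by simp
qed simp

lemma independent_family:
  assumes S: "finite S" and ind: "\<And>a. (\<Sum>s\<in>S. scale (a s) (f s)) = 0 \<Longrightarrow> \<forall>s\<in>S. a s = 0"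
  shows "inj_on f S" "independent (f ` S)"
proof -
  show inj: "inj_on f S"
  proof (rule inj_onI)
    fix s t assume st: "s \<in> S" "t \<in> S" "f s = f t"
    show "s = t"
    proof (rule ccontr)
      assume "s \<noteq> t"
      let ?a = "\<lambda>r. (if r = s then 1 else if r = t then - 1 else 0) :: 'a"
      have "(\<Sum>r\<in>S. scale (?a r) (f r)) = (\<Sum>r\<in>{s, t}. scale (?a r) (f r))"
        using S st by (intro sum.mono_neutral_right) auto
      also have "\<dots> = 0" using \<open>s \<noteq> t\<close> st(3) by simp
      finally show False using bspec[OF ind st(1)] by fastforce
    qed
  qed
  show "independent (f ` S)"
  proof (rule independent_if_scalars_zero)
    fix a y assume "(\<Sum>x\<in>f ` S. scale (a x) x) = 0" "y \<in> f ` S"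
    then show "a y = 0" using ind[of "a \<circ> f"] by (auto simp: sum.reindex[OF inj] o_def)
  qed (use S in simp)
qed

end

context vacuum_module
begin

definition word_space :: "'a set" where
  "word_space = span {act_word w v | w. fst ` set w \<subseteq> {1..<n}}"

lemma subspace_word_space: "subspace word_space"
  by (simp add: word_space_def)

lemma x_word_space:
  assumes "i \<in> {1..<n}" "u \<in> word_space"
  shows "x i m u \<in> word_space"
  unfolding word_space_def
proof (rule x_in_span[OF _ _ assms(2)[unfolded word_space_def]])
  fix u assume "u \<in> {act_word w v | w. fst ` set w \<subseteq> {1..<n}}"
  then obtain w where "u = act_word w v" "fst ` set w \<subseteq> {1..<n}" by blast
  then have "x i m u = act_word (w @ [(i, m)]) v" "fst ` set (w @ [(i, m)]) \<subseteq> {1..<n}"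
    using assms(1) by (auto simp: act_word_append)
  then show "x i m u \<in> span {act_word w v | w. fst ` set w \<subseteq> {1..<n}}"
    by (intro span_base) blast
qed (use assms in simp)

text \<open>Every positive root current is an iterated bracket of simple ones, so words in the
  simple root currents are enough.\<close>

lemma positive_word_space:
  assumes "p < q" "q < n" "u \<in> word_space"
  shows "e p q m u \<in> word_space"
  using assms
proof (induction "q - p" arbitrary: q u m)
  case (Suc k)
  show ?case
  proof (cases "q = Suc p")
    case True
    then show ?thesis using x_word_space[of q u m] Suc.prems by (simp add: x_def)
  next
    case False
    have s: "e (q - 1) q a y \<in> word_space" if "y \<in> word_space" for a y
      using x_word_space[of q y a] Suc.prems that by (auto simp: x_def)
    have t: "e p (q - 1) a y \<in> word_space" if "y \<in> word_space" for a y
      using False Suc.prems Suc.hyps(2) that by (intro Suc.hyps(1)) auto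
    have "e p q m u = e p (q - 1) m (e (q - 1) q 0 u) - e (q - 1) q 0 (e p (q - 1) m u)"
      using comm_e[of p "q - 1" "q - 1" q m 0 u] False Suc.prems by auto
    then show ?thesis
      using s t Suc.prems(3) by (simp add: word_space_def span_diff)
  qed
qed simp

lemma d_act_word:
  assumes "fst ` set w \<subseteq> {1..<n}" "d u = z *s u"
  shows "d (act_word w u) = (z - of_int (sum_list (map snd w))) *s act_word w u"
  using assms
proof (induction w arbitrary: u z)
  case (Cons p w)
  obtain i m where p: "p = (i, m)" by (cases p)
  have i: "i - 1 < n" "i < n" using Cons.prems(1) p by auto
  have "d (x i m u) = (z - of_int m) *s x i m u"
    using comm_d[OF i, of m u] Cons.prems(2) i by (simp add: x_def e_simps scale_left_diff_distrib)
  from Cons.IH[OF _ this] show ?case using Cons.prems(1) p by (simp add: diff_diff_eq)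
qed simp

lemma h_act_word:
  assumes "fst ` set w \<subseteq> {1..<n}" "k \<le> n" "h k 0 u = z *s u"
  shows "h k 0 (act_word w u) = (z + of_nat (count_list (map fst w) k)) *s act_word w u"
  using assms
proof (induction w arbitrary: u z)
  case (Cons p w)
  obtain i m where p: "p = (i, m)" by (cases p)
  have i: "i \<in> {1..<n}" "i < n" using Cons.prems(1) p by auto
  have "h k 0 (x i m u) = (z + (if i = k then 1 else 0)) *s x i m u"
    using h_x[OF Cons.prems(2) i(1), of 0 m u] Cons.prems(3) i(2) by (simp add: x_scale scale_left_distrib)
  from Cons.IH[OF _ Cons.prems(2) this] show ?case using Cons.prems(1) p by (simp add: add.assoc)
qed simp

lemma h_v: "k \<le> n \<Longrightarrow> h k 0 v = 0 *s v"
  by (auto simp: h_def e_v intro!: sum.neutral)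

theorem word_basis:
  fixes cs N
  defines "B \<equiv> (\<lambda>ms. act_word (zip cs ms) v) ` admissible_lists (\<lambda>_. 0) cs N"
  assumes cs: "sorted cs" "set cs \<subseteq> {1..<n}"
  shows "finite B" "independent B" "card B = card (admissible_lists (\<lambda>_. 0) cs N)"
    and "\<And>w. mset (map fst w) = mset cs \<Longrightarrow> sum_list (map snd w) = - N \<Longrightarrow> act_word w v \<in> span B"
proof -
  have fin: "finite (admissible_lists (\<lambda>_. 0) cs N)"
    using card_admissible_lists[OF cs(1), of "\<lambda>_. 0" 0] by simp
  then show "finite B" by (simp add: B_def)
  have cut: "cutoff (\<lambda>_. 0) = (\<lambda>_. 0)" by (simp add: cutoff_def fun_eq_iff)
  have "\<forall>ms\<in>admissible_lists (\<lambda>_. 0) cs N. a ms = 0"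
    if "(\<Sum>ms\<in>admissible_lists (\<lambda>_. 0) cs N. a ms *s act_word (zip cs ms) v) = 0" for a
    using cut that by (intro admissible_words_independent[OF extremal_v cs fin]) (auto simp: admissible_lists_def)
  note fam = independent_family[OF fin this]
  show "independent B" unfolding B_def by (rule fam(2))
  show "card B = card (admissible_lists (\<lambda>_. 0) cs N)" unfolding B_def by (rule card_image[OF fam(1)])
  fix w assume w: "mset (map fst w) = mset cs" "sum_list (map snd w) = - N"
  have "B = {act_word (zip cs ms) v | ms. admissible (\<lambda>_. 0) cs ms \<and> sum_list ms = sum_list (map snd w)}"
    by (auto simp: B_def admissible_lists_def w(2))
  then show "act_word w v \<in> span B" using admissible_words_span_v[OF cs w(1)] by simp
qed

end

section \<open>Colour counts and coefficients of series\<close>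

lemma count_list_replicate: "count_list (replicate m x) y = (if x = y then m else 0)"
  by (induction m) auto

lemma sorted_list_with_counts:
  fixes l :: nat and r :: "nat \<Rightarrow> nat"
  shows "\<exists>cs. sorted cs \<and> set cs \<subseteq> {1..l} \<and> (\<forall>i\<in>{1..l}. count_list cs i = r i)"
proof (induction l)
  case 0
  then show ?case by (intro exI[of _ "[]"]) simp
next
  case (Suc l)
  then obtain cs where cs: "sorted cs" "set cs \<subseteq> {1..l}" "\<forall>i\<in>{1..l}. count_list cs i = r i" by blast
  have "count_list cs (Suc l) = 0" using cs(2) by (auto simp: count_list_0_iff)
  then show ?case
    using cs by (intro exI[of _ "cs @ replicate (r (Suc l)) (Suc l)"])
      (auto simp: sorted_append count_list_replicate set_replicate_conv_if le_Suc_eq)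
qed

lemma q_series_eq:
  assumes "\<forall>i\<in>{1..l}. fst E i = 0" "snd E = of_int z"
  shows "q_series l P E = (if 0 \<le> z then fps_nth P (nat z) else 0)"
proof -
  let ?g = "\<lambda>n::nat. if (\<forall>i\<in>{1..l}. fst E i = 0) \<and> snd E = of_nat n then fps_nth P n else 0"
  have g: "?g n = (if int n = z then fps_nth P n else 0)" for n
  proof -
    have "(of_int z = (of_nat n :: complex)) = (z = int n)"
      by (metis of_int_eq_iff of_int_of_nat_eq)
    then show ?thesis using assms by auto
  qed
  have "Sum_any ?g = (\<Sum>n\<in>{nat z}. ?g n)"
    unfolding g by (rule Sum_any.expand_superset) auto
  then show ?thesis unfolding q_series_def g by auto
qed

lemma q_series_nonzero:
  assumes "q_series l P E \<noteq> 0"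
  shows "(\<forall>i\<in>{1..l}. fst E i = 0) \<and> (\<exists>n::nat. snd E = of_nat n)"
proof (rule ccontr)
  assume "\<not> ?thesis"
  then have "(if (\<forall>i\<in>{1..l}. fst E i = 0) \<and> snd E = of_nat n then fps_nth P n else 0) = 0" for n by auto
  then show False using assms by (simp add: q_series_def)
qed

context standard
begin

abbreviation pair :: "nat \<Rightarrow> complex" where
  "pair k \<equiv> form (fund_weight l k) (fund_weight l j)"

lemma fund_weight_action: "k \<le> l \<Longrightarrow> act (loop l (fund_weight l k) 0) u = vac.h k 0 u + pair k *s u"
proof -
  assume k: "k \<le> l"
  have *: "act (loop l (fund_weight l k) 0) u = vac.h k 0 u + (\<Sum>p<k. wt p) *s u" for u
    unfolding loop_fund_weight[OF k] vac.h_def scale_sum_left sum.distrib[symmetric]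
    by (intro sum.cong refl) (simp add: e'_def wt_eq)
  have "(\<Sum>p<k. wt p) *s v = act (loop l (fund_weight l k) 0) v"
    using *[of v] vac.h_v[of k] k by simp
  also have "\<dots> = pair k *s v"
    unfolding v_cartan[OF fund_weight_in_cartan[OF k]] form_commute[OF fund_weight_carrier fund_weight_carrier] ..
  finally have "(\<Sum>p<k. wt p) = pair k" using v_nz by simp
  then show ?thesis using * by simp
qed

lemma sum_b: "(\<Sum>p<n. of_int (b p) *s f p) = (\<Sum>p<j. f p)"
  using j by (intro sum.mono_neutral_cong_right) (auto simp: b_def)

text \<open>Undoing the flow adds \<open>lambda_j(0)\<close> to the degree. Its eigenvalue counts
  the letters of colour \<open>j\<close>, which is the origin of \<open>r_j\<close> in the
  exponent.\<close>

lemma L0_action: "L0 l scale act u = d' u + act (loop l (fund_weight l j) 0) u"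
  unfolding d'_def sum_b loop_fund_weight[OF j] by simp

lemma fund_weight_word:
  assumes "fst ` set w \<subseteq> {1..l}" "k \<le> l"
  shows "act (loop l (fund_weight l k) 0) (vac.act_word w v)
    = (of_nat (count_list (map fst w) k) + pair k) *s vac.act_word w v"
proof -
  have w: "fst ` set w \<subseteq> {1..<n}" using assms(1) by auto
  show ?thesis
    unfolding fund_weight_action[OF assms(2)]
    using vac.h_act_word[OF w _ vac.h_v, of k] assms(2) by (simp add: scale_left_distrib)
qed

lemma L0_word:
  assumes "fst ` set w \<subseteq> {1..l}"
  shows "L0 l scale act (vac.act_word w v)
    = (of_int (int (count_list (map fst w) j) - sum_list (map snd w)) + 1 / 2 * pair j) *s vac.act_word w v"
proof -
  have w: "fst ` set w \<subseteq> {1..<n}" using assms(1) by auto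
  have "d' v = (1 / 2 * pair j - pair j) *s v"
  proof -
    have "d' v = L0 l scale act v - act (loop l (fund_weight l j) 0) v" by (simp add: L0_action)
    moreover have "act (loop l (fund_weight l j) 0) v = pair j *s v"
      using fund_weight_word[of "[]" j] j by simp
    ultimately show ?thesis by (simp only: L0_v scale_left_diff_distrib)
  qed
  then have "d' (vac.act_word w v) = (1 / 2 * pair j - pair j - of_int (sum_list (map snd w))) *s vac.act_word w v"
    by (rule vac.d_act_word[OF w])
  then have "L0 l scale act (vac.act_word w v) = (1 / 2 * pair j - pair j - of_int (sum_list (map snd w))
      + (of_nat (count_list (map fst w) j) + pair j)) *s vac.act_word w v"
    unfolding L0_action fund_weight_word[OF assms j] scale_left_distrib by simp
  then show ?thesis by (simp add: algebra_simps)
qed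

lemma e_eq_e': "p \<noteq> q \<Longrightarrow> e p q m = e' p q (m + b p - b q)"
  by (simp add: e'_def fun_eq_iff)

lemma word_colours: "fst ` set w \<subseteq> {1..<n} \<longleftrightarrow> fst ` set w \<subseteq> {1..l}"
  by auto

text \<open>The flow only renumbers the modes of each root current, so both actions of the nilpotent
  loop algebra generate the same subspace from \<open>v\<close>.\<close>

lemma principal_subspace_eq: "principal_subspace l scale act v = vac.word_space"
proof
  show "principal_subspace l scale act v \<subseteq> vac.word_space"
    unfolding principal_subspace_def
  proof (rule span_minimal)
    have "foldr act Xs v \<in> vac.word_space" if "set Xs \<subseteq> nbar l" for Xs
      using that
    proof (induction Xs)
      case Nil
      have "vac.act_word [] v \<in> vac.word_space"
        unfolding vac.word_space_def by (intro span_base CollectI exI[of _ "[]"]) simp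
      then show ?case by simp
    next
      case (Cons X Xs)
      then have X: "X \<in> nbar l" and u: "foldr act Xs v \<in> vac.word_space" by auto
      have "act X (foldr act Xs v) \<in> vac.word_space"
      proof (rule act_in_subspace[OF vac.subspace_word_space _ u])
        show "X \<in> aff l" using X by (auto simp: nbar_def)
        show "act (central l) (foldr act Xs v) \<in> vac.word_space" using u by (simp add: act_central)
      next
        fix p q m assume pq: "p \<le> l" "q \<le> l" "fst X m $$ (p, q) \<noteq> 0"
        have "fst X m $$ (p, q) = 0" if "q \<le> p" using X pq(1) that by (auto simp: nbar_def)
        then have lt: "p < q" using pq(3) by (meson not_less)
        then have "p \<noteq> q" by simp
        then show "e p q m (foldr act Xs v) \<in> vac.word_space"
          unfolding e_eq_e'[OF \<open>p \<noteq> q\<close>] using pq by (intro vac.positive_word_space[OF lt _ u]) simp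
      qed
      then show ?case by simp
    qed
    then show "{foldr act Xs v |Xs. set Xs \<subseteq> nbar l} \<subseteq> vac.word_space" by blast
  qed (rule vac.subspace_word_space)
next
  have "vac.act_word w v \<in> {foldr act Xs v |Xs. set Xs \<subseteq> nbar l}" if "fst ` set w \<subseteq> {1..<n}" for w
    using that
  proof (induction w rule: rev_induct)
    case Nil
    then show ?case by (auto intro!: exI[of _ "[]"])
  next
    case (snoc p w)
    obtain i m where p: "p = (i, m)" by (cases p)
    have i: "1 \<le> i" "i \<le> l" using snoc.prems p by auto
    obtain Xs where Xs: "vac.act_word w v = foldr act Xs v" "set Xs \<subseteq> nbar l" using snoc by auto
    let ?X = "loop l (root_vec l (i - 1) i) (m - b (i - 1) + b i)"
    have "root_vec l (i - 1) i \<in> sl l"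
      using traceless_unit_sl[of "i - 1" l i] traceless_unit_offdiag[of "i - 1" i l] i by simp
    then have "?X \<in> aff l" by (rule loop_aff)
    then have "?X \<in> nbar l" using i by (auto simp: nbar_def loop_def root_vec_def)
    moreover have "vac.act_word (w @ [p]) v = act ?X (foldr act Xs v)"
    proof -
      have "i - 1 \<noteq> i" using i by simp
      then have "e' (i - 1) i m u = act ?X u" for u
        unfolding e'_def e_def traceless_unit_offdiag[OF \<open>i - 1 \<noteq> i\<close>] by simp
      then have "vac.x i m u = act ?X u" for u by (simp only: vac.x_def)
      then show ?thesis unfolding Xs(1)[symmetric] p vac.act_word_append by simp
    qed
    ultimately show ?case using Xs(2) by (auto intro!: exI[of _ "?X # Xs"])
  qed
  then show "vac.word_space \<subseteq> principal_subspace l scale act v"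
    unfolding vac.word_space_def principal_subspace_def by (intro span_mono) blast
qed

lemma act_loop_linear:
  assumes "k \<le> l"
  shows "act (loop l (fund_weight l k) 0) (u + w) = act (loop l (fund_weight l k) 0) u + act (loop l (fund_weight l k) 0) w"
    "act (loop l (fund_weight l k) 0) (z *s u) = z *s act (loop l (fund_weight l k) 0) u"
proof -
  have "loop l (fund_weight l k) 0 \<in> aff l"
    using fund_weight_in_cartan[OF assms] by (intro loop_aff) (simp add: cartan_def)
  then show "act (loop l (fund_weight l k) 0) (u + w) = act (loop l (fund_weight l k) 0) u + act (loop l (fund_weight l k) 0) w"
    "act (loop l (fund_weight l k) 0) (z *s u) = z *s act (loop l (fund_weight l k) 0) u"
    by (auto simp: act_u_add act_u_scale)
qed

text \<open>Exponents are normalised as in the primed graded dimension: \<open>v\<close> itself sits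
  at zero.\<close>

definition hom :: "(nat \<Rightarrow> complex) \<Rightarrow> complex \<Rightarrow> 'v set" where
  "hom a w = homogeneous_subspace l scale act v (\<lambda>k. a k + pair k, w + 1 / 2 * pair j)"

definition matching :: "(nat \<Rightarrow> complex) \<Rightarrow> complex \<Rightarrow> (nat \<times> int) list \<Rightarrow> bool" where
  "matching a z w \<longleftrightarrow> fst ` set w \<subseteq> {1..l} \<and> (\<forall>k\<in>{1..l}. a k = of_nat (count_list (map fst w) k))
     \<and> z = of_int (int (count_list (map fst w) j) - sum_list (map snd w))"

lemma word_in_hom: "matching a z w \<Longrightarrow> vac.act_word w v \<in> hom a z"
proof -
  assume m: "matching a z w"
  then have w: "fst ` set w \<subseteq> {1..l}" by (simp add: matching_def)
  then have "vac.act_word w v \<in> vac.word_space"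
    unfolding vac.word_space_def word_colours by (intro span_base) blast
  then show ?thesis
    using m w unfolding hom_def homogeneous_subspace_def principal_subspace_eq
    by (simp add: matching_def fund_weight_word L0_word)
qed

lemma hom_subset: "hom a z \<subseteq> span {vac.act_word w v | w. matching a z w}"
proof
  fix u assume u: "u \<in> hom a z"
  \<comment> \<open>Index 0, which labels no charge, is used for the weight, so that all gradings
    form one finite family.\<close>
  define T where "T k = (if k = 0 then L0 l scale act else act (loop l (fund_weight l k) 0))" for k
  define ch where "ch k = (if k = 0 then z + 1 / 2 * pair j else a k + pair k)" for k
  let ?G = "{vac.act_word w v | w. fst ` set w \<subseteq> {1..l}}"
  have Tw: "T k (vac.act_word w v) = (if k = 0 then
      of_int (int (count_list (map fst w) j) - sum_list (map snd w)) + 1 / 2 * pair j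
      else of_nat (count_list (map fst w) k) + pair k) *s vac.act_word w v"
    if "fst ` set w \<subseteq> {1..l}" "k \<le> l" for w k
    using that by (auto simp: T_def fund_weight_word L0_word)
  have "u \<in> span {g \<in> ?G. \<forall>k\<in>{..l}. T k g = ch k *s g}"
  proof (rule joint_eigenvector_in_span)
    show "T k (u + w) = T k u + T k w" "T k (y *s u) = y *s T k u" if "k \<in> {..l}" for k u w y
      using that by (auto simp: T_def act_loop_linear cur.d_add cur.d_scale)
    show "\<exists>z. T k g = z *s g" if "k \<in> {..l}" "g \<in> ?G" for k g
      using that Tw by blast
    show "u \<in> span ?G"
      using u unfolding hom_def homogeneous_subspace_def principal_subspace_eq vac.word_space_def word_colours by simp
    show "T k u = ch k *s u" if "k \<in> {..l}" for k
      using u that by (auto simp: hom_def homogeneous_subspace_def T_def ch_def)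
  qed simp
  moreover have "{g \<in> ?G. \<forall>k\<in>{..l}. T k g = ch k *s g} \<subseteq> span {vac.act_word w v | w. matching a z w}"
  proof
    fix g assume "g \<in> {g \<in> ?G. \<forall>k\<in>{..l}. T k g = ch k *s g}"
    then obtain w where w: "g = vac.act_word w v" "fst ` set w \<subseteq> {1..l}" and eig: "\<And>k. k \<le> l \<Longrightarrow> T k g = ch k *s g"
      by auto
    show "g \<in> span {vac.act_word w v | w. matching a z w}"
    \<comment> \<open>A word may act as zero; then its eigenvalues say nothing about its letters,
      but it lies in every span.\<close>
    proof (cases "g = 0")
      case False
      have "matching a z w"
        unfolding matching_def
      proof (intro conjI ballI w(2))
        fix k assume "k \<in> {1..l}"
        then show "a k = of_nat (count_list (map fst w) k)"
          using eig[of k] Tw[OF w(2), of k] False w(1) by (simp add: ch_def)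
      next
        show "z = of_int (int (count_list (map fst w) j) - sum_list (map snd w))"
          using eig[of 0] Tw[OF w(2), of 0] False w(1) by (simp add: ch_def)
      qed
      then show ?thesis using w(1) by (intro span_base) blast
    qed (simp add: span_zero)
  qed
  ultimately show "u \<in> span {vac.act_word w v | w. matching a z w}"
    using span_minimal[OF _ subspace_span] by blast
qed

text \<open>One formula serves all \<open>j\<close>. For \<open>j = 0\<close> the term is switched
  off, because the value of \<open>r\<close> outside \<open>{1..l}\<close> is arbitrary.\<close>

definition character :: series where
  "character = multi_sum l (\<lambda>r. monom_mult (\<lambda>i. of_nat (r i)) 0
     (q_frac l (quad l r + (if j = 0 then 0 else int (r j))) r))"

lemma hom_basis: "\<exists>B. finite B \<and> B \<subseteq> hom a z \<and> independent B \<and> hom a z \<subseteq> span B \<and> of_nat (card B) = character (a, z)"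
proof -
  define Q where "Q r = quad l r + (if j = 0 then 0 else int (r j))" for r
  define F where "F r = monom_mult (\<lambda>i. of_nat (r i)) 0 (q_frac l (Q r) r) (a, z)" for r
  have F: "F r = q_series l (inverse (\<Prod>i=1..l. q_poch (r i))) (\<lambda>i. a i - of_nat (r i), z - of_int (Q r))" for r
    by (simp add: F_def monom_mult_def q_frac_def)
  have ch: "character (a, z) = Sum_any (\<lambda>r. if r \<in> {1..l} \<rightarrow>\<^sub>E UNIV then F r else 0)"
    unfolding character_def multi_sum_def F_def Q_def by (rule refl)
  have F_nz: "(\<forall>i\<in>{1..l}. a i = of_nat (r i)) \<and> (\<exists>M::int. z = of_int M)" if nz: "F r \<noteq> 0" for r
  proof -
    from q_series_nonzero[OF nz[unfolded F]] obtain k :: nat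
      where "\<forall>i\<in>{1..l}. a i - of_nat (r i) = 0" and "z - of_int (Q r) = of_nat k" by auto
    then have "z = of_int (int k + Q r)" by (simp add: algebra_simps)
    then have "\<exists>M::int. z = of_int M" by blast
    then show ?thesis using \<open>\<forall>i\<in>{1..l}. a i - of_nat (r i) = 0\<close> by auto
  qed
  show ?thesis
  proof (cases "\<exists>r\<in>{1..l} \<rightarrow>\<^sub>E UNIV. (\<forall>i\<in>{1..l}. a i = of_nat (r i :: nat)) \<and> (\<exists>M::int. z = of_int M)")
    \<comment> \<open>Other exponents occur on neither side: no word matches them and no
      \<open>r\<close> contributes.\<close>
    case False
    have none: "\<not> matching a z w" for w
    proof
      assume m: "matching a z w"
      have "restrict (count_list (map fst w)) {1..l} \<in> {1..l} \<rightarrow>\<^sub>E UNIV"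
        "\<forall>i\<in>{1..l}. a i = of_nat (restrict (count_list (map fst w)) {1..l} i)" 
        using m unfolding matching_def by (auto simp: restrict_def)
      moreover have "\<exists>M::int. z = of_int M"
        using m unfolding matching_def by blast
      ultimately show False using False by blast
    qed
    have "(if r \<in> {1..l} \<rightarrow>\<^sub>E UNIV then F r else 0) = 0" for r
      using False F_nz[of r] by auto
    then have "character (a, z) = 0" unfolding ch by simp
    moreover have "hom a z \<subseteq> span {}" using hom_subset[of a z] none by simp
    ultimately show ?thesis by (intro exI[of _ "{}"]) (simp add: independent_empty)
  next
    case True
    then obtain r and M :: int where r: "r \<in> {1..l} \<rightarrow>\<^sub>E UNIV" "\<forall>i\<in>{1..l}. a i = of_nat (r i)" and M: "z = of_int M"
      by blast
    obtain cs where cs: "sorted cs" "set cs \<subseteq> {1..l}" "\<forall>i\<in>{1..l}. count_list cs i = r i"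
      using sorted_list_with_counts[of l r] by blast
    have csn: "set cs \<subseteq> {1..<n}" using cs(2) by auto
    \<comment> \<open>Of the degree \<open>M\<close> above the highest weight, the letters of colour
      \<open>j\<close> contribute \<open>r_j\<close>; the rest is minus the sum of the
      modes.\<close>
    define N where "N = M - int (count_list cs j)"
    define B where "B = (\<lambda>ms. vac.act_word (zip cs ms) v) ` admissible_lists (\<lambda>_. 0) cs N"
    note basis = vac.word_basis[where N = N, OF cs(1) csn, folded B_def]
    have "B \<subseteq> hom a z"
    proof
      fix y assume "y \<in> B"
      then obtain ms where ms: "y = vac.act_word (zip cs ms) v" "admissible (\<lambda>_. 0) cs ms" "sum_list ms = - N"
        by (auto simp: B_def admissible_lists_def)
      have "map fst (zip cs ms) = cs" "map snd (zip cs ms) = ms" using admissible_length[OF ms(2)] by auto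
      moreover from this(1) have "fst ` set (zip cs ms) = set cs" by (metis set_map)
      ultimately have "matching a z (zip cs ms)"
        using cs r(2) M ms(3) by (simp add: matching_def N_def)
      then show "y \<in> hom a z" using word_in_hom ms(1) by simp
    qed
    moreover have "hom a z \<subseteq> span B"
    proof -
      have "vac.act_word w v \<in> span B" if m: "matching a z w" for w
      proof (rule basis(4))
        show mset: "mset (map fst w) = mset cs"
        proof (rule multiset_eqI)
          fix k
          show "count (mset (map fst w)) k = count (mset cs) k"
          proof (cases "k \<in> {1..l}")
            case True
            then have "of_nat (count_list (map fst w) k) = (of_nat (r k) :: complex)"
              using m r(2) by (simp add: matching_def)
            then have "count_list (map fst w) k = r k" by (simp only: of_nat_eq_iff)
            then show ?thesis using True cs(3) by (simp only: count_mset)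
          next
            case False
            then have "k \<notin> set (map fst w)" "k \<notin> set cs" using m cs(2) by (auto simp: matching_def)
            then show ?thesis by (metis count_mset_0_iff)
          qed
        qed
        have "of_int M = (of_int (int (count_list (map fst w) j) - sum_list (map snd w)) :: complex)"
          using m M by (simp add: matching_def)
        then have "M = int (count_list (map fst w) j) - sum_list (map snd w)" by (simp only: of_int_eq_iff)
        moreover have "count_list (map fst w) j = count_list cs j"
          using arg_cong[OF mset, of "\<lambda>A. count A j"] by (simp only: count_mset)
        ultimately show "sum_list (map snd w) = - N" by (simp add: N_def)
      qed
      then have "span {vac.act_word w v | w. matching a z w} \<subseteq> span B" by (intro span_minimal) auto
      then show ?thesis using hom_subset by blast
    qed
    moreover have "of_nat (card B) = character (a, z)"
    proof -
      have "count_list cs i = r i" if "1 \<le> i" "i \<le> l" for i using cs(3) that by simp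
      then have quad: "quad l (count_list cs) = quad l r"
        unfolding quad_def by (intro arg_cong2[of _ _ _ _ "(-)"] sum.cong) auto
      have den: "denominator cs = (\<Prod>i=1..l. q_poch (r i))"
        unfolding denominator_eq[OF cs(2)] using cs(3) by (intro prod.cong) auto
      have rj: "int (count_list cs j) = (if j = 0 then 0 else int (r j))"
      proof (cases "j = 0")
        case True
        then have "j \<notin> set cs" using cs(2) by auto
        then show ?thesis using True count_list_0_iff by fastforce
      qed (use cs(3) j in simp)
      \<comment> \<open>The charges determine \<open>r\<close>, so the multiple sum has a single
        summand.\<close>
      have "character (a, z) = (\<Sum>r\<in>{r}. if r \<in> {1..l} \<rightarrow>\<^sub>E UNIV then F r else 0)"
        unfolding ch
      proof (rule Sum_any.expand_superset)
        show "{r. (if r \<in> {1..l} \<rightarrow>\<^sub>E UNIV then F r else 0) \<noteq> 0} \<subseteq> {r}"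
        proof
          fix r' assume "r' \<in> {r. (if r \<in> {1..l} \<rightarrow>\<^sub>E UNIV then F r else 0) \<noteq> 0}"
          then have r': "r' \<in> {1..l} \<rightarrow>\<^sub>E UNIV" "F r' \<noteq> 0" by (auto split: if_splits)
          have "r' i = r i" if "i \<in> {1..l}" for i
          proof -
            have "of_nat (r' i) = (of_nat (r i) :: complex)" using F_nz[OF r'(2)] r(2) that by metis
            then show ?thesis by (simp only: of_nat_eq_iff)
          qed
          then have "r' = r" by (intro PiE_ext[OF r'(1) r(1)])
          then show "r' \<in> {r}" by simp
        qed
      qed simp
      also have "\<dots> = F r" using r(1) by simp
      also have "\<dots> = (if 0 \<le> M - Q r then fps_nth (inverse (denominator cs)) (nat (M - Q r)) else 0)"
        unfolding F den using r(2) M by (intro q_series_eq) auto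
      also have "\<dots> = of_nat (card B)"
        using card_admissible_lists[OF cs(1), of "\<lambda>_. 0" 0 N]
        by (simp add: basis(3) min_degree_quad[OF cs(1,2)] quad Q_def N_def rj algebra_simps)
      finally show ?thesis by simp
    qed
    ultimately show ?thesis using basis(1,2) by blast
  qed
qed

lemma graded_dim_eq:
  "graded_dim l scale act v (\<lambda>k. a k + pair k, z + 1 / 2 * pair j) = character (a, z)"
proof -
  obtain B where B: "finite B" "B \<subseteq> hom a z" "independent B" "hom a z \<subseteq> span B" "of_nat (card B) = character (a, z)"
    using hom_basis[of a z] by blast
  have "dim (hom a z) = card B" by (rule dim_unique[OF B(2,4,3) refl])
  then show ?thesis using B(5) by (simp add: graded_dim_def hom_def)
qed

lemma graded_dim_exists: "graded_dim_exists l scale act v"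
  unfolding graded_dim_exists_def
proof (intro conjI allI)
  have "(\<Union>E. homogeneous_subspace l scale act v E) \<subseteq> principal_subspace l scale act v"
    by (auto simp: homogeneous_subspace_def)
  then have "span (\<Union>E. homogeneous_subspace l scale act v E) \<subseteq> principal_subspace l scale act v"
    by (rule span_minimal) (simp add: principal_subspace_def)
  moreover have "principal_subspace l scale act v \<subseteq> span (\<Union>E. homogeneous_subspace l scale act v E)"
    unfolding principal_subspace_eq vac.word_space_def
  proof (rule span_mono, clarify)
    fix w :: "(nat \<times> int) list" assume w: "fst ` set w \<subseteq> {1..<n}"
    let ?a = "\<lambda>k. of_nat (count_list (map fst w) k)"
      and ?z = "of_int (int (count_list (map fst w) j) - sum_list (map snd w))"
    have "matching ?a ?z w" using w by (auto simp: matching_def)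
    then show "vac.act_word w v \<in> (\<Union>E. homogeneous_subspace l scale act v E)"
      using word_in_hom unfolding hom_def by blast
  qed
  ultimately show "span (\<Union>E. homogeneous_subspace l scale act v E) = principal_subspace l scale act v" by simp
next
  fix E :: exponent
  obtain a :: "nat \<Rightarrow> complex" and z where E: "E = (a, z)" by (cases E)
  obtain B where "finite B" "hom (\<lambda>k. a k - pair k) (z - 1 / 2 * pair j) \<subseteq> span B"
    using hom_basis[of "\<lambda>k. a k - pair k" "z - 1 / 2 * pair j"] by blast
  then show "\<exists>B. finite B \<and> homogeneous_subspace l scale act v E \<subseteq> span B"
    unfolding E hom_def by auto
qed

end

theorem corollary4p1:
  fixes l :: nat
  assumes "2 \<le> l"
  shows
    "(\<forall>(scale :: complex \<Rightarrow> 'v::ab_group_add \<Rightarrow> 'v) act v. standard_module l 0 scale act v \<longrightarrow>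
        graded_dim_exists l scale act v \<and>
        graded_dim l scale act v =
          multi_sum l (\<lambda>r. monom_mult (\<lambda>i. of_nat (r i)) 0 (q_frac l (quad l r) r))) \<and>
     (\<forall>j\<in>{1..l}. \<forall>(scale :: complex \<Rightarrow> 'v \<Rightarrow> 'v) act v. standard_module l j scale act v \<longrightarrow>
        graded_dim_exists l scale act v \<and>
        graded_dim' l j scale act v =
          multi_sum l (\<lambda>r. monom_mult (\<lambda>i. of_nat (r i)) 0 (q_frac l (quad l r + int (r j)) r)) \<and>
        graded_dim l scale act v =
          monom_mult (\<lambda>k. form (fund_weight l k) (fund_weight l j))
            (1 / 2 * form (fund_weight l j) (fund_weight l j)) (graded_dim' l j scale act v))"
proof (intro conjI allI ballI impI)
  have std: "standard scale l j act v" if "standard_module l j scale act v" "j \<le> l"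
    for scale :: "complex \<Rightarrow> 'v \<Rightarrow> 'v" and j act v
    using that by (intro standard.intro standard_axioms.intro) (auto simp: standard_module_def aff_module_def)
  {
    fix scale :: "complex \<Rightarrow> 'v \<Rightarrow> 'v" and act v
    assume "standard_module l 0 scale act v"
    then interpret standard scale l 0 act v by (intro std) simp_all
    show "graded_dim_exists l scale act v" by (rule graded_dim_exists)
    have pair: "form (fund_weight l k) (fund_weight l 0) = 0" for k
      unfolding fund_weight_0 form_def right_mult_zero_mat[OF fund_weight_carrier] by (simp add: mtrace_def)
    show "graded_dim l scale act v = multi_sum l (\<lambda>r. monom_mult (\<lambda>i. of_nat (r i)) 0 (q_frac l (quad l r) r))"
    proof
      fix E
      show "graded_dim l scale act v E = multi_sum l (\<lambda>r. monom_mult (\<lambda>i. of_nat (r i)) 0 (q_frac l (quad l r) r)) E"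
        using graded_dim_eq[of "fst E" "snd E"] by (simp add: pair character_def)
    qed
  }
  fix j and scale :: "complex \<Rightarrow> 'v \<Rightarrow> 'v" and act v
  assume j1: "j \<in> {1..l}" and "standard_module l j scale act v"
  then interpret standard scale l j act v by (intro std) simp_all
  show "graded_dim_exists l scale act v" by (rule graded_dim_exists)
  show "graded_dim' l j scale act v = multi_sum l (\<lambda>r. monom_mult (\<lambda>i. of_nat (r i)) 0 (q_frac l (quad l r + int (r j)) r))"
  proof
    fix E
    have "graded_dim' l j scale act v E = character (fst E, snd E)"
      unfolding graded_dim_eq[symmetric] by (simp add: graded_dim'_def monom_mult_def)
    then show "graded_dim' l j scale act v E = multi_sum l (\<lambda>r. monom_mult (\<lambda>i. of_nat (r i)) 0 (q_frac l (quad l r + int (r j)) r)) E"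
      using j1 by (simp add: character_def)
  qed
  show "graded_dim l scale act v = monom_mult (\<lambda>k. form (fund_weight l k) (fund_weight l j))
      (1 / 2 * form (fund_weight l j) (fund_weight l j)) (graded_dim' l j scale act v)"
    by (simp add: graded_dim'_def monom_mult_def fun_eq_iff)
qed

end
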